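(* Consider the generalized linear model with binary response $y\in\{0,1\}$ and density $f(y,h)$, the i.i.d. data $D^n$ from the true density $p^*(y|x)=f(y,x^T\beta^* )$, and the truncated i.i.d.-binary / Gaussian variable selection prior with parameters $r_n,\bar r_n,\{V_\gamma\}$, all as described in the context. Assume $|x_j|\le 1$ for all $j$ and $\lim_{n\to\infty}\sum_{j=1}^{K_n}|\beta_j^*|<\infty$, where $K_n$ is a nondecreasing sequence in $n$. Define $$\Delta(r_n)=\inf_{\gamma:|\gamma|=r_n}\sum_{j:j\notin\gamma}|\beta_j^*|,\quad B(r_n)=\sup_{\gamma:|\gamma|=r_n}\mathrm{ch}_1(V_\gamma^{-1}),\quad \bar B(r_n)=\sup_{\gamma:|\gamma|=r_n}\mathrm{ch}_1(V_\gamma),\quad \tilde B_n=\sup_{\gamma:|\gamma|\le\bar r_n}\mathrm{ch}_1(V_\gamma),$$ and $D(R)=1+R\cdot\sup_{|h|\le R}|a'(h)|\cdot\sup_{|h|\le R}|\psi(h)|$ for $R>0$. Let $\varepsilon_n\in(0,1]$ be a sequence with $n\varepsilon_n^2\succ 1$, and assume $$\bar r_n\ln(1/\varepsilon_n^2)\prec n\varepsilon_n^2,\qquad \bar r_n\ln(K_n)\prec n\varepsilon_n^2,\qquad \bar r_n\ln D\big(\bar r_n\sqrt{n\varepsilon_n^2\tilde B_n}\big)\prec n\varepsilon_n^2,$$ $$1\le r_n\le\bar r_n<K_n,\qquad 1\prec r_n\prec K_n,\qquad \Delta(r_n)\prec\varepsilon_n^2,\qquad B(r_n)\prec n\varepsilon_n^2,\qquad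 r_n\ln\bar B(r_n)\prec n\varepsilon_n^2.$$ Let $A$ be a (possibly data-dependent) selection rule with $\pi\{p\in A|D^n\}>r$ for some constant $r>0$, let $\hat p_A$ be the corresponding selected posterior estimate, $\hat\mu_A(x)=\int y\,\hat p_A(y|x)\,\nu_y(dy)$, and $\hat C_A(x)=I[\hat\mu_A(x)>0.5]$. Let $L^*=P^*_{(x,y)}\{C^*(x)\ne y\}$ be the Bayes error, where $C^*(x)=I[\mu^*(x)>1/2]$ and $\mu^*(x)=E(y|x)$ is the true mean function. Then for all large enough $n$, $$E^*_{D^n}P^*_{(x,y)}(\hat C_A(x)\ne y\,|\,D^n)-L^*\le 5\varepsilon_n.$$
   Context: Notation. For sequences, $a_n\prec b_n$ (equivalently $b_n\succ a_n$) means $\lim_{n\to\infty}a_n/b_n=0$. $\mathrm{ch}_1$ denotes the largest eigenvalue of a symmetric matrix. $I[\cdot]$ is the indicator function. Model. For each $n$, $x=(x_1,\dots,x_{K_n})^T$ is a random vector with probability law $\nu_x(dx)$, and $y\in\{0,1\}$ with $\nu_y$ the counting measure on $\{0,1\}$. The GLM density is $f(y,h)=\exp\{a(h)y+b(h)+c(y)\}$, a probability density with respect to $\nu_y$ for each real $h$, where $a,b$ are continuously differentiable and $a$ has nonzero derivative; its mean is $\psi(h)=-b'(h)/a'(h)$. (Logistic and probit regression are examples.) The true conditional density of $y$ given $x$ is $p^*(y|x)=f(y,x^T\beta^* )$ for a true vector $\beta^*=(\beta_1^*,\dots,\beta_{K_n}^* )^T$; it is also the joint density of $(x,y)$ with respect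 to $\nu_x(dx)\nu_y(dy)$. The data $D^n=(x^{(i)},y^{(i)})_{i=1}^n$ are i.i.d. from $p^*\,\nu_x(dx)\nu_y(dy)$; $E^*_{D^n}$ denotes expectation over $D^n$, and $P^*_{(x,y)}$ is the probability for a new pair $(x,y)$ with the same law, independent of $D^n$. Fitted models. A model is $\gamma=(\gamma_1,\dots,\gamma_{K_n})\in\{0,1\}^{K_n}$, identified with the index set $\{j:\gamma_j=1\}$; $|\gamma|$ is its size; $v_\gamma$ is the subvector of $v$ with indices in $\gamma$. With coefficients $\beta_\gamma\in\mathbb R^{|\gamma|}$ the fitted density is $p(y,x|\gamma,\beta_\gamma)=p(y|x)=f(y,x_\gamma^T\beta_\gamma)$ (linear parameter $0$ for the empty model). Suprema of eigenvalues of $V_\gamma$ are over nonempty $\gamma\subset\{1,\dots,K_n\}$. Prior. $r_n\le\bar r_n$ are integers. Let $\tilde\gamma_1,\dots,\tilde\gamma_{K_n}$ be i.i.d. binary with $\pi(\tilde\gamma_j=1)=\lambda_n=r_n/K_n$; $\gamma$ is distributed as $\tilde\gamma$ conditioned on $\sum_j\tilde\gamma_j\le\bar r_n$, i.e. $\pi(\gamma)\propto\prod_{j=1}^{K_n}\lambda_n^{\gamma_j}(1-\lambda_n)^{1-\gamma_j}\,I[\sum_l\gamma_l\le\bar r_n]$. Conditional on $\gamma$, $\beta_\gamma\sim N(0,V_\gamma)$ with $V_\gamma$ a given $|\gamma|\times|\gamma|$ (positive definite) covariance matrix. The posterior is $$\pi(\gamma,d\beta_\gamma|D^n)=\frac{\prod_{i=1}^np(y^{(i)},x^{(i)}|\gamma,\beta_\gamma)\,\pi(\gamma,d\beta_\gamma)}{\sum_{\gamma'}\int\prod_{i=1}^np(y^{(i)},x^{(i)}|\gamma',\beta'_{\gamma'})\,\pi(\gamma',d\beta'_{\gamma'})},$$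 and it induces a posterior distribution $\pi(dp|D^n)$ on densities $p=p(\cdot|\gamma,\beta_\gamma)$. Selected posterior estimate. For a selection rule $A$ (a possibly data-dependent set of densities), $\hat p_A=\int p\,\pi_A(dp|D^n)$, where $\pi_A(dp|D^n)=\pi(dp|D^n,\,p\in A)$ is the posterior conditioned on $p\in A$. *)

theory Defs
  imports
    "HOL-Probability.Probability"
    "Jordan_Normal_Form.Char_Poly"
    "Jordan_Normal_Form.Gauss_Jordan_Elimination"
begin

definition asymp_less :: "(nat \<Rightarrow> real) \<Rightarrow> (nat \<Rightarrow> real) \<Rightarrow> bool"  (infix "\<prec>" 50)
  where "u \<prec> v \<longleftrightarrow> (\<lambda>n. u n / v n) \<longlonglongrightarrow> 0"

text \<open>Since \<open>K\<^sub>n\<close> and the size of a model vary with \<open>n\<close>, matrices are those of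
  \<open>Jordan_Normal_Form\<close>, whose dimensions are numbers rather than types.\<close>

definition pos_def_mat :: "nat \<Rightarrow> real Matrix.mat \<Rightarrow> bool" where
  "pos_def_mat k M \<longleftrightarrow> M \<in> carrier_mat k k \<and> transpose_mat M = M \<and>
     (\<forall>v\<in>carrier_vec k. v \<noteq> 0\<^sub>v k \<longrightarrow> 0 < scalar_prod v (M *\<^sub>v v))"

abbreviation mat_inv :: "real Matrix.mat \<Rightarrow> real Matrix.mat" where
  "mat_inv M \<equiv> the (mat_inverse M)"

definition ch1 :: "real Matrix.mat \<Rightarrow> real" where
  "ch1 M = Max {e. eigenvalue M e}"

text \<open>The response is a \<open>bool\<close>, with \<open>True\<close> standing for \<open>1\<close>; the dominating measure
  \<open>\<nu>\<^sub>y\<close> is then the counting measure on \<open>bool\<close>.  Vectors in \<open>\<real>\<^sup>K\<close> are the elements of the product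
  space over the index set \<open>{1..K}\<close>, and a model is a set of indices.\<close>

abbreviation nu_y :: "bool measure" where "nu_y \<equiv> count_space UNIV"

definition glm_pdf ::
    "(real \<Rightarrow> real) \<Rightarrow> (real \<Rightarrow> real) \<Rightarrow> (bool \<Rightarrow> real) \<Rightarrow> bool \<Rightarrow> real \<Rightarrow> real" where
  "glm_pdf a b c y h = exp (a h * of_bool y + b h + c y)"

definition is_glm :: "(real \<Rightarrow> real) \<Rightarrow> (real \<Rightarrow> real) \<Rightarrow> (bool \<Rightarrow> real) \<Rightarrow> bool" where
  "is_glm a b c \<longleftrightarrow>
     (\<forall>h. a field_differentiable at h) \<and> continuous_on UNIV (deriv a) \<and>
     (\<forall>h. b field_differentiable at h) \<and> continuous_on UNIV (deriv b) \<and>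
     (\<forall>h. deriv a h \<noteq> 0) \<and>
     (\<forall>h. (\<integral>y. glm_pdf a b c y h \<partial>nu_y) = 1)"

definition glm_psi :: "(real \<Rightarrow> real) \<Rightarrow> (real \<Rightarrow> real) \<Rightarrow> real \<Rightarrow> real" where
  "glm_psi a b h = - deriv b h / deriv a h"

definition glm_D :: "(real \<Rightarrow> real) \<Rightarrow> (real \<Rightarrow> real) \<Rightarrow> real \<Rightarrow> real" where
  "glm_D a b R =
     1 + R * (SUP h\<in>{h. \<bar>h\<bar> \<le> R}. \<bar>deriv a h\<bar>) * (SUP h\<in>{h. \<bar>h\<bar> \<le> R}. \<bar>glm_psi a b h\<bar>)"

type_synonym cov = "nat \<Rightarrow> real"
type_synonym param = "nat set \<times> (nat \<Rightarrow> real)"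
type_synonym cdens = "bool \<Rightarrow> cov \<Rightarrow> real"
type_synonym dataset = "nat \<Rightarrow> cov \<times> bool"

definition cov_space :: "nat \<Rightarrow> cov measure" where
  "cov_space K = Pi\<^sub>M {1..K} (\<lambda>_. borel)"

definition model_density :: "(bool \<Rightarrow> real \<Rightarrow> real) \<Rightarrow> param \<Rightarrow> cdens" where
  "model_density f \<theta> y x = f y (\<Sum>j\<in>fst \<theta>. x j * snd \<theta> j)"

definition obs_law :: "cov measure \<Rightarrow> cdens \<Rightarrow> (cov \<times> bool) measure" where
  "obs_law \<nu> p = density (\<nu> \<Otimes>\<^sub>M nu_y) (\<lambda>(x, y). ennreal (p y x))"

definition data_law :: "nat \<Rightarrow> cov measure \<Rightarrow> cdens \<Rightarrow> dataset measure" where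
  "data_law n \<nu> p = Pi\<^sub>M {1..n} (\<lambda>_. obs_law \<nu> p)"

definition model_prior :: "nat \<Rightarrow> nat \<Rightarrow> nat \<Rightarrow> nat set pmf" where
  "model_prior K r rbar =
     cond_pmf (map_pmf Collect (Pi_pmf {1..K} False (\<lambda>_. bernoulli_pmf (real r / real K))))
       {\<gamma>. card \<gamma> \<le> rbar}"

text \<open>The subvector \<open>v\<^sub>\<gamma>\<close>, with the indices in \<open>\<gamma>\<close> in increasing order; this is also the order
  of the rows and columns of \<open>V\<^sub>\<gamma>\<close>.\<close>

definition subvec :: "nat set \<Rightarrow> (nat \<Rightarrow> real) \<Rightarrow> real Matrix.vec" where
  "subvec \<gamma> v = vec_of_list (map v (sorted_list_of_set \<gamma>))"

definition mvn_density :: "real Matrix.mat \<Rightarrow> real Matrix.vec \<Rightarrow> real" where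
  "mvn_density M v =
     exp (- scalar_prod v (mat_inv M *\<^sub>v v) / 2) / sqrt ((2 * pi) ^ dim_row M * Determinant.det M)"

definition coef_prior :: "nat set \<Rightarrow> real Matrix.mat \<Rightarrow> (nat \<Rightarrow> real) measure" where
  "coef_prior \<gamma> M = density (Pi\<^sub>M \<gamma> (\<lambda>_. lborel)) (\<lambda>\<beta>. ennreal (mvn_density M (subvec \<gamma> \<beta>)))"

text \<open>The coefficients of all models are collected in one space by setting \<open>\<beta>\<^sub>j = 0\<close> for
  \<open>j \<notin> \<gamma>\<close>; these entries do not enter \<open>model_density\<close>.\<close>

definition param_space :: "nat \<Rightarrow> param measure" where
  "param_space K = count_space (Pow {1..K}) \<Otimes>\<^sub>M Pi\<^sub>M {1..K} (\<lambda>_. borel)"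

definition zero_extend :: "nat \<Rightarrow> nat set \<Rightarrow> (nat \<Rightarrow> real) \<Rightarrow> nat \<Rightarrow> real" where
  "zero_extend K \<gamma> \<beta> = (\<lambda>j\<in>{1..K}. if j \<in> \<gamma> then \<beta> j else 0)"

text \<open>The model prior is restricted to \<open>Pow {1..K}\<close>, which carries all its mass, because
  \<open>bind\<close> requires a probability kernel and \<open>V\<^sub>\<gamma>\<close> is specified only for these \<open>\<gamma>\<close>.\<close>

definition prior :: "nat \<Rightarrow> nat \<Rightarrow> nat \<Rightarrow> (nat set \<Rightarrow> real Matrix.mat) \<Rightarrow> param measure" where
  "prior K r rbar V =
     restrict_space (measure_pmf (model_prior K r rbar)) (Pow {1..K}) \<bind>
       (\<lambda>\<gamma>. distr (coef_prior \<gamma> (V \<gamma>)) (param_space K) (\<lambda>\<beta>. (\<gamma>, zero_extend K \<gamma> \<beta>)))"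

definition likelihood :: "(bool \<Rightarrow> real \<Rightarrow> real) \<Rightarrow> nat \<Rightarrow> dataset \<Rightarrow> param \<Rightarrow> real" where
  "likelihood f n D \<theta> = (\<Prod>i\<in>{1..n}. model_density f \<theta> (snd (D i)) (fst (D i)))"

definition posterior ::
    "(bool \<Rightarrow> real \<Rightarrow> real) \<Rightarrow> param measure \<Rightarrow> nat \<Rightarrow> dataset \<Rightarrow> param measure" where
  "posterior f \<pi> n D =
     density \<pi> (\<lambda>\<theta>. ennreal (likelihood f n D \<theta>) / (\<integral>\<^sup>+\<theta>'. ennreal (likelihood f n D \<theta>') \<partial>\<pi>))"

definition sel_event :: "(bool \<Rightarrow> real \<Rightarrow> real) \<Rightarrow> nat \<Rightarrow> cdens set \<Rightarrow> param set" where
  "sel_event f K A = {\<theta> \<in> space (param_space K). model_density f \<theta> \<in> A}"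

definition selected_estimate ::
    "(bool \<Rightarrow> real \<Rightarrow> real) \<Rightarrow> nat \<Rightarrow> param measure \<Rightarrow> nat \<Rightarrow> dataset \<Rightarrow> cdens set \<Rightarrow> cdens" where
  "selected_estimate f K \<pi> n D A y x =
     (\<integral>\<theta>. model_density f \<theta> y x \<partial>uniform_measure (posterior f \<pi> n D) (sel_event f K A))"

text \<open>A selection rule maps a data set to a set of densities; measurability is joint in the data
  and the parameter.\<close>

definition selection_rule ::
    "(bool \<Rightarrow> real \<Rightarrow> real) \<Rightarrow> nat \<Rightarrow> dataset measure \<Rightarrow> (dataset \<Rightarrow> cdens set) \<Rightarrow> bool" where
  "selection_rule f K P A \<longleftrightarrow>
     {(D, \<theta>) \<in> space (P \<Otimes>\<^sub>M param_space K). model_density f \<theta> \<in> A D} \<in> sets (P \<Otimes>\<^sub>M param_space K)"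

definition mean_fn :: "cdens \<Rightarrow> cov \<Rightarrow> real" where
  "mean_fn p x = (\<integral>y. of_bool y * p y x \<partial>nu_y)"

definition classifier :: "cdens \<Rightarrow> cov \<Rightarrow> bool" where
  "classifier p x \<longleftrightarrow> mean_fn p x > 1 / 2"

definition misclass_prob :: "(cov \<times> bool) measure \<Rightarrow> (cov \<Rightarrow> bool) \<Rightarrow> real" where
  "misclass_prob P C = measure P {(x, y) \<in> space P. C x \<noteq> y}"

definition models_of_size :: "nat \<Rightarrow> nat \<Rightarrow> nat set set" where
  "models_of_size K r = {\<gamma>. \<gamma> \<subseteq> {1..K} \<and> card \<gamma> = r}"

definition Delta :: "nat \<Rightarrow> (nat \<Rightarrow> real) \<Rightarrow> nat \<Rightarrow> real" where
  "Delta K \<beta> r = (INF \<gamma>\<in>models_of_size K r. \<Sum>j\<in>{1..K} - \<gamma>. \<bar>\<beta> j\<bar>)"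

definition B_inv :: "nat \<Rightarrow> (nat set \<Rightarrow> real Matrix.mat) \<Rightarrow> nat \<Rightarrow> real" where
  "B_inv K V r = (SUP \<gamma>\<in>models_of_size K r. ch1 (mat_inv (V \<gamma>)))"

definition B_bar :: "nat \<Rightarrow> (nat set \<Rightarrow> real Matrix.mat) \<Rightarrow> nat \<Rightarrow> real" where
  "B_bar K V r = (SUP \<gamma>\<in>models_of_size K r. ch1 (V \<gamma>))"

definition B_tilde :: "nat \<Rightarrow> (nat set \<Rightarrow> real Matrix.mat) \<Rightarrow> nat \<Rightarrow> real" where
  "B_tilde K V rbar = (SUP \<gamma>\<in>{\<gamma>. \<gamma> \<subseteq> {1..K} \<and> \<gamma> \<noteq> {} \<and> card \<gamma> \<le> rbar}. ch1 (V \<gamma>))"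

end

theory Submission
  imports Defs
begin

text \<open>
The classification error of a density exceeds the Bayes error at most by twice its total variation
distance from the truth, and a posterior mean is no farther from the truth than the posterior
average of the distances.  Conditioning on an event of posterior probability above \<open>\<rho>\<close> inflates
posterior probabilities at most by \<open>1 / \<rho>\<close>.  So it suffices that the expected posterior mass of the
densities at distance more than \<open>2 \<epsilon>\<^sub>n\<close> is at most \<open>\<rho> \<epsilon>\<^sub>n / 2\<close>
(\<open>selected_tv_le\<close>, \<open>expected_excess_risk_le\<close>).  With \<open>s = n \<epsilon>\<^sub>n\<^sup>2\<close>, this mass is in fact
\<open>O(exp (- s / 16))\<close>, which is smaller because \<open>ln (1 / \<epsilon>\<^sub>n\<^sup>2)\<close> is of smaller order than \<open>s\<close>.
The posterior mass is a ratio, and three estimates are combined (\<open>expected_posterior_far_le\<close>).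

Denominator.  The covariates are bounded.  Coefficients close to the true ones on \<open>r\<^sub>n\<close> indices that
leave out an absolute sum of \<open>o(\<epsilon>\<^sub>n\<^sup>2)\<close> therefore give linear predictors that are uniformly within
\<open>o(\<epsilon>\<^sub>n\<^sup>2)\<close> of the true ones.  Their likelihood is at least \<open>exp (- o(s))\<close> times the true likelihood, for
almost every data set and not just with high probability (\<open>likelihood_near_truth\<close>).  Their prior
mass is \<open>exp (- o(s))\<close> as well (\<open>prior_box\<close>, \<open>box_mass_ge\<close>).

Large coefficients.  The likelihood ratio of a fixed parameter has expectation one, so their expected
posterior mass is bounded by their prior mass over the bound on the denominator
(\<open>expected_posterior_le_prior\<close>, \<open>prior_tail\<close>).

Bounded coefficients.  The likelihood is Lipschitz in the coefficients, so that parameters may be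
replaced by the points of a finite net, of size \<open>exp (o(s))\<close> (\<open>param_net\<close>).  The posterior mass \<open>X\<close> of
the parameters with a distant density is then bounded by the largest of finitely many likelihood
ratios; as \<open>X \<le> 1\<close>, also by the sum of their square roots.  The expectation of the square root of a
likelihood ratio is the \<open>n\<close>-th power of a Hellinger affinity, which is at most \<open>exp (- 2 s)\<close> at
distance \<open>2 \<epsilon>\<^sub>n\<close> (\<open>nn_integral_sqrt_likelihood_ratio\<close>, \<open>expected_posterior_le_net\<close>).

The prior enters through quadratic forms of \<open>V\<^sub>\<gamma>\<close> and its inverse.  They are bounded by extreme
eigenvalues (\<open>psd_lower_bound_of_inverse\<close>, \<open>quad_form_le_ch1\<close>), and the
Gaussian density is normalised by completing squares one coordinate at a time
(\<open>nn_integral_gaussian\<close>).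
\<close>

section \<open>Quadratic forms and eigenvalues\<close>

abbreviation quad_form :: "real Matrix.mat \<Rightarrow> real Matrix.vec \<Rightarrow> real" where
  "quad_form M x \<equiv> scalar_prod x (M *\<^sub>v x)"

lemma scalar_prod_sym_mat:
  fixes M :: "real Matrix.mat"
  assumes M: "M \<in> carrier_mat k k" "transpose_mat M = M"
    and x: "x \<in> carrier_vec k" and y: "y \<in> carrier_vec k"
  shows "scalar_prod x (M *\<^sub>v y) = scalar_prod y (M *\<^sub>v x)"
proof -
  have "scalar_prod (transpose_mat M *\<^sub>v x) y = scalar_prod x (M *\<^sub>v y)"
    by (rule transpose_vec_mult_scalar[OF M(1) y x])
  moreover have "scalar_prod (M *\<^sub>v x) y = scalar_prod y (M *\<^sub>v x)"
    by (rule comm_scalar_prod[of _ k]) (use M x y in auto)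
  ultimately show ?thesis using M by simp
qed

lemma quad_form_diff:
  fixes M :: "real Matrix.mat"
  assumes M: "M \<in> carrier_mat k k" "transpose_mat M = M"
    and x: "x \<in> carrier_vec k" and y: "y \<in> carrier_vec k"
  shows "quad_form M (x - t \<cdot>\<^sub>v y)
    = quad_form M x - 2 * t * scalar_prod x (M *\<^sub>v y) + t\<^sup>2 * quad_form M y"
proof -
  have My: "M *\<^sub>v y \<in> carrier_vec k" and Mx: "M *\<^sub>v x \<in> carrier_vec k"
    using M x y by auto
  have 1: "M *\<^sub>v (x - t \<cdot>\<^sub>v y) = M *\<^sub>v x - t \<cdot>\<^sub>v (M *\<^sub>v y)"
    using M x y by (simp add: mult_minus_distrib_mat_vec mult_mat_vec)
  have "quad_form M (x - t \<cdot>\<^sub>v y) =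
      scalar_prod x (M *\<^sub>v x) - scalar_prod x (t \<cdot>\<^sub>v (M *\<^sub>v y))
      - (scalar_prod (t \<cdot>\<^sub>v y) (M *\<^sub>v x) - scalar_prod (t \<cdot>\<^sub>v y) (t \<cdot>\<^sub>v (M *\<^sub>v y)))"
    unfolding 1 using x y My Mx
    by (subst minus_scalar_prod_distrib[of _ k]) (auto simp: scalar_prod_minus_distrib[of _ k])
  also have "\<dots> = quad_form M x - t * scalar_prod x (M *\<^sub>v y)
      - (t * scalar_prod y (M *\<^sub>v x) - t * (t * quad_form M y))"
    using x y My Mx M by simp
  also have "scalar_prod y (M *\<^sub>v x) = scalar_prod x (M *\<^sub>v y)"
    by (rule scalar_prod_sym_mat[OF M y x])
  finally show ?thesis by (simp add: power2_eq_square algebra_simps)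
qed

text \<open>Expanding \<open>q(x - N x / C) \<ge> 0\<close> for the form \<open>q\<close> of \<open>M\<close> trades an upper bound on an inverse \<open>N\<close>
  for a lower bound on \<open>M\<close>.\<close>

lemma psd_lower_bound_of_inverse:
  fixes M N :: "real Matrix.mat"
  assumes M: "M \<in> carrier_mat k k" "transpose_mat M = M"
    and psd: "\<And>x. x \<in> carrier_vec k \<Longrightarrow> 0 \<le> quad_form M x"
    and N: "N \<in> carrier_mat k k" "M * N = 1\<^sub>m k"
    and bound: "\<And>x. x \<in> carrier_vec k \<Longrightarrow> quad_form N x \<le> C * scalar_prod x x"
    and C: "0 < C" and x: "x \<in> carrier_vec k"
  shows "scalar_prod x x / C \<le> quad_form M x"
proof -
  let ?y = "N *\<^sub>v x" and ?t = "1 / C"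
  have y: "?y \<in> carrier_vec k" using N x by auto
  have My: "M *\<^sub>v ?y = x"
    using M N x by (metis assoc_mult_mat_vec one_mult_mat_vec)
  have "0 \<le> quad_form M (x - ?t \<cdot>\<^sub>v ?y)" using psd x y by simp
  also have "\<dots> = quad_form M x - 2 * ?t * scalar_prod x x + ?t\<^sup>2 * scalar_prod ?y x"
    by (simp only: quad_form_diff[OF M x y] My)
  also have "scalar_prod ?y x = quad_form N x"
    using x y by (simp add: comm_scalar_prod[of _ k])
  also have "?t\<^sup>2 * quad_form N x \<le> ?t\<^sup>2 * (C * scalar_prod x x)"
    by (intro mult_left_mono bound x) auto
  also have "?t\<^sup>2 * (C * scalar_prod x x) = scalar_prod x x / C"
    using C by (simp add: power2_eq_square)
  finally show ?thesis by simp
qed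

lemma quad_form_sum:
  fixes M :: "real Matrix.mat"
  assumes M: "M \<in> carrier_mat k k" and x: "x \<in> carrier_vec k"
  shows "quad_form M x
    = (\<Sum>i\<in>{0..<k}. \<Sum>j\<in>{0..<k}. M $$ (i,j) * (vec_index x i * vec_index x j))"
proof -
  have d: "dim_vec x = k" using x by auto
  show ?thesis
    using M d unfolding scalar_prod_def
    by (auto simp: scalar_prod_def sum_distrib_left algebra_simps intro!: sum.cong)
qed

lemma scalar_prod_self_nonneg: "0 \<le> scalar_prod x (x :: real Matrix.vec)"
  unfolding scalar_prod_def by (auto intro: sum_nonneg)

lemma scalar_prod_self_pos:
  assumes "x \<in> carrier_vec k" "x \<noteq> 0\<^sub>v k"
  shows "0 < scalar_prod x (x :: real Matrix.vec)"
proof -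
  have d: "dim_vec x = k" using assms by auto
  from assms obtain i where i: "i < k" "vec_index x i \<noteq> 0"
    by (metis (no_types) carrier_vecD eq_vecI index_zero_vec)
  have "0 < vec_index x i * vec_index x i" using i by (simp add: zero_less_mult_iff) linarith
  also have "\<dots> \<le> (\<Sum>i\<in>{0..<k}. vec_index x i * vec_index x i)"
    by (rule member_le_sum) (use i in auto)
  finally show ?thesis unfolding scalar_prod_def d .
qed

lemma quad_form_bounded:
  fixes M :: "real Matrix.mat"
  assumes M: "M \<in> carrier_mat k k"
  shows "\<exists>C>0. \<forall>x\<in>carrier_vec k. \<bar>quad_form M x\<bar> \<le> C * scalar_prod x x"
proof -
  let ?C = "(\<Sum>i\<in>{0..<k}. \<Sum>j\<in>{0..<k}. \<bar>M $$ (i,j)\<bar>) + 1"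
  have "\<bar>quad_form M x\<bar> \<le> ?C * scalar_prod x x" if x: "x \<in> carrier_vec k" for x
  proof -
    have d: "dim_vec x = k" using x by auto
    have le: "\<bar>vec_index x i * vec_index x j\<bar> \<le> scalar_prod x x" if "i < k" "j < k" for i j
    proof -
      have "(vec_index x i)\<^sup>2 \<le> scalar_prod x x" if "i < k" for i
        unfolding scalar_prod_def d power2_eq_square by (rule member_le_sum) (use that in auto)
      from this[OF \<open>i < k\<close>] this[OF \<open>j < k\<close>]
      have "(vec_index x i)\<^sup>2 + (vec_index x j)\<^sup>2 \<le> 2 * scalar_prod x x" by simp
      moreover have "2 * \<bar>vec_index x i * vec_index x j\<bar> \<le> (vec_index x i)\<^sup>2 + (vec_index x j)\<^sup>2"
        using sum_squares_bound[of "\<bar>vec_index x i\<bar>" "\<bar>vec_index x j\<bar>"] by (simp add: abs_mult)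
      ultimately show ?thesis by simp
    qed
    have "\<bar>quad_form M x\<bar> \<le> (\<Sum>i\<in>{0..<k}. \<Sum>j\<in>{0..<k}. \<bar>M $$ (i,j)\<bar> * scalar_prod x x)"
      unfolding quad_form_sum[OF M x]
      by (intro order_trans[OF sum_abs] sum_mono order_trans[OF sum_abs])
        (auto simp: abs_mult[of "M $$ _"] intro!: mult_left_mono le)
    also have "\<dots> = (\<Sum>i\<in>{0..<k}. \<Sum>j\<in>{0..<k}. \<bar>M $$ (i,j)\<bar>) * scalar_prod x x"
      by (simp add: sum_distrib_right)
    also have "\<dots> \<le> ?C * scalar_prod x x"
      using scalar_prod_self_nonneg by (intro mult_right_mono) auto
    finally show ?thesis .
  qed
  moreover have "?C > 0" by (intro add_nonneg_pos sum_nonneg) auto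
  ultimately show ?thesis by blast
qed

lemma finite_eigenvalues:
  fixes M :: "real Matrix.mat"
  assumes M: "M \<in> carrier_mat k k"
  shows "finite {e. eigenvalue M e}"
proof -
  have "char_poly M \<noteq> 0"
    using degree_monic_char_poly[OF M] by auto
  then show ?thesis
    unfolding eigenvalue_root_char_poly[OF M] by (rule poly_roots_finite)
qed

lemma inverse_exists_of_kernel:
  fixes M :: "real Matrix.mat"
  assumes M: "M \<in> carrier_mat k k"
    and ker: "\<And>x. x \<in> carrier_vec k \<Longrightarrow> M *\<^sub>v x = 0\<^sub>v k \<Longrightarrow> x = 0\<^sub>v k"
  shows "\<exists>N. mat_inverse M = Some N \<and> N \<in> carrier_mat k k \<and> M * N = 1\<^sub>m k \<and> N * M = 1\<^sub>m k"
proof -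
  have "Determinant.det M \<noteq> 0"
    unfolding det_0_iff_vec_prod_zero_field[OF M] using ker by blast
  from det_non_zero_imp_unit[OF M this, where b = "()"]
  have "mat_inverse M \<noteq> None" using mat_inverse(1)[OF M, where b = "()"] by blast
  then obtain N where "mat_inverse M = Some N" by auto
  with mat_inverse(2)[OF M this] show ?thesis by auto
qed

text \<open>The least upper bound \<open>e\<close> of the Rayleigh quotient is an eigenvalue: otherwise \<open>e - M\<close> is
  positive semidefinite and invertible, hence bounded below by a positive multiple of the
  identity, which contradicts minimality of \<open>e\<close>.\<close>

lemma quad_form_le_ch1:
  fixes M :: "real Matrix.mat"
  assumes M: "M \<in> carrier_mat k k" "transpose_mat M = M" and k: "0 < k"
    and x: "x \<in> carrier_vec k"
  shows "quad_form M x \<le> ch1 M * scalar_prod x x"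
proof -
  define U where "U = {e. \<forall>x\<in>carrier_vec k. quad_form M x \<le> e * scalar_prod x x}"
  from quad_form_bounded[OF M(1)] obtain C where C: "C > 0"
    "\<And>x. x \<in> carrier_vec k \<Longrightarrow> \<bar>quad_form M x\<bar> \<le> C * scalar_prod x x" by blast
  have CU: "C \<in> U" unfolding U_def using C(2) by (auto simp: abs_le_iff)
  let ?u = "unit_vec k 0 :: real Matrix.vec"
  have u: "?u \<in> carrier_vec k" by simp
  have uu: "scalar_prod ?u ?u = 1" using k by simp
  have lb: "quad_form M ?u \<le> e" if "e \<in> U" for e
    using that u uu unfolding U_def by fastforce
  then have bdd: "bdd_below U" by (auto simp: bdd_below_def)
  define e where "e = Inf U"
  have eU: "e \<in> U"
    unfolding U_def
  proof (safe)
    fix x :: "real Matrix.vec" assume x: "x \<in> carrier_vec k"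
    show "quad_form M x \<le> e * scalar_prod x x"
    proof (cases "x = 0\<^sub>v k")
      case True
      then show ?thesis using M by simp
    next
      case False
      from scalar_prod_self_pos[OF x False] have p: "scalar_prod x x > 0" .
      have "quad_form M x / scalar_prod x x \<le> e"
        unfolding e_def using CU
        by (intro cInf_greatest) (use x p in \<open>auto simp: U_def divide_simps\<close>)
      then show ?thesis using p by (simp add: divide_simps)
    qed
  qed
  have ev: "eigenvalue M e"
  proof (rule ccontr)
    assume nev: "\<not> eigenvalue M e"
    define M' where "M' = e \<cdot>\<^sub>m 1\<^sub>m k - M"
    have M': "M' \<in> carrier_mat k k" using M unfolding M'_def by auto
    have M'sym: "transpose_mat M' = M'"
    proof (rule eq_matI)
      fix i j assume "i < dim_row M'" "j < dim_col M'"
      then have ij: "i < k" "j < k" using M' by auto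
      then have "M $$ (j, i) = M $$ (i, j)"
        using M by (metis carrier_matD index_transpose_mat(1))
      then show "transpose_mat M' $$ (i, j) = M' $$ (i, j)"
        unfolding M'_def using ij M(1) by auto
    qed (use M' in auto)
    have M'v: "M' *\<^sub>v x = e \<cdot>\<^sub>v x - M *\<^sub>v x" if "x \<in> carrier_vec k" for x
    proof -
      have "M' *\<^sub>v x = (e \<cdot>\<^sub>m 1\<^sub>m k) *\<^sub>v x - M *\<^sub>v x"
        unfolding M'_def using M that by (intro minus_mult_distrib_mat_vec) auto
      also have "(e \<cdot>\<^sub>m 1\<^sub>m k) *\<^sub>v x = e \<cdot>\<^sub>v x"
        using that by auto
      finally show ?thesis .
    qed
    have q: "quad_form M' x = e * scalar_prod x x - quad_form M x" if x: "x \<in> carrier_vec k" for x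
      unfolding M'v[OF x] using x M by (subst scalar_prod_minus_distrib[of _ k]) auto
    have "\<exists>N. mat_inverse M' = Some N \<and> N \<in> carrier_mat k k \<and> M' * N = 1\<^sub>m k \<and> N * M' = 1\<^sub>m k"
    proof (rule inverse_exists_of_kernel[OF M'], rule ccontr)
      fix x assume x: "x \<in> carrier_vec k" "M' *\<^sub>v x = 0\<^sub>v k" "x \<noteq> 0\<^sub>v k"
      have "M *\<^sub>v x = e \<cdot>\<^sub>v x"
      proof (rule eq_vecI)
        fix i assume "i < dim_vec (e \<cdot>\<^sub>v x)"
        then have i: "i < k" using x by simp
        have "vec_index (e \<cdot>\<^sub>v x - M *\<^sub>v x) i = 0"
          using x(2) M'v[OF x(1)] i by simp
        then show "vec_index (M *\<^sub>v x) i = vec_index (e \<cdot>\<^sub>v x) i" using i x M by simp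
      qed (use M x in simp)
      then show False
        using nev x M unfolding eigenvalue_def eigenvector_def by auto
    qed
    then obtain N where N: "N \<in> carrier_mat k k" "M' * N = 1\<^sub>m k" by blast
    from quad_form_bounded[OF N(1)] obtain c where c: "c > 0"
      "\<And>x. x \<in> carrier_vec k \<Longrightarrow> \<bar>quad_form N x\<bar> \<le> c * scalar_prod x x" by blast
    have "scalar_prod x x / c \<le> quad_form M' x" if "x \<in> carrier_vec k" for x
    proof (rule psd_lower_bound_of_inverse[OF M' M'sym _ N _ c(1) that])
      show "0 \<le> quad_form M' x" if "x \<in> carrier_vec k" for x
        using that eU q[OF that] unfolding U_def by auto
      show "quad_form N x \<le> c * scalar_prod x x" if "x \<in> carrier_vec k" for x
        using c(2)[OF that] by simp
    qed
    then have "e - 1 / c \<in> U"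
      unfolding U_def using q by (fastforce simp: algebra_simps)
    then have "e \<le> e - 1 / c" unfolding e_def by (rule cInf_lower[OF _ bdd])
    then show False using c(1) by (simp add: field_simps)
  qed
  have "e \<le> ch1 M"
    unfolding ch1_def using ev finite_eigenvalues[OF M(1)] by simp
  then have "e * scalar_prod x x \<le> ch1 M * scalar_prod x x"
    by (intro mult_right_mono scalar_prod_self_nonneg)
  moreover have "quad_form M x \<le> e * scalar_prod x x" using eU x unfolding U_def by blast
  ultimately show ?thesis by simp
qed

lemma pos_def_matD:
  assumes "pos_def_mat k M"
  shows "M \<in> carrier_mat k k" "transpose_mat M = M"
    "\<And>x. x \<in> carrier_vec k \<Longrightarrow> x \<noteq> 0\<^sub>v k \<Longrightarrow> 0 < quad_form M x"
    "\<And>x. x \<in> carrier_vec k \<Longrightarrow> 0 \<le> quad_form M x"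
proof -
  show *: "M \<in> carrier_mat k k" "transpose_mat M = M"
    "\<And>x. x \<in> carrier_vec k \<Longrightarrow> x \<noteq> 0\<^sub>v k \<Longrightarrow> 0 < quad_form M x"
    using assms unfolding pos_def_mat_def by auto
  show "0 \<le> quad_form M x" if "x \<in> carrier_vec k" for x
  proof (cases "x = 0\<^sub>v k")
    case True
    then show ?thesis using *(1) by simp
  next
    case False
    then show ?thesis using *(3)[OF that] by simp
  qed
qed

lemma pos_def_inverse:
  assumes V: "pos_def_mat k V"
  shows "mat_inv V \<in> carrier_mat k k" "V * mat_inv V = 1\<^sub>m k" "mat_inv V * V = 1\<^sub>m k"
    "pos_def_mat k (mat_inv V)"
proof -
  note VD = pos_def_matD[OF V]
  have "\<exists>N. mat_inverse V = Some N \<and> N \<in> carrier_mat k k \<and> V * N = 1\<^sub>m k \<and> N * V = 1\<^sub>m k"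
  proof (rule inverse_exists_of_kernel[OF VD(1)], rule ccontr)
    fix x assume x: "x \<in> carrier_vec k" "V *\<^sub>v x = 0\<^sub>v k" "x \<noteq> 0\<^sub>v k"
    from VD(3)[OF x(1,3)] x show False by simp
  qed
  then obtain W where inv: "mat_inverse V = Some W"
    and W: "W \<in> carrier_mat k k" "V * W = 1\<^sub>m k" "W * V = 1\<^sub>m k" by blast
  show "mat_inv V \<in> carrier_mat k k" "V * mat_inv V = 1\<^sub>m k" "mat_inv V * V = 1\<^sub>m k"
    using inv W by auto
  have "transpose_mat (V * W) = transpose_mat W * V"
    using VD W by (metis transpose_mult)
  then have "transpose_mat W * V = 1\<^sub>m k" using W by simp
  then have "transpose_mat W = transpose_mat W * (V * W)" using W by simp
  also have "\<dots> = transpose_mat W * V * W"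
    by (rule assoc_mult_mat[symmetric, of _ k k _ k _ k]) (use VD W in auto)
  also have "\<dots> = W" using W \<open>transpose_mat W * V = 1\<^sub>m k\<close> by simp
  finally have sym: "transpose_mat W = W" .
  have "0 < quad_form W x" if x: "x \<in> carrier_vec k" "x \<noteq> 0\<^sub>v k" for x
  proof -
    let ?y = "W *\<^sub>v x"
    have y: "?y \<in> carrier_vec k" using W x by auto
    have Vy: "V *\<^sub>v ?y = x"
      using VD W x by (metis assoc_mult_mat_vec one_mult_mat_vec)
    have "V *\<^sub>v 0\<^sub>v k = 0\<^sub>v k" using VD(1) by auto
    then have "?y \<noteq> 0\<^sub>v k" using Vy x(2) by auto
    from VD(3)[OF y this] show ?thesis
      unfolding Vy using x y by (simp add: comm_scalar_prod[of _ k])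
  qed
  then show "pos_def_mat k (mat_inv V)"
    unfolding pos_def_mat_def using inv W sym by auto
qed

lemma ch1_pos:
  assumes V: "pos_def_mat k V" and k: "0 < k"
  shows "0 < ch1 V"
proof -
  let ?u = "unit_vec k 0 :: real Matrix.vec"
  have "?u \<noteq> 0\<^sub>v k"
    by (metis index_unit_vec(2) index_zero_vec(1) k zero_neq_one)
  then have "0 < quad_form V ?u" using pos_def_matD(3)[OF V] by simp
  also have "\<dots> \<le> ch1 V * scalar_prod ?u ?u"
    using quad_form_le_ch1[OF pos_def_matD(1,2)[OF V] k] by simp
  finally show ?thesis using k by simp
qed

lemma inverse_form_ge:
  assumes V: "pos_def_mat k V" and k: "0 < k" and x: "x \<in> carrier_vec k"
  shows "scalar_prod x x / ch1 V \<le> quad_form (mat_inv V) x"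
proof (rule psd_lower_bound_of_inverse)
  note W = pos_def_inverse[OF V] and VD = pos_def_matD[OF V]
  show "mat_inv V \<in> carrier_mat k k" "mat_inv V * V = 1\<^sub>m k" using W by auto
  show "transpose_mat (mat_inv V) = mat_inv V" "\<And>x. x \<in> carrier_vec k \<Longrightarrow> 0 \<le> quad_form (mat_inv V) x"
    using pos_def_matD[OF W(4)] by auto
qed (use pos_def_matD[OF V] quad_form_le_ch1[OF pos_def_matD(1,2)[OF V] k] ch1_pos[OF V k] x in auto)

section \<open>Gaussian integrals\<close>

text \<open>The Schur complement of the corner entry: the form of \<open>W\<close> that is left in the other coordinates
  after completing the square in the first one.\<close>

definition schur_mat :: "real Matrix.mat \<Rightarrow> real Matrix.mat" where
  "schur_mat W = Matrix.mat (dim_row W - 1) (dim_row W - 1)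
     (\<lambda>(i,j). W $$ (Suc i, Suc j) - W $$ (Suc i, 0) * W $$ (Suc j, 0) / W $$ (0,0))"

lemma quad_form_schur:
  fixes W :: "real Matrix.mat"
  assumes W: "W \<in> carrier_mat (Suc k) (Suc k)" "transpose_mat W = W" and w: "W $$ (0,0) \<noteq> 0"
    and t: "t \<in> carrier_vec k"
  shows "quad_form W (vCons s t)
    = W $$ (0,0) * (s + (\<Sum>i\<in>{0..<k}. W $$ (Suc i, 0) * vec_index t i) / W $$ (0,0))\<^sup>2
      + quad_form (schur_mat W) t"
proof -
  have S: "schur_mat W \<in> carrier_mat k k" using W unfolding schur_mat_def by auto
  define w where "w = W $$ (0,0)"
  define u where "u i = W $$ (Suc i, 0)" for i
  define U where "U = (\<Sum>i\<in>{0..<k}. u i * vec_index t i)"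
  define Q where "Q = (\<Sum>i\<in>{0..<k}. \<Sum>j\<in>{0..<k}. W $$ (Suc i, Suc j) * (vec_index t i * vec_index t j))"
  have sym: "W $$ (0, Suc i) = u i" if "i < k" for i
    using W that unfolding u_def by (metis Suc_less_eq carrier_matD index_transpose_mat(1) zero_less_Suc)
  have "quad_form W (vCons s t) = w * (s * s) + (\<Sum>j\<in>{0..<k}. u j * (s * vec_index t j))
      + ((\<Sum>i\<in>{0..<k}. u i * (vec_index t i * s)) + Q)"
    unfolding Q_def w_def
    by (subst quad_form_sum[OF W(1)])
      (use t in \<open>simp_all only: sum.atLeast0_lessThan_Suc_shift vCons_carrier_vec\<close>,
       simp add: sum.distrib sym u_def[symmetric])
  also have "(\<Sum>j\<in>{0..<k}. u j * (s * vec_index t j)) = s * U"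
    unfolding U_def by (simp add: sum_distrib_left algebra_simps)
  also have "(\<Sum>i\<in>{0..<k}. u i * (vec_index t i * s)) = s * U"
    unfolding U_def by (simp add: sum_distrib_left algebra_simps)
  finally have 1: "quad_form W (vCons s t) = w * (s * s) + s * U + (s * U + Q)" .
  have "quad_form (schur_mat W) t =
      (\<Sum>i\<in>{0..<k}. \<Sum>j\<in>{0..<k}. W $$ (Suc i, Suc j) * (vec_index t i * vec_index t j)
          - (u i * vec_index t i) * (u j * vec_index t j) / w)"
    using W unfolding quad_form_sum[OF S t]
    by (intro sum.cong refl) (auto simp: schur_mat_def u_def w_def algebra_simps)
  also have "\<dots> = Q - U * U / w"
    unfolding Q_def U_def sum_product
    by (simp add: sum_subtractf sum_divide_distrib)
  finally have 2: "quad_form (schur_mat W) t = Q - U * U / w" .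
  show ?thesis
    unfolding 1 2 w_def[symmetric] u_def[symmetric] U_def[symmetric]
    using w[folded w_def] by (simp add: field_simps power2_eq_square)
qed

lemma pos_def_corner_pos:
  assumes W: "pos_def_mat (Suc k) W"
  shows "0 < W $$ (0,0)"
proof -
  note D = pos_def_matD[OF W]
  let ?e = "unit_vec (Suc k) 0 :: real Matrix.vec"
  have "?e \<noteq> 0\<^sub>v (Suc k)"
    by (metis index_unit_vec(2) index_zero_vec(1) zero_less_Suc zero_neq_one)
  then have "0 < quad_form W ?e" using D(3) by simp
  also have "quad_form W ?e = W $$ (0,0)"
    using D(1) by (simp add: scalar_prod_left_unit)
  finally show ?thesis .
qed

lemma schur_pos_def:
  assumes W: "pos_def_mat (Suc k) W"
  shows "pos_def_mat k (schur_mat W)"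
proof -
  note D = pos_def_matD[OF W]
  note w = pos_def_corner_pos[OF W]
  have S: "schur_mat W \<in> carrier_mat k k" using D unfolding schur_mat_def by auto
  have sym: "W $$ (i, j) = W $$ (j, i)" if "i < Suc k" "j < Suc k" for i j
    using D(1,2) that by (metis carrier_matD index_transpose_mat(1))
  have "transpose_mat (schur_mat W) = schur_mat W"
    using D(1) sym by (auto simp: schur_mat_def)
  moreover have "0 < quad_form (schur_mat W) t" if t: "t \<in> carrier_vec k" "t \<noteq> 0\<^sub>v k" for t
  proof -
    let ?s = "- (\<Sum>i\<in>{0..<k}. W $$ (Suc i, 0) * vec_index t i) / W $$ (0,0)"
    have "vCons ?s t \<in> carrier_vec (Suc k)" "vCons ?s t \<noteq> 0\<^sub>v (Suc k)"
      using t by (auto simp: zero_vec_Suc)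
    from D(3)[OF this] show ?thesis
      using quad_form_schur[OF D(1,2) _ t(1), of ?s] w by simp
  qed
  ultimately show ?thesis unfolding pos_def_mat_def using S by auto
qed

text \<open>One block row elimination, written as a product with a unit lower triangular matrix.\<close>

lemma det_schur:
  fixes W :: "real Matrix.mat"
  assumes W: "W \<in> carrier_mat (Suc k) (Suc k)" "transpose_mat W = W" and w: "W $$ (0,0) \<noteq> 0"
  shows "Determinant.det W = W $$ (0,0) * Determinant.det (schur_mat W)"
proof -
  define A where "A = Matrix.mat 1 1 (\<lambda>_. W $$ (0,0))"
  define B where "B = Matrix.mat 1 k (\<lambda>(i,j). W $$ (0, Suc j))"
  define C where "C = Matrix.mat k 1 (\<lambda>(i,j). W $$ (Suc i, 0))"
  define F where "F = Matrix.mat k 1 (\<lambda>(i,j). - W $$ (Suc i, 0) / W $$ (0,0))"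
  define W1 where "W1 = Matrix.mat k k (\<lambda>(i,j). W $$ (Suc i, Suc j))"
  define E where "E = four_block_mat (1\<^sub>m 1) (0\<^sub>m 1 k) F (1\<^sub>m k)"
  have c: "A \<in> carrier_mat 1 1" "B \<in> carrier_mat 1 k" "C \<in> carrier_mat k 1"
    "F \<in> carrier_mat k 1" "W1 \<in> carrier_mat k k"
    unfolding A_def B_def C_def F_def W1_def by auto
  have S: "schur_mat W \<in> carrier_mat k k" using W unfolding schur_mat_def by auto
  have sym: "W $$ (0, Suc i) = W $$ (Suc i, 0)" if "i < k" for i
    using W that by (metis Suc_less_eq carrier_matD index_transpose_mat(1) zero_less_Suc)
  have W_eq: "W = four_block_mat A B C W1"
    using W unfolding A_def B_def C_def W1_def four_block_mat_def Let_def
    by (intro eq_matI) (auto simp: less_Suc_eq_0_disj)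
  have "E * W = four_block_mat (1\<^sub>m 1 * A + 0\<^sub>m 1 k * C) (1\<^sub>m 1 * B + 0\<^sub>m 1 k * W1)
      (F * A + 1\<^sub>m k * C) (F * B + 1\<^sub>m k * W1)"
    unfolding E_def W_eq by (rule mult_four_block_mat) (use c in auto)
  also have "1\<^sub>m 1 * A + 0\<^sub>m 1 k * C = A" using c by simp
  also have "1\<^sub>m 1 * B + 0\<^sub>m 1 k * W1 = B" using c by simp
  also have "F * A + 1\<^sub>m k * C = 0\<^sub>m k 1"
    using c w by (intro eq_matI) (auto simp: F_def A_def C_def scalar_prod_def)
  also have "F * B + 1\<^sub>m k * W1 = schur_mat W"
    using c w W sym by (intro eq_matI) (auto simp: F_def B_def W1_def scalar_prod_def schur_mat_def)
  finally have EW: "E * W = four_block_mat A B (0\<^sub>m k 1) (schur_mat W)" .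
  have "Determinant.det (E * W) = Determinant.det A * Determinant.det (schur_mat W)"
    unfolding EW by (rule det_four_block_mat_lower_left_zero) (use c S in auto)
  moreover have "Determinant.det E = 1"
    unfolding E_def by (subst det_four_block_mat_upper_right_zero) (use c in auto)
  moreover have "Determinant.det A = W $$ (0,0)"
    unfolding A_def by (subst det_single) auto
  moreover have "Determinant.det (E * W) = Determinant.det E * Determinant.det W"
    by (rule det_mult[of _ "Suc k"]) (use W c in \<open>auto simp: E_def\<close>)
  ultimately show ?thesis by simp
qed

lemma vec_of_list_map_carrier: "vec_of_list (map f xs) \<in> carrier_vec (length xs)"
  by (rule carrier_vecI) simp

lemma quad_form_measurable:
  fixes W :: "real Matrix.mat"
  assumes W: "W \<in> carrier_mat (length xs) (length xs)" and xs: "set xs \<subseteq> I"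
    and [measurable_cong]: "sets M = sets (borel :: real measure)"
  shows "(\<lambda>\<beta>. quad_form W (vec_of_list (map \<beta> xs))) \<in> borel_measurable (Pi\<^sub>M I (\<lambda>_. M))"
proof -
  have eq: "quad_form W (vec_of_list (map \<beta> xs)) =
      (\<Sum>i\<in>{0..<length xs}. \<Sum>j\<in>{0..<length xs}. W $$ (i,j) * (\<beta> (xs ! i) * \<beta> (xs ! j)))" for \<beta>
    by (subst quad_form_sum[OF W vec_of_list_map_carrier])
      (auto intro!: sum.cong simp: vec_of_list_index)
  have [measurable]: "(\<lambda>\<beta>. \<beta> (xs ! i)) \<in> borel_measurable (Pi\<^sub>M I (\<lambda>_. M))" if "i \<in> {0..<length xs}" for i
  proof -
    have "xs ! i \<in> I" using xs that by (auto simp: subset_iff)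
    then have "(\<lambda>\<beta>. \<beta> (xs ! i)) \<in> measurable (Pi\<^sub>M I (\<lambda>_. M)) M" by (rule measurable_component_singleton)
    then show ?thesis using assms(3) measurable_cong_sets by blast
  qed
  show ?thesis unfolding eq by measurable
qed

lemma nn_integral_gaussian_real:
  assumes w: "0 < w"
  shows "(\<integral>\<^sup>+s. ennreal (exp (- (w * (s + c)\<^sup>2) / 2)) \<partial>lborel) = ennreal (sqrt (2 * pi / w))"
proof -
  define \<sigma> where "\<sigma> = 1 / sqrt w"
  have \<sigma>: "0 < \<sigma>" "\<sigma>\<^sup>2 = 1 / w" unfolding \<sigma>_def using w by (auto simp: power_divide)
  have e: "exp (- (w * (s + c)\<^sup>2) / 2) = sqrt (2 * pi / w) * normal_density (- c) \<sigma> s" for s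
    unfolding normal_density_def \<sigma>(2) using w by simp
  interpret prob_space "density lborel (normal_density (- c) \<sigma>)"
    by (rule prob_space_normal_density[OF \<sigma>(1)])
  have "(\<integral>\<^sup>+s. ennreal (normal_density (- c) \<sigma> s) \<partial>lborel) = 1"
    using emeasure_space_1 by (simp add: emeasure_density)
  then show ?thesis
    unfolding e by (subst ennreal_mult') (auto simp: nn_integral_cmult w less_imp_le)
qed

text \<open>The Gaussian integral is computed one coordinate at a time: completing the square in the first
  coordinate leaves the form of the Schur complement in the others, and translation invariance
  removes the shift.\<close>

lemma nn_integral_gaussian:
  assumes "distinct xs" "pos_def_mat (length xs) W"
  shows "0 < Determinant.det W \<and>
    (\<integral>\<^sup>+\<beta>. ennreal (exp (- quad_form W (vec_of_list (map \<beta> xs)) / 2)) \<partial>Pi\<^sub>M (set xs) (\<lambda>_. lborel))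
      = ennreal (sqrt ((2 * pi) ^ length xs / Determinant.det W))"
  using assms
proof (induction xs arbitrary: W)
  case Nil
  then have W: "W \<in> carrier_mat 0 0" using pos_def_matD by fastforce
  then have "Determinant.det W = 1" by simp
  moreover have "quad_form W vNil = 0" using W by (simp add: scalar_prod_def)
  moreover have "integral\<^sup>N (Pi\<^sub>M {} (\<lambda>_::'a. lborel :: real measure)) (\<lambda>_. 1 :: ennreal) = 1"
    by (simp add: PiM_empty)
  ultimately show ?case by simp
next
  case (Cons x ys)
  let ?k = "length ys" and ?S = "schur_mat W"
  interpret product_sigma_finite "\<lambda>_::'a. lborel :: real measure"
    by standard
  have W: "pos_def_mat (Suc ?k) W" using Cons.prems by simp
  note D = pos_def_matD[OF W] and w = pos_def_corner_pos[OF W] and S = schur_pos_def[OF W]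
  note IH = Cons.IH[OF _ S]
  have xs: "x \<notin> set ys" "distinct ys" using Cons.prems by auto
  have det: "Determinant.det W = W $$ (0,0) * Determinant.det ?S"
    by (rule det_schur[OF D(1,2)]) (use w in auto)
  have "(\<integral>\<^sup>+\<beta>. ennreal (exp (- quad_form W (vec_of_list (map \<beta> (x # ys))) / 2)) \<partial>Pi\<^sub>M (set (x # ys)) (\<lambda>_. lborel))
      = (\<integral>\<^sup>+\<beta>. \<integral>\<^sup>+s. ennreal (exp (- quad_form W (vec_of_list (map (\<beta>(x := s)) (x # ys))) / 2)) \<partial>lborel
           \<partial>Pi\<^sub>M (set ys) (\<lambda>_. lborel))"
    unfolding list.set
    by (rule product_nn_integral_insert)
      (use xs D(1) quad_form_measurable[of W "x # ys" "insert x (set ys)" lborel] in \<open>auto intro!: measurable_compose[OF _ measurable_ennreal] borel_measurable_exp\<close>)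
  also have "\<dots> = (\<integral>\<^sup>+\<beta>. ennreal (sqrt (2 * pi / W $$ (0,0)))
      * ennreal (exp (- quad_form ?S (vec_of_list (map \<beta> ys)) / 2)) \<partial>Pi\<^sub>M (set ys) (\<lambda>_. lborel))"
  proof (rule nn_integral_cong)
    fix \<beta> :: "'a \<Rightarrow> real"
    let ?t = "vec_of_list (map \<beta> ys)"
    define c where "c = (\<Sum>i\<in>{0..<?k}. W $$ (Suc i, 0) * vec_index ?t i) / W $$ (0,0)"
    have t: "?t \<in> carrier_vec ?k" by (rule vec_of_list_map_carrier)
    have m: "map (\<beta>(x := s)) (x # ys) = s # map \<beta> ys" for s using xs by auto
    have q: "quad_form W (vec_of_list (map (\<beta>(x := s)) (x # ys)))
        = W $$ (0,0) * (s + c)\<^sup>2 + quad_form ?S ?t" for s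
      unfolding m vec_of_list_Cons c_def
      by (rule quad_form_schur[OF D(1,2) _ t]) (use w in simp)
    have "(\<integral>\<^sup>+s. ennreal (exp (- quad_form W (vec_of_list (map (\<beta>(x := s)) (x # ys))) / 2)) \<partial>lborel)
        = (\<integral>\<^sup>+s. ennreal (exp (- (W $$ (0,0) * (s + c)\<^sup>2) / 2)) * ennreal (exp (- quad_form ?S ?t / 2)) \<partial>lborel)"
      unfolding q by (intro nn_integral_cong)
        (simp add: ennreal_mult[symmetric] exp_add[symmetric] add_divide_distrib diff_divide_distrib)
    also have "\<dots> = ennreal (sqrt (2 * pi / W $$ (0,0))) * ennreal (exp (- quad_form ?S ?t / 2))"
      by (subst nn_integral_multc) (auto simp only: nn_integral_gaussian_real[OF w], measurable)
    finally show "(\<integral>\<^sup>+s. ennreal (exp (- quad_form W (vec_of_list (map (\<beta>(x := s)) (x # ys))) / 2)) \<partial>lborel)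
        = ennreal (sqrt (2 * pi / W $$ (0,0))) * ennreal (exp (- quad_form ?S ?t / 2))" .
  qed
  also have "\<dots> = ennreal (sqrt (2 * pi / W $$ (0,0))) * ennreal (sqrt ((2 * pi) ^ ?k / Determinant.det ?S))"
    by (subst nn_integral_cmult)
      (use IH xs quad_form_measurable[of ?S ys "set ys" lborel] pos_def_matD(1)[OF S] in \<open>auto intro!: measurable_compose[OF _ measurable_ennreal] borel_measurable_exp\<close>)
  also have "\<dots> = ennreal (sqrt ((2 * pi) ^ length (x # ys) / Determinant.det W))"
    using w IH xs by (simp add: ennreal_mult[symmetric] real_sqrt_mult[symmetric] det)
  finally show ?case using w IH xs det by simp
qed

section \<open>The Gaussian prior on the coefficients of one model\<close>

lemma subvec_carrier: "subvec \<gamma> v \<in> carrier_vec (card \<gamma>)"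
  unfolding subvec_def by (rule carrier_vecI) simp

lemma subvec_norm:
  assumes "finite \<gamma>"
  shows "scalar_prod (subvec \<gamma> \<beta>) (subvec \<gamma> \<beta>) = (\<Sum>j\<in>\<gamma>. (\<beta> j)\<^sup>2)"
proof -
  let ?xs = "sorted_list_of_set \<gamma>"
  have "scalar_prod (subvec \<gamma> \<beta>) (subvec \<gamma> \<beta>) = (\<Sum>i\<in>{0..<length ?xs}. (\<beta> (?xs ! i))\<^sup>2)"
    unfolding scalar_prod_def subvec_def
    by (intro sum.cong) (auto simp del: vec_of_list_map simp: vec_of_list_index power2_eq_square)
  also have "\<dots> = sum_list (map (\<lambda>j. (\<beta> j)\<^sup>2) ?xs)"
    by (subst sum_list_sum_nth) simp
  also have "\<dots> = (\<Sum>j\<in>set ?xs. (\<beta> j)\<^sup>2)" by (rule sum_list_distinct_conv_sum_set) simp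
  finally show ?thesis using assms by simp
qed

lemma quad_form_subvec_measurable:
  assumes "finite \<gamma>" "W \<in> carrier_mat (card \<gamma>) (card \<gamma>)"
  shows "(\<lambda>\<beta>. quad_form W (subvec \<gamma> \<beta>)) \<in> borel_measurable (Pi\<^sub>M \<gamma> (\<lambda>_. lborel))"
  unfolding subvec_def using assms
  by (intro quad_form_measurable) auto

lemma nn_integral_gaussian_subvec:
  assumes "finite \<gamma>" "pos_def_mat (card \<gamma>) W"
  shows "0 < Determinant.det W"
    "(\<integral>\<^sup>+\<beta>. ennreal (exp (- quad_form W (subvec \<gamma> \<beta>) / 2)) \<partial>Pi\<^sub>M \<gamma> (\<lambda>_. lborel))
      = ennreal (sqrt ((2 * pi) ^ card \<gamma> / Determinant.det W))"
  using nn_integral_gaussian[of "sorted_list_of_set \<gamma>" W] assms unfolding subvec_def by auto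

lemma mvn_density_eq:
  assumes V: "pos_def_mat k V"
  shows "mvn_density V v
      = sqrt (Determinant.det (mat_inv V) / (2 * pi) ^ k) * exp (- quad_form (mat_inv V) v / 2)"
proof -
  note W = pos_def_inverse[OF V] and D = pos_def_matD[OF V]
  have "Determinant.det (V * mat_inv V) = Determinant.det V * Determinant.det (mat_inv V)"
    by (rule det_mult[OF D(1) W(1)])
  then have "Determinant.det V * Determinant.det (mat_inv V) = 1" using W by simp
  then have "Determinant.det V = 1 / Determinant.det (mat_inv V)"
    by (metis mult_zero_right nonzero_eq_divide_eq zero_neq_one)
  then show ?thesis
    unfolding mvn_density_def using D by (simp add: real_sqrt_divide)
qed

lemma sets_coef_prior [simp]: "sets (coef_prior \<gamma> M) = sets (Pi\<^sub>M \<gamma> (\<lambda>_. borel))"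
  unfolding coef_prior_def by (simp cong: sets_PiM_cong)

lemma mvn_density_measurable:
  assumes "finite \<gamma>" and V: "pos_def_mat (card \<gamma>) V"
  shows "(\<lambda>\<beta>. ennreal (mvn_density V (subvec \<gamma> \<beta>))) \<in> borel_measurable (Pi\<^sub>M \<gamma> (\<lambda>_. lborel))"
  unfolding mvn_density_eq[OF V]
  using quad_form_subvec_measurable[OF assms(1) pos_def_inverse(1)[OF V]] by measurable

lemma prob_space_coef_prior:
  assumes "finite \<gamma>" and V: "pos_def_mat (card \<gamma>) V"
  shows "prob_space (coef_prior \<gamma> V)"
proof
  note W = pos_def_inverse[OF V]
  note g = nn_integral_gaussian_subvec[OF assms(1) W(4)]
  let ?c = "sqrt (Determinant.det (mat_inv V) / (2 * pi) ^ card \<gamma>)"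
  note m = quad_form_subvec_measurable[OF assms(1) W(1)]
  have "emeasure (coef_prior \<gamma> V) (space (coef_prior \<gamma> V)) =
      (\<integral>\<^sup>+\<beta>. ennreal (mvn_density V (subvec \<gamma> \<beta>)) \<partial>Pi\<^sub>M \<gamma> (\<lambda>_. lborel))"
    unfolding coef_prior_def using mvn_density_measurable[OF assms]
    by (subst emeasure_density) (auto intro!: nn_integral_cong)
  also have "\<dots> = (\<integral>\<^sup>+\<beta>. ennreal ?c * ennreal (exp (- quad_form (mat_inv V) (subvec \<gamma> \<beta>) / 2)) \<partial>Pi\<^sub>M \<gamma> (\<lambda>_. lborel))"
    unfolding mvn_density_eq[OF V] by (intro nn_integral_cong) (simp add: ennreal_mult g(1) less_imp_le)
  also have "\<dots> = ennreal ?c * ennreal (sqrt ((2 * pi) ^ card \<gamma> / Determinant.det (mat_inv V)))"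
    unfolding g(2)[symmetric] by (rule nn_integral_cmult) (use m in measurable)
  also have "\<dots> = 1"
    using g(1) by (simp add: ennreal_mult[symmetric] real_sqrt_mult[symmetric] less_imp_le)
  finally show "emeasure (coef_prior \<gamma> V) (space (coef_prior \<gamma> V)) = 1" .
qed

lemma pos_def_smult:
  assumes W: "pos_def_mat k W" and c: "0 < c"
  shows "pos_def_mat k (c \<cdot>\<^sub>m W)" "x \<in> carrier_vec k \<Longrightarrow> quad_form (c \<cdot>\<^sub>m W) x = c * quad_form W x"
proof -
  note D = pos_def_matD[OF W]
  show q: "quad_form (c \<cdot>\<^sub>m W) x = c * quad_form W x" if "x \<in> carrier_vec k" for x
    using D(1) that by (simp add: quad_form_sum[of _ k] sum_distrib_left mult.assoc)
  have "transpose_mat (c \<cdot>\<^sub>m W) = c \<cdot>\<^sub>m W"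
  proof (rule eq_matI)
    fix i j assume "i < dim_row (c \<cdot>\<^sub>m W)" "j < dim_col (c \<cdot>\<^sub>m W)"
    then have ij: "i < k" "j < k" using D(1) by auto
    then have "W $$ (j, i) = W $$ (i, j)"
      using D(1,2) by (metis carrier_matD index_transpose_mat(1))
    then show "transpose_mat (c \<cdot>\<^sub>m W) $$ (i, j) = (c \<cdot>\<^sub>m W) $$ (i, j)"
      using ij D(1) by auto
  qed (use D(1) in auto)
  then show "pos_def_mat k (c \<cdot>\<^sub>m W)"
    unfolding pos_def_mat_def using D(1) D(3) c q by auto
qed

lemma pos_def_one: "pos_def_mat k (1\<^sub>m k)"
  unfolding pos_def_mat_def by (auto simp: scalar_prod_self_pos)

text \<open>Only half of the exponent is spent on the tail; the other half still integrates, to a Gaussian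
  integral with the form \<open>V\<^sup>-\<^sup>1 / 2\<close>.\<close>

lemma coef_prior_tail:
  assumes fin: "finite \<gamma>" and ne: "\<gamma> \<noteq> {}" and V: "pos_def_mat (card \<gamma>) V"
    and B: "ch1 V \<le> B" and C: "0 \<le> C"
  shows "emeasure (coef_prior \<gamma> V) {\<beta> \<in> space (Pi\<^sub>M \<gamma> (\<lambda>_. lborel)). \<exists>j\<in>\<gamma>. C < \<bar>\<beta> j\<bar>}
    \<le> ennreal (sqrt (2 ^ card \<gamma>) * exp (- C\<^sup>2 / (4 * B)))"
proof -
  let ?k = "card \<gamma>" and ?T = "{\<beta> \<in> space (Pi\<^sub>M \<gamma> (\<lambda>_. lborel :: real measure)). \<exists>j\<in>\<gamma>. C < \<bar>\<beta> j\<bar>}"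
  have k: "0 < ?k" using fin ne by auto
  note W = pos_def_inverse[OF V]
  define W' where "W' = (1/2) \<cdot>\<^sub>m mat_inv V"
  have W': "pos_def_mat ?k W'" "\<And>x. x \<in> carrier_vec ?k \<Longrightarrow> quad_form W' x = 1 / 2 * quad_form (mat_inv V) x"
    unfolding W'_def using pos_def_smult[OF W(4), of "1/2"] by auto
  note g = nn_integral_gaussian_subvec[OF fin W(4)]
  note g' = nn_integral_gaussian_subvec[OF fin W'(1)]
  define d where "d = Determinant.det (mat_inv V)"
  have d: "0 < d" using g(1) unfolding d_def .
  have d': "Determinant.det W' = d / 2 ^ ?k"
    unfolding W'_def d_def using W(1) by (simp add: power_divide)
  have ch: "0 < ch1 V" by (rule ch1_pos[OF V k])
  let ?c = "sqrt (d / (2 * pi) ^ ?k)" and ?e = "exp (- C\<^sup>2 / (4 * B))"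
  have meas: "?T \<in> sets (Pi\<^sub>M \<gamma> (\<lambda>_. lborel))" using fin by measurable
  have pt: "mvn_density V (subvec \<gamma> \<beta>) \<le> ?c * ?e * exp (- quad_form W' (subvec \<gamma> \<beta>) / 2)"
    if \<beta>: "\<beta> \<in> ?T" for \<beta>
  proof -
    let ?v = "subvec \<gamma> \<beta>"
    from \<beta> obtain j where j: "j \<in> \<gamma>" "C < \<bar>\<beta> j\<bar>" by auto
    have "C\<^sup>2 \<le> (\<beta> j)\<^sup>2" using j C by (metis abs_le_square_iff abs_of_nonneg less_imp_le)
    also have "\<dots> \<le> (\<Sum>j\<in>\<gamma>. (\<beta> j)\<^sup>2)" by (rule member_le_sum) (use j fin in auto)
    finally have "C\<^sup>2 / B \<le> scalar_prod ?v ?v / ch1 V"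
      unfolding subvec_norm[OF fin] using ch B by (intro frac_le) (auto intro: sum_nonneg)
    also have "\<dots> \<le> quad_form (mat_inv V) ?v" by (rule inverse_form_ge[OF V k subvec_carrier])
    finally have C_le: "C\<^sup>2 / B \<le> quad_form (mat_inv V) ?v" .
    have "- quad_form (mat_inv V) ?v / 2 \<le> - C\<^sup>2 / (4 * B) + - quad_form W' ?v / 2"
    proof -
      have "- C\<^sup>2 / (4 * B) = - ((C\<^sup>2 / B) / 4)" by simp
      moreover have "quad_form W' ?v = quad_form (mat_inv V) ?v / 2"
        using W'(2)[OF subvec_carrier[of \<gamma> \<beta>]] by simp
      ultimately show ?thesis using C_le by linarith
    qed
    then have "exp (- quad_form (mat_inv V) ?v / 2) \<le> ?e * exp (- quad_form W' ?v / 2)"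
      unfolding exp_add[symmetric] by simp
    then have "?c * exp (- quad_form (mat_inv V) ?v / 2) \<le> ?c * (?e * exp (- quad_form W' ?v / 2))"
      using d by (intro mult_left_mono) auto
    then show ?thesis unfolding mvn_density_eq[OF V] d_def by (simp add: mult.assoc)
  qed
  have "emeasure (coef_prior \<gamma> V) ?T
      = (\<integral>\<^sup>+\<beta>. ennreal (mvn_density V (subvec \<gamma> \<beta>)) * indicator ?T \<beta> \<partial>Pi\<^sub>M \<gamma> (\<lambda>_. lborel))"
    unfolding coef_prior_def by (rule emeasure_density[OF mvn_density_measurable[OF fin V] meas])
  also have "\<dots> \<le> (\<integral>\<^sup>+\<beta>. ennreal (?c * ?e) * ennreal (exp (- quad_form W' (subvec \<gamma> \<beta>) / 2)) \<partial>Pi\<^sub>M \<gamma> (\<lambda>_. lborel))"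
  proof (intro nn_integral_mono)
    fix \<beta>
    show "ennreal (mvn_density V (subvec \<gamma> \<beta>)) * indicator ?T \<beta>
        \<le> ennreal (?c * ?e) * ennreal (exp (- quad_form W' (subvec \<gamma> \<beta>) / 2))"
    proof (cases "\<beta> \<in> ?T")
      case True
      have "ennreal (mvn_density V (subvec \<gamma> \<beta>)) \<le> ennreal (?c * ?e * exp (- quad_form W' (subvec \<gamma> \<beta>) / 2))"
        by (rule ennreal_leI[OF pt[OF True]])
      also have "\<dots> = ennreal (?c * ?e) * ennreal (exp (- quad_form W' (subvec \<gamma> \<beta>) / 2))"
        using d by (intro ennreal_mult) simp_all
      finally show ?thesis using True by (simp only: indicator_simps mult_1_right)
    next
      case False
      show ?thesis unfolding indicator_simps(2)[OF False] by (simp only: mult_zero_right zero_le)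
    qed
  qed
  also have "\<dots> = ennreal (?c * ?e) * ennreal (sqrt ((2 * pi) ^ ?k / (d / 2 ^ ?k)))"
    unfolding d'[symmetric] g'(2)[symmetric]
    by (rule nn_integral_cmult)
      (use quad_form_subvec_measurable[OF fin pos_def_matD(1)[OF W'(1)]] in measurable)
  also have "\<dots> = ennreal (sqrt (2 ^ ?k) * ?e)"
  proof -
    have "?c * sqrt ((2 * pi) ^ ?k / (d / 2 ^ ?k)) = sqrt (2 ^ ?k)"
      unfolding real_sqrt_mult[symmetric] using d by simp
    then have "?c * ?e * sqrt ((2 * pi) ^ ?k / (d / 2 ^ ?k)) = sqrt (2 ^ ?k) * ?e"
      by (simp only: mult.commute[of ?e] mult.left_commute[of _ ?e] mult.assoc[of ?e] mult.assoc[of _ ?e]) (simp only: mult.assoc[symmetric])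
    moreover have "0 \<le> ?c * ?e" "0 \<le> sqrt ((2 * pi) ^ ?k / (d / 2 ^ ?k))" using d by simp_all
    ultimately show ?thesis by (simp only: ennreal_mult[symmetric])
  qed
  finally show ?thesis .
qed

text \<open>The determinant is read off from the total mass: \<open>V\<^sup>-\<^sup>1 \<ge> 1 / B\<close> bounds the Gaussian integral of
  \<open>V\<^sup>-\<^sup>1\<close> by that of \<open>1 / B\<close> times the identity.\<close>

lemma det_inverse_ge:
  assumes fin: "finite (\<gamma> :: nat set)" and ne: "\<gamma> \<noteq> {}" and V: "pos_def_mat (card \<gamma>) V"
    and B: "ch1 V \<le> B"
  shows "1 / B ^ card \<gamma> \<le> Determinant.det (mat_inv V)"
proof -
  let ?k = "card \<gamma>"
  have k: "0 < ?k" using fin ne by auto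
  note W = pos_def_inverse[OF V]
  have ch: "0 < ch1 V" by (rule ch1_pos[OF V k])
  then have B0: "0 < B" using B by simp
  define J where "J = (1/B) \<cdot>\<^sub>m 1\<^sub>m ?k"
  have J: "pos_def_mat ?k J" "\<And>x. x \<in> carrier_vec ?k \<Longrightarrow> quad_form J x = 1/B * quad_form (1\<^sub>m ?k) x"
    unfolding J_def using pos_def_smult[OF pos_def_one, of "1/B"] B0 by auto
  have dJ: "Determinant.det J = 1 / B ^ ?k"
    unfolding J_def by (simp add: power_divide)
  note g = nn_integral_gaussian_subvec[OF fin W(4)]
  note gJ = nn_integral_gaussian_subvec[OF fin J(1)]
  have "ennreal (sqrt ((2 * pi) ^ ?k / Determinant.det (mat_inv V))) \<le> ennreal (sqrt ((2 * pi) ^ ?k / Determinant.det J))"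
    unfolding g(2)[symmetric] gJ(2)[symmetric]
  proof (intro nn_integral_mono ennreal_leI)
    fix \<beta> :: "nat \<Rightarrow> real"
    let ?v = "subvec \<gamma> \<beta>"
    have v: "?v \<in> carrier_vec ?k" by (rule subvec_carrier)
    have "quad_form J ?v = scalar_prod ?v ?v / B"
      using J(2)[OF v] v by simp
    also have "\<dots> \<le> scalar_prod ?v ?v / ch1 V"
      using ch B scalar_prod_self_nonneg by (intro divide_left_mono) auto
    also have "\<dots> \<le> quad_form (mat_inv V) ?v" by (rule inverse_form_ge[OF V k v])
    finally show "exp (- quad_form (mat_inv V) ?v / 2) \<le> exp (- quad_form J ?v / 2)" by simp
  qed
  then have "(2 * pi) ^ ?k / Determinant.det (mat_inv V) \<le> (2 * pi) ^ ?k / Determinant.det J"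
    using gJ(1) by (subst (asm) ennreal_le_iff) auto
  then have "Determinant.det J \<le> Determinant.det (mat_inv V)"
    using g(1) gJ(1) by (simp add: divide_le_cancel frac_le_eq divide_simps mult_le_cancel_left)
  then show ?thesis unfolding dJ .
qed

lemma coef_prior_box:
  assumes fin: "finite \<gamma>" and ne: "\<gamma> \<noteq> {}" and V: "pos_def_mat (card \<gamma>) V"
    and B: "ch1 V \<le> B" and B1: "ch1 (mat_inv V) \<le> B1" and w: "0 \<le> w"
    and Q: "(\<Sum>j\<in>\<gamma>. (\<bar>b j\<bar> + w)\<^sup>2) \<le> Q"
  shows "ennreal ((2 * w) ^ card \<gamma> * (exp (- B1 * Q / 2) / sqrt ((2 * pi * B) ^ card \<gamma>)))
    \<le> emeasure (coef_prior \<gamma> V) {\<beta> \<in> space (Pi\<^sub>M \<gamma> (\<lambda>_. lborel)). \<forall>j\<in>\<gamma>. \<bar>\<beta> j - b j\<bar> \<le> w}"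
proof -
  let ?k = "card \<gamma>"
  let ?T = "{\<beta> \<in> space (Pi\<^sub>M \<gamma> (\<lambda>_. lborel :: real measure)). \<forall>j\<in>\<gamma>. \<bar>\<beta> j - b j\<bar> \<le> w}"
  have k: "0 < ?k" using fin ne by auto
  note W = pos_def_inverse[OF V]
  have W1: "0 < ch1 (mat_inv V)" by (rule ch1_pos[OF W(4) k])
  have ch: "0 < ch1 V" by (rule ch1_pos[OF V k])
  have B0: "0 < B" using B ch by simp
  let ?c = "exp (- B1 * Q / 2) / sqrt ((2 * pi * B) ^ ?k)"
  have T_eq: "?T = Pi\<^sub>E \<gamma> (\<lambda>j. {b j - w .. b j + w})"
  proof (rule Set.set_eqI)
    fix \<beta> :: "nat \<Rightarrow> real"
    have "\<bar>\<beta> j - b j\<bar> \<le> w \<longleftrightarrow> \<beta> j \<in> {b j - w .. b j + w}" for j by auto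
    then show "\<beta> \<in> ?T \<longleftrightarrow> \<beta> \<in> Pi\<^sub>E \<gamma> (\<lambda>j. {b j - w .. b j + w})"
      by (simp only: mem_Collect_eq space_PiM PiE_iff space_lborel space_borel UNIV_I) blast
  qed
  interpret product_sigma_finite "\<lambda>_::nat. lborel :: real measure"
    by standard
  have vol: "emeasure (Pi\<^sub>M \<gamma> (\<lambda>_. lborel)) ?T = ennreal ((2 * w) ^ ?k)"
    unfolding T_eq using w fin by (subst emeasure_PiM) (simp_all add: ennreal_power del: power_mult_distrib)
  have meas: "?T \<in> sets (Pi\<^sub>M \<gamma> (\<lambda>_. lborel))" using fin by measurable
  have pt: "?c \<le> mvn_density V (subvec \<gamma> \<beta>)" if \<beta>: "\<beta> \<in> ?T" for \<beta>
  proof -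
    let ?v = "subvec \<gamma> \<beta>"
    have "scalar_prod ?v ?v = (\<Sum>j\<in>\<gamma>. (\<beta> j)\<^sup>2)" by (rule subvec_norm[OF fin])
    also have "\<dots> \<le> (\<Sum>j\<in>\<gamma>. (\<bar>b j\<bar> + w)\<^sup>2)"
    proof (intro sum_mono)
      fix j assume "j \<in> \<gamma>"
      then have "\<bar>\<beta> j - b j\<bar> \<le> w" using \<beta> by auto
      then have "\<bar>\<beta> j\<bar> \<le> \<bar>\<bar>b j\<bar> + w\<bar>" by linarith
      then show "(\<beta> j)\<^sup>2 \<le> (\<bar>b j\<bar> + w)\<^sup>2" by (simp only: abs_le_square_iff)
    qed
    finally have vQ: "scalar_prod ?v ?v \<le> Q" using Q by simp
    have "quad_form (mat_inv V) ?v \<le> ch1 (mat_inv V) * scalar_prod ?v ?v"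
      using pos_def_matD[OF W(4)] by (intro quad_form_le_ch1[OF _ _ k subvec_carrier]) auto
    also have "\<dots> \<le> B1 * Q"
      using W1 B1 by (intro mult_mono vQ scalar_prod_self_nonneg) linarith+
    finally have e: "exp (- B1 * Q / 2) \<le> exp (- quad_form (mat_inv V) ?v / 2)" by simp
    have "1 / sqrt ((2 * pi * B) ^ ?k) = sqrt ((1 / B ^ ?k) / (2 * pi) ^ ?k)"
      by (simp add: real_sqrt_divide power_mult_distrib mult.commute)
    also have "\<dots> \<le> sqrt (Determinant.det (mat_inv V) / (2 * pi) ^ ?k)"
      using det_inverse_ge[OF fin ne V B] by (intro real_sqrt_le_mono divide_right_mono) auto
    finally have "1 / sqrt ((2 * pi * B) ^ ?k) * exp (- B1 * Q / 2) \<le>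
        sqrt (Determinant.det (mat_inv V) / (2 * pi) ^ ?k) * exp (- quad_form (mat_inv V) ?v / 2)"
      using e by (rule mult_mono) (use pos_def_matD W(4) nn_integral_gaussian_subvec(1)[OF fin W(4)] in simp_all)
    then show ?thesis unfolding mvn_density_eq[OF V] by simp
  qed
  have "ennreal ((2 * w) ^ ?k * ?c) = (\<integral>\<^sup>+\<beta>. ennreal ?c * indicator ?T \<beta> \<partial>Pi\<^sub>M \<gamma> (\<lambda>_. lborel))"
    unfolding nn_integral_cmult_indicator[OF meas] vol using w B0
    by (subst ennreal_mult[symmetric]) (simp_all add: mult.commute)
  also have "\<dots> \<le> (\<integral>\<^sup>+\<beta>. ennreal (mvn_density V (subvec \<gamma> \<beta>)) * indicator ?T \<beta> \<partial>Pi\<^sub>M \<gamma> (\<lambda>_. lborel))"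
  proof (intro nn_integral_mono)
    fix \<beta>
    show "ennreal ?c * indicator ?T \<beta> \<le> ennreal (mvn_density V (subvec \<gamma> \<beta>)) * indicator ?T \<beta>"
    proof (cases "\<beta> \<in> ?T")
      case True
      then show ?thesis using ennreal_leI[OF pt[OF True]] by (simp only: indicator_simps mult_1_right)
    next
      case False
      show ?thesis unfolding indicator_simps(2)[OF False] by (simp only: mult_zero_right order_refl)
    qed
  qed
  also have "\<dots> = emeasure (coef_prior \<gamma> V) ?T"
    unfolding coef_prior_def by (rule emeasure_density[OF mvn_density_measurable[OF fin V] meas, symmetric])
  finally show ?thesis .
qed

section \<open>Binary responses: densities, distances and classification risk\<close>

context
  fixes a b :: "real \<Rightarrow> real" and c :: "bool \<Rightarrow> real"
  assumes glm: "is_glm a b c"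
begin

lemma glm_pdf_sum: "glm_pdf a b c True h + glm_pdf a b c False h = 1"
proof -
  have "(\<integral>y. glm_pdf a b c y h \<partial>nu_y) = 1" using glm unfolding is_glm_def by blast
  then show ?thesis by (simp add: lebesgue_integral_count_space_finite UNIV_bool)
qed

lemma glm_pdf_pos: "0 < glm_pdf a b c y h"
  unfolding glm_pdf_def by simp

lemma glm_pdf_le_1: "glm_pdf a b c y h \<le> 1"
  using glm_pdf_sum[of h] glm_pdf_pos[of True h] glm_pdf_pos[of False h] by (cases y) auto

lemma glm_deriv:
  "(a has_real_derivative deriv a h) (at h)" "(b has_real_derivative deriv b h) (at h)"
  using glm unfolding is_glm_def by (auto simp: DERIV_deriv_iff_field_differentiable)

lemma ln_glm_pdf_deriv:
  "((\<lambda>h. a h * of_bool y + b h + c y) has_real_derivative (deriv a h * of_bool y + deriv b h)) (at h)"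
  by (auto intro!: derivative_eq_intros glm_deriv)

lemma glm_pdf_deriv:
  "(glm_pdf a b c y has_real_derivative (glm_pdf a b c y h * (deriv a h * of_bool y + deriv b h))) (at h)"
  unfolding glm_pdf_def by (auto intro!: derivative_eq_intros glm_deriv)

lemma continuous_glm_pdf: "continuous_on UNIV (glm_pdf a b c y)"
  by (intro continuous_at_imp_continuous_on ballI DERIV_isCont[OF glm_pdf_deriv])

text \<open>Differentiating \<open>f(1,h) + f(0,h) = 1\<close> identifies \<open>\<psi>\<close> with the success probability.\<close>

lemma glm_psi_eq: "glm_psi a b h = glm_pdf a b c True h"
proof -
  have "((\<lambda>h. glm_pdf a b c True h + glm_pdf a b c False h) has_real_derivative
      (glm_pdf a b c True h * (deriv a h * of_bool True + deriv b h)
       + glm_pdf a b c False h * (deriv a h * of_bool False + deriv b h))) (at h)"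
    by (intro DERIV_add glm_pdf_deriv)
  moreover have "((\<lambda>h. glm_pdf a b c True h + glm_pdf a b c False h) has_real_derivative 0) (at h)"
    unfolding glm_pdf_sum by simp
  ultimately have "glm_pdf a b c True h * (deriv a h + deriv b h) + glm_pdf a b c False h * deriv b h = 0"
    using DERIV_unique by fastforce
  then have "glm_pdf a b c True h * deriv a h
      + (glm_pdf a b c True h + glm_pdf a b c False h) * deriv b h = 0"
    by (simp add: algebra_simps)
  then have "glm_pdf a b c True h * deriv a h = - deriv b h"
    unfolding glm_pdf_sum by simp
  moreover have "deriv a h \<noteq> 0" using glm unfolding is_glm_def by blast
  ultimately show ?thesis unfolding glm_psi_def by (simp add: field_simps)
qed

lemma ln_glm_pdf_deriv_bound: "\<bar>deriv a h * of_bool y + deriv b h\<bar> \<le> \<bar>deriv a h\<bar>"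
proof -
  have nz: "deriv a h \<noteq> 0" using glm unfolding is_glm_def by blast
  let ?p = "glm_pdf a b c True h"
  have "deriv b h = - ?p * deriv a h"
    using glm_psi_eq[of h] nz unfolding glm_psi_def by (simp add: field_simps)
  then have "deriv a h * of_bool y + deriv b h = deriv a h * (of_bool y - ?p)"
    by (simp add: algebra_simps)
  moreover have "\<bar>of_bool y - ?p\<bar> \<le> 1"
    using glm_pdf_pos[of True h] glm_pdf_le_1[of True h] by (cases y) auto
  ultimately show ?thesis by (simp add: abs_mult mult_left_le)
qed

text \<open>The log-likelihood has derivative \<open>a'(h) (y - \<psi>(h))\<close>, and \<open>\<psi>\<close> is a probability; hence this is a
  Lipschitz constant for it on \<open>[-R, R]\<close>.\<close>

definition glm_lip :: "real \<Rightarrow> real" where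
  "glm_lip R = (SUP h\<in>{h. \<bar>h\<bar> \<le> R}. \<bar>deriv a h\<bar>)"

lemma interval_eq: "{h::real. \<bar>h\<bar> \<le> R} = {-R..R}" by auto

lemma bdd_deriv_a: "bdd_above ((\<lambda>h. \<bar>deriv a h\<bar>) ` {h. \<bar>h\<bar> \<le> R})"
proof -
  have "continuous_on {-R..R} (\<lambda>h. \<bar>deriv a h\<bar>)"
    using glm unfolding is_glm_def by (intro continuous_intros) (auto intro: continuous_on_subset)
  then show ?thesis unfolding interval_eq
    by (intro bounded_imp_bdd_above compact_imp_bounded compact_continuous_image) auto
qed

lemma glm_lip_ge: "\<bar>h\<bar> \<le> R \<Longrightarrow> \<bar>deriv a h\<bar> \<le> glm_lip R"
  unfolding glm_lip_def by (rule cSUP_upper[OF _ bdd_deriv_a]) auto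

lemma glm_lip_pos: "0 \<le> R \<Longrightarrow> 0 < glm_lip R"
  using glm_lip_ge[of 0 R] glm unfolding is_glm_def by (metis abs_zero less_le_trans zero_less_abs_iff)

lemma glm_pdf_lipschitz:
  assumes "\<bar>h\<bar> \<le> R" "\<bar>h'\<bar> \<le> R"
  shows "glm_pdf a b c y h \<le> exp (glm_lip R * \<bar>h - h'\<bar>) * glm_pdf a b c y h'"
proof -
  let ?g = "\<lambda>h. a h * of_bool y + b h + c y"
  have "norm (?g h - ?g h') \<le> glm_lip R * norm (h - h')"
  proof (rule field_differentiable_bound[where S = "{-R..R}"])
    fix z assume z: "z \<in> {-R..R}"
    show "(?g has_field_derivative (deriv a z * of_bool y + deriv b z)) (at z within {-R..R})"
      by (rule has_field_derivative_at_within[OF ln_glm_pdf_deriv])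
    have "\<bar>z\<bar> \<le> R" using z by auto
    then show "norm (deriv a z * of_bool y + deriv b z) \<le> glm_lip R"
      using ln_glm_pdf_deriv_bound[of z y] glm_lip_ge[of z R] unfolding real_norm_def by linarith
  qed (use assms in auto)
  then have "?g h \<le> glm_lip R * \<bar>h - h'\<bar> + ?g h'" unfolding real_norm_def by linarith
  then show ?thesis unfolding glm_pdf_def exp_add[symmetric] by simp
qed

text \<open>The value \<open>\<psi>(0)\<close> is a positive constant below the supremum of \<open>\<bar>\<psi>\<bar>\<close>, so that \<open>D(R)\<close> controls
  \<open>R\<close> times the Lipschitz constant of the log-likelihood.\<close>

lemma glm_D_ge:
  assumes R: "0 \<le> R"
  shows "1 \<le> glm_D a b R" "R * glm_lip R \<le> glm_D a b R / glm_pdf a b c True 0"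
proof -
  let ?P = "SUP h\<in>{h. \<bar>h\<bar> \<le> R}. \<bar>glm_psi a b h\<bar>"
  have "bdd_above ((\<lambda>h. \<bar>glm_psi a b h\<bar>) ` {h. \<bar>h\<bar> \<le> R})"
    unfolding bdd_above_def using glm_pdf_le_1 glm_pdf_pos
    by (intro exI[of _ 1]) (auto simp: glm_psi_eq less_imp_le)
  then have "\<bar>glm_psi a b 0\<bar> \<le> ?P" using R by (intro cSUP_upper) auto
  then have P: "glm_pdf a b c True 0 \<le> ?P" using glm_psi_eq by simp
  have D: "glm_D a b R = 1 + R * glm_lip R * ?P" unfolding glm_D_def glm_lip_def ..
  have RL: "0 \<le> R * glm_lip R" using R glm_lip_pos[OF R] by simp
  have P0: "0 < ?P" using P glm_pdf_pos[of True 0] by linarith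
  show "1 \<le> glm_D a b R" unfolding D using RL P0 by simp
  have "R * glm_lip R * glm_pdf a b c True 0 \<le> R * glm_lip R * ?P"
    by (intro mult_left_mono P RL)
  also have "\<dots> \<le> glm_D a b R" unfolding D by simp
  finally show "R * glm_lip R \<le> glm_D a b R / glm_pdf a b c True 0"
    using glm_pdf_pos by (simp add: pos_le_divide_eq)
qed

end

text \<open>The square of the left-hand side is at most \<open>1 - (p-q)\<^sup>2\<close>, by the arithmetic-geometric mean
  inequality for \<open>p(1-p)\<close> and \<open>q(1-q)\<close>.\<close>

lemma bernoulli_affinity_le:
  fixes p q :: real
  assumes "0 \<le> p" "p \<le> 1" "0 \<le> q" "q \<le> 1"
  shows "sqrt (p * q) + sqrt ((1 - p) * (1 - q)) \<le> 1 - (p - q)\<^sup>2 / 2"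
proof -
  define s where "s = sqrt (p * q) + sqrt ((1 - p) * (1 - q))"
  have "2 * sqrt ((p * (1 - p)) * (q * (1 - q))) \<le> p * (1 - p) + q * (1 - q)"
    using arith_geo_mean_sqrt[of "p * (1 - p)" "q * (1 - q)"] assms by simp
  moreover have "sqrt (p * q) * sqrt ((1 - p) * (1 - q)) = sqrt ((p * (1 - p)) * (q * (1 - q)))"
    unfolding real_sqrt_mult[symmetric] by (simp add: algebra_simps)
  moreover have "s\<^sup>2 = p * q + (1 - p) * (1 - q) + 2 * (sqrt (p * q) * sqrt ((1 - p) * (1 - q)))"
    unfolding s_def power2_sum using assms by simp
  ultimately have "s\<^sup>2 \<le> 1 - (p - q)\<^sup>2"
    by (simp add: algebra_simps power2_eq_square)
  moreover have "2 * s \<le> 1 + s\<^sup>2"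
    using sum_squares_bound[of s 1] by simp
  ultimately show ?thesis unfolding s_def by simp
qed

text \<open>Positivity everywhere, which all fitted and true densities have, lets likelihood ratios be formed
  without exceptional sets.\<close>

definition cond_density :: "cov measure \<Rightarrow> cdens \<Rightarrow> bool" where
  "cond_density \<nu> p \<longleftrightarrow> (\<forall>y. p y \<in> borel_measurable \<nu>) \<and> (\<forall>x y. 0 < p y x)
     \<and> (\<forall>x. p True x + p False x = 1)"

lemma cond_densityD:
  assumes "cond_density \<nu> p"
  shows "p y \<in> borel_measurable \<nu>" "0 < p y x" "p False x = 1 - p True x" "p y x \<le> 1" "0 \<le> p y x"
proof -
  have *: "p True x + p False x = 1" "0 < p True x" "0 < p False x"
    using assms unfolding cond_density_def by auto
  show "p False x = 1 - p True x" "p y x \<le> 1" "0 \<le> p y x" using * by (cases y; simp)+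
  show "p y \<in> borel_measurable \<nu>" "0 < p y x" using assms unfolding cond_density_def by auto
qed

lemma cond_density_measurable_pair:
  assumes "\<And>y. g y \<in> borel_measurable \<nu>"
  shows "(\<lambda>(x, y). g y x) \<in> borel_measurable (\<nu> \<Otimes>\<^sub>M nu_y)"
proof -
  have [measurable]: "g y \<in> borel_measurable \<nu>" for y by (rule assms)
  have "(\<lambda>(x, y). g y x) = (\<lambda>z. if snd z then g True (fst z) else g False (fst z))"
    by (auto simp: fun_eq_iff)
  also have "\<dots> \<in> borel_measurable (\<nu> \<Otimes>\<^sub>M nu_y)" by measurable
  finally show ?thesis .
qed

text \<open>For two-point conditional densities this is the total variation distance of the joint laws of
  \<open>(x, y)\<close>: both values of \<open>y\<close> contribute the same integral, which cancels the factor \<open>1/2\<close>.\<close>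

definition tv_dist :: "cov measure \<Rightarrow> cdens \<Rightarrow> cdens \<Rightarrow> real" where
  "tv_dist \<nu> q p = (\<integral>x. \<bar>q True x - p True x\<bar> \<partial>\<nu>)"

lemma sets_obs_law: "sets (obs_law \<nu> p) = sets (\<nu> \<Otimes>\<^sub>M nu_y)"
  unfolding obs_law_def by simp

lemma space_obs_law: "space (obs_law \<nu> p) = space \<nu> \<times> UNIV"
  unfolding obs_law_def by (simp add: space_pair_measure)

lemma nn_integral_obs_law:
  assumes p: "cond_density \<nu> p" and g: "\<And>y. g y \<in> borel_measurable \<nu>" "\<And>y x. 0 \<le> g y x"
  shows "(\<integral>\<^sup>+z. ennreal (g (snd z) (fst z)) \<partial>obs_law \<nu> p)
    = (\<integral>\<^sup>+x. ennreal (p True x * g True x + p False x * g False x) \<partial>\<nu>)"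
proof -
  have [measurable]: "(\<lambda>(x, y). p y x) \<in> borel_measurable (\<nu> \<Otimes>\<^sub>M nu_y)" "(\<lambda>(x, y). g y x) \<in> borel_measurable (\<nu> \<Otimes>\<^sub>M nu_y)"
    by (rule cond_density_measurable_pair, rule cond_densityD(1)[OF p] g(1))+
  have m: "(\<lambda>(x, y). ennreal (p y x)) \<in> borel_measurable (\<nu> \<Otimes>\<^sub>M nu_y)" by measurable
  have gm: "(\<lambda>(x, y). ennreal (g y x)) \<in> borel_measurable (\<nu> \<Otimes>\<^sub>M nu_y)" by measurable
  interpret sigma_finite_measure "count_space (UNIV :: bool set)"
    by (rule sigma_finite_measure_count_space_finite) simp
  have "(\<integral>\<^sup>+z. ennreal (g (snd z) (fst z)) \<partial>obs_law \<nu> p)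
      = (\<integral>\<^sup>+z. (case z of (x, y) \<Rightarrow> ennreal (p y x)) * (case z of (x, y) \<Rightarrow> ennreal (g y x)) \<partial>(\<nu> \<Otimes>\<^sub>M nu_y))"
    unfolding obs_law_def nn_integral_density[OF m gm, symmetric] by (simp only: case_prod_unfold)
  also have "\<dots> = (\<integral>\<^sup>+x. \<integral>\<^sup>+y. ennreal (p y x) * ennreal (g y x) \<partial>nu_y \<partial>\<nu>)"
    using gm m by (subst nn_integral_fst[symmetric]) auto
  also have "\<dots> = (\<integral>\<^sup>+x. ennreal (p True x * g True x + p False x * g False x) \<partial>\<nu>)"
    using cond_densityD(5)[OF p] g(2)
    by (simp add: nn_integral_count_space_finite UNIV_bool ennreal_mult add.commute)
  finally show ?thesis .
qed

context
  fixes \<nu> :: "cov measure" and p :: cdens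
  assumes nu: "prob_space \<nu>" and p: "cond_density \<nu> p"
begin

interpretation nu: prob_space \<nu> by (rule nu)

lemma prob_space_obs_law: "prob_space (obs_law \<nu> p)"
proof
  show "emeasure (obs_law \<nu> p) (space (obs_law \<nu> p)) = 1"
    using nn_integral_obs_law[OF p, of "\<lambda>_ _. 1"] by (simp add: cond_densityD(3)[OF p] nu.emeasure_space_1)
qed

lemma integrable_abs_diff:
  assumes q: "q True \<in> borel_measurable \<nu>" "\<And>x. 0 \<le> q True x" "\<And>x. q True x \<le> 1"
  shows "integrable \<nu> (\<lambda>x. \<bar>q True x - p True x\<bar>)"
proof (rule nu.integrable_const_bound[where B = 1])
  show "AE x in \<nu>. norm \<bar>q True x - p True x\<bar> \<le> 1"
    using q cond_densityD(4,5)[OF p, of True] by (auto simp: abs_le_iff intro!: AE_I2 add_increasing2) (smt (verit))+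
  show "(\<lambda>x. \<bar>q True x - p True x\<bar>) \<in> borel_measurable \<nu>"
    using q cond_densityD(1)[OF p] by measurable
qed

lemma nn_integral_likelihood_ratio:
  assumes q: "cond_density \<nu> q"
  shows "(\<integral>\<^sup>+z. ennreal (q (snd z) (fst z) / p (snd z) (fst z)) \<partial>obs_law \<nu> p) = 1"
proof -
  have "p y x \<noteq> 0" for y x using cond_densityD(2)[OF p, of y x] by simp
  moreover have "(\<lambda>x. q y x / p y x) \<in> borel_measurable \<nu>" for y
    using cond_densityD(1)[OF q] cond_densityD(1)[OF p] by (intro borel_measurable_divide)
  ultimately show ?thesis
    using nn_integral_obs_law[OF p, of "\<lambda>y x. q y x / p y x"] cond_densityD(5)[OF p] cond_densityD(5)[OF q]
    by (simp add: cond_densityD(3)[OF q] nu.emeasure_space_1)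
qed

text \<open>The bound of \<open>bernoulli_affinity_le\<close> is averaged over \<open>x\<close>; the square is then moved outside by
  the Cauchy-Schwarz inequality.\<close>

lemma nn_integral_sqrt_likelihood_ratio:
  assumes q: "cond_density \<nu> q"
  shows "(\<integral>\<^sup>+z. ennreal (sqrt (q (snd z) (fst z) / p (snd z) (fst z))) \<partial>obs_law \<nu> p)
    \<le> ennreal (1 - (tv_dist \<nu> q p)\<^sup>2 / 2)"
proof -
  let ?d = "\<lambda>x. \<bar>q True x - p True x\<bar>"
  have qm [measurable]: "q y \<in> borel_measurable \<nu>" and pm [measurable]: "p y \<in> borel_measurable \<nu>" for y
    using cond_densityD(1)[OF q] cond_densityD(1)[OF p] by auto
  have d1: "?d x \<le> 1" for x
    using cond_densityD(4,5)[OF p, of True x] cond_densityD(4,5)[OF q, of True x] by linarith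
  have int: "integrable \<nu> ?d"
    using cond_densityD(4,5)[OF q] by (intro integrable_abs_diff) auto
  have int2: "integrable \<nu> (\<lambda>x. (?d x)\<^sup>2)"
  proof (rule nu.integrable_const_bound[where B = 1])
    show "AE x in \<nu>. norm ((?d x)\<^sup>2) \<le> 1"
      using d1 by (auto simp: abs_square_le_1)
  qed measurable
  have cs: "(tv_dist \<nu> q p)\<^sup>2 \<le> (\<integral>x. (?d x)\<^sup>2 \<partial>\<nu>)"
  proof -
    have "0 \<le> nu.variance ?d" by (rule nu.variance_positive)
    also have "\<dots> = (\<integral>x. (?d x)\<^sup>2 \<partial>\<nu>) - (\<integral>x. ?d x \<partial>\<nu>)\<^sup>2"
      by (rule nu.variance_eq[OF int int2])
    finally show ?thesis unfolding tv_dist_def by simp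
  qed
  have e: "p y x * sqrt (q y x / p y x) = sqrt (p y x * q y x)" for y x
  proof -
    have pp: "0 < p y x" "0 < q y x" using cond_densityD(2)[OF p] cond_densityD(2)[OF q] by auto
    then have "p y x * sqrt (q y x / p y x) = sqrt (p y x * p y x) * sqrt (q y x / p y x)" by simp
    also have "\<dots> = sqrt (p y x * q y x)" unfolding real_sqrt_mult[symmetric] using pp by simp
    finally show ?thesis .
  qed
  have "(\<integral>\<^sup>+z. ennreal (sqrt (q (snd z) (fst z) / p (snd z) (fst z))) \<partial>obs_law \<nu> p)
      = (\<integral>\<^sup>+x. ennreal (sqrt (p True x * q True x) + sqrt (p False x * q False x)) \<partial>\<nu>)"
    unfolding e[symmetric]
    by (rule nn_integral_obs_law[OF p]) (use cond_densityD(5)[OF p] cond_densityD(5)[OF q] in simp_all)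
  also have "\<dots> \<le> (\<integral>\<^sup>+x. ennreal (1 - (?d x)\<^sup>2 / 2) \<partial>\<nu>)"
  proof (intro nn_integral_mono ennreal_leI)
    fix x
    show "sqrt (p True x * q True x) + sqrt (p False x * q False x) \<le> 1 - (?d x)\<^sup>2 / 2"
      unfolding cond_densityD(3)[OF p, of x] cond_densityD(3)[OF q, of x] power2_abs
      using bernoulli_affinity_le[of "p True x" "q True x"] cond_densityD(4,5)[OF p, of True x] cond_densityD(4,5)[OF q, of True x]
      by (simp add: power2_commute)
  qed
  also have "\<dots> = ennreal (\<integral>x. 1 - (?d x)\<^sup>2 / 2 \<partial>\<nu>)"
  proof (rule nn_integral_eq_integral)
    show "integrable \<nu> (\<lambda>x. 1 - (?d x)\<^sup>2 / 2)" using int2 by auto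
    have "(?d x)\<^sup>2 \<le> 1" for x using d1[of x] by (simp add: abs_square_le_1)
    then show "AE x in \<nu>. 0 \<le> 1 - (?d x)\<^sup>2 / 2" by (intro AE_I2) (smt (verit) field_sum_of_halves)
  qed
  also have "(\<integral>x. 1 - (?d x)\<^sup>2 / 2 \<partial>\<nu>) = 1 - (\<integral>x. (?d x)\<^sup>2 \<partial>\<nu>) / 2"
    using int2 by (simp add: nu.prob_space)
  also have "ennreal \<dots> \<le> ennreal (1 - (tv_dist \<nu> q p)\<^sup>2 / 2)"
    using cs by (intro ennreal_leI) simp
  finally show ?thesis .
qed

lemma misclass_prob_eq:
  assumes C: "Measurable.pred \<nu> C"
  shows "misclass_prob (obs_law \<nu> p) C = (\<integral>x. (if C x then p False x else p True x) \<partial>\<nu>)"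
proof -
  let ?E = "{(x, y) \<in> space (obs_law \<nu> p). C x \<noteq> y}"
  have [measurable]: "Measurable.pred \<nu> C" "p y \<in> borel_measurable \<nu>" for y
    using C cond_densityD(1)[OF p] by auto
  have "?E = {z \<in> space (\<nu> \<Otimes>\<^sub>M nu_y). C (fst z) \<noteq> snd z}"
    by (auto simp: space_obs_law space_pair_measure)
  also have "\<dots> \<in> sets (\<nu> \<Otimes>\<^sub>M nu_y)" by measurable
  finally have E: "?E \<in> sets (\<nu> \<Otimes>\<^sub>M nu_y)" .
  have "emeasure (obs_law \<nu> p) ?E = (\<integral>\<^sup>+z. indicator ?E z \<partial>obs_law \<nu> p)"
    using E by (simp add: sets_obs_law)
  also have "\<dots> = (\<integral>\<^sup>+z. ennreal (of_bool (C (fst z) \<noteq> snd z)) \<partial>obs_law \<nu> p)"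
    by (intro nn_integral_cong) (auto simp: indicator_def)
  also have "\<dots> = (\<integral>\<^sup>+x. ennreal (p True x * of_bool (C x \<noteq> True) + p False x * of_bool (C x \<noteq> False)) \<partial>\<nu>)"
    by (rule nn_integral_obs_law[OF p, of "\<lambda>y x. of_bool (C x \<noteq> y)"]) simp_all
  also have "\<dots> = (\<integral>\<^sup>+x. ennreal (if C x then p False x else p True x) \<partial>\<nu>)"
    by (intro nn_integral_cong) simp
  finally have "emeasure (obs_law \<nu> p) ?E = (\<integral>\<^sup>+x. ennreal (if C x then p False x else p True x) \<partial>\<nu>)" .
  then show ?thesis
    unfolding misclass_prob_def measure_def
    by (subst integral_eq_nn_integral) (auto simp: cond_densityD(5)[OF p])
qed

lemma mean_fn_eq: "mean_fn q x = q True x"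
  unfolding mean_fn_def by (simp add: lebesgue_integral_count_space_finite UNIV_bool)

text \<open>Where the two classifiers disagree, \<open>1/2\<close> lies between the two success probabilities, so that
  the loss \<open>\<bar>2 p(1|x) - 1\<bar>\<close> is at most twice their difference.\<close>

lemma excess_risk_le:
  assumes q: "q True \<in> borel_measurable \<nu>" "\<And>x. 0 \<le> q True x" "\<And>x. q True x \<le> 1"
  shows "misclass_prob (obs_law \<nu> p) (classifier q) - misclass_prob (obs_law \<nu> p) (classifier p)
    \<le> 2 * tv_dist \<nu> q p"
proof -
  have pm [measurable]: "p y \<in> borel_measurable \<nu>" for y using cond_densityD(1)[OF p] by auto
  note [measurable] = q(1)
  let ?r = "\<lambda>C x. if C x then p False x else p True x"
  have C: "Measurable.pred \<nu> (classifier q)" "Measurable.pred \<nu> (classifier p)"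
    unfolding classifier_def mean_fn_eq by measurable
  have int: "integrable \<nu> (?r C)" if "Measurable.pred \<nu> C" for C
  proof (rule nu.integrable_const_bound[where B = 1])
    show "AE x in \<nu>. norm (?r C x) \<le> 1"
      using cond_densityD(4,5)[OF p] by (intro AE_I2) simp
  qed (use that in measurable)
  have "(\<integral>x. ?r (classifier q) x \<partial>\<nu>) - (\<integral>x. ?r (classifier p) x \<partial>\<nu>)
      = (\<integral>x. ?r (classifier q) x - ?r (classifier p) x \<partial>\<nu>)"
    using int C by simp
  also have "\<dots> \<le> (\<integral>x. 2 * \<bar>q True x - p True x\<bar> \<partial>\<nu>)"
  proof (rule integral_mono)
    show "integrable \<nu> (\<lambda>x. ?r (classifier q) x - ?r (classifier p) x)" using int C by simp
    show "integrable \<nu> (\<lambda>x. 2 * \<bar>q True x - p True x\<bar>)"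
      by (intro integrable_mult_right integrable_abs_diff q)
    show "?r (classifier q) x - ?r (classifier p) x \<le> 2 * \<bar>q True x - p True x\<bar>" for x
      unfolding classifier_def mean_fn_eq cond_densityD(3)[OF p, of x] by auto
  qed
  also have "\<dots> = 2 * tv_dist \<nu> q p" unfolding tv_dist_def by simp
  finally show ?thesis by (simp only: misclass_prob_eq[OF C(1)] misclass_prob_eq[OF C(2)])
qed

end

section \<open>The prior on models and coefficients\<close>

lemma space_param_space:
  "space (param_space K) = Pow {1..K} \<times> space (Pi\<^sub>M {1..K} (\<lambda>_. borel :: real measure))"
  unfolding param_space_def by (simp add: space_pair_measure)

lemma fst_param_subset: "\<theta> \<in> space (param_space K) \<Longrightarrow> fst \<theta> \<subseteq> {1..K}"
  by (auto simp: space_param_space)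

lemma param_fst_measurable [measurable]: "fst \<in> measurable (param_space K) (count_space (Pow {1..K}))"
  unfolding param_space_def by measurable

lemma param_snd_measurable [measurable]:
  "j \<in> {1..K} \<Longrightarrow> (\<lambda>\<theta>. snd \<theta> j) \<in> borel_measurable (param_space K)"
  unfolding param_space_def by measurable

lemma pred_fst_param [measurable]: "Measurable.pred (param_space K) (\<lambda>\<theta>. Q (fst \<theta>))"
proof -
  have "Measurable.pred (count_space (Pow {1..K})) Q" by simp
  from measurable_compose[OF param_fst_measurable this] show ?thesis .
qed

lemma coef_event_measurable:
  assumes "\<And>j. j \<in> {1..K} \<Longrightarrow> Measurable.pred borel (R j)"
  shows "{\<theta> \<in> space (param_space K). \<exists>j\<in>fst \<theta>. R j (snd \<theta> j)} \<in> sets (param_space K)"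
    "{\<theta> \<in> space (param_space K). \<forall>j\<in>fst \<theta>. R j (snd \<theta> j)} \<in> sets (param_space K)"
proof -
  have [measurable]: "Measurable.pred (param_space K) (\<lambda>\<theta>. R j (snd \<theta> j))" if "j \<in> {1..K}" for j
    using measurable_compose[OF param_snd_measurable assms] that by blast
  have "{\<theta> \<in> space (param_space K). \<exists>j\<in>fst \<theta>. R j (snd \<theta> j)}
      = {\<theta> \<in> space (param_space K). \<exists>j\<in>{1..K}. j \<in> fst \<theta> \<and> R j (snd \<theta> j)}"
    using fst_param_subset by fastforce
  also have "\<dots> \<in> sets (param_space K)" by measurable
  finally show "{\<theta> \<in> space (param_space K). \<exists>j\<in>fst \<theta>. R j (snd \<theta> j)} \<in> sets (param_space K)" .
  have "{\<theta> \<in> space (param_space K). \<forall>j\<in>fst \<theta>. R j (snd \<theta> j)}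
      = {\<theta> \<in> space (param_space K). \<forall>j\<in>{1..K}. j \<in> fst \<theta> \<longrightarrow> R j (snd \<theta> j)}"
    using fst_param_subset by fastforce
  also have "\<dots> \<in> sets (param_space K)" by measurable
  finally show "{\<theta> \<in> space (param_space K). \<forall>j\<in>fst \<theta>. R j (snd \<theta> j)} \<in> sets (param_space K)" .
qed

lemma zero_extend_measurable:
  assumes "\<gamma> \<subseteq> {1..K}"
  shows "(\<lambda>\<beta>. (\<gamma>, zero_extend K \<gamma> \<beta>)) \<in> measurable (coef_prior \<gamma> M) (param_space K)"
proof -
  have s [measurable_cong]: "sets (coef_prior \<gamma> M) = sets (Pi\<^sub>M \<gamma> (\<lambda>_. borel))" by simp
  have "zero_extend K \<gamma> \<in> measurable (Pi\<^sub>M \<gamma> (\<lambda>_. borel)) (Pi\<^sub>M {1..K} (\<lambda>_. borel))"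
    unfolding zero_extend_def
  proof (rule measurable_restrict)
    fix j assume "j \<in> {1..K}"
    show "(\<lambda>\<beta>. if j \<in> \<gamma> then \<beta> j else 0) \<in> borel_measurable (Pi\<^sub>M \<gamma> (\<lambda>_. borel :: real measure))"
      by (cases "j \<in> \<gamma>") simp_all
  qed
  then have "zero_extend K \<gamma> \<in> measurable (coef_prior \<gamma> M) (Pi\<^sub>M {1..K} (\<lambda>_. borel))"
    using s measurable_cong_sets by blast
  then show ?thesis unfolding param_space_def using assms by (intro measurable_Pair) auto
qed

lemma pmf_indep_model:
  assumes r: "r \<le> K" and \<gamma>: "\<gamma> \<subseteq> {1..K}"
  shows "pmf (map_pmf Collect (Pi_pmf {1..K} False (\<lambda>_. bernoulli_pmf (real r / real K)))) \<gamma>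
    = (real r / real K) ^ card \<gamma> * (1 - real r / real K) ^ (K - card \<gamma>)"
proof -
  let ?l = "real r / real K"
  have l: "0 \<le> ?l" "?l \<le> 1" using r by (auto simp: divide_le_eq_1)
  have inj: "inj (Collect :: (nat \<Rightarrow> bool) \<Rightarrow> nat set)" by (rule injI) auto
  have "pmf (map_pmf Collect (Pi_pmf {1..K} False (\<lambda>_. bernoulli_pmf ?l))) (Collect (\<lambda>j. j \<in> \<gamma>))
      = pmf (Pi_pmf {1..K} False (\<lambda>_. bernoulli_pmf ?l)) (\<lambda>j. j \<in> \<gamma>)"
    by (rule pmf_map_inj'[OF inj])
  also have "\<dots> = (\<Prod>j\<in>{1..K}. pmf (bernoulli_pmf ?l) (j \<in> \<gamma>))"
    using \<gamma> by (subst pmf_Pi) auto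
  also have "\<dots> = (\<Prod>j\<in>{1..K}. if j \<in> \<gamma> then ?l else 1 - ?l)"
    by (intro prod.cong refl) (simp add: l)
  also have "\<dots> = (\<Prod>j\<in>\<gamma>. ?l) * (\<Prod>j\<in>{1..K} - \<gamma>. 1 - ?l)"
  proof -
    have "{1..K} \<inter> {j. j \<in> \<gamma>} = \<gamma>" "{1..K} \<inter> - {j. j \<in> \<gamma>} = {1..K} - \<gamma>" using \<gamma> by auto
    then show ?thesis by (subst prod.If_cases) simp_all
  qed
  also have "\<dots> = ?l ^ card \<gamma> * (1 - ?l) ^ (K - card \<gamma>)"
    using \<gamma> by (simp add: card_Diff_subset finite_subset)
  finally show ?thesis by simp
qed

context
  fixes K r rbar :: nat and V :: "nat set \<Rightarrow> real Matrix.mat"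
  assumes r: "1 \<le> r" "r \<le> rbar" "rbar < K"
    and V: "\<And>\<gamma>. \<gamma> \<subseteq> {1..K} \<Longrightarrow> pos_def_mat (card \<gamma>) (V \<gamma>)"
begin

lemma indep_model_pos:
  "\<gamma> \<subseteq> {1..K} \<Longrightarrow> 0 < pmf (map_pmf Collect (Pi_pmf {1..K} False (\<lambda>_. bernoulli_pmf (real r / real K)))) \<gamma>"
  using r by (subst pmf_indep_model) (auto intro!: mult_pos_pos simp: zero_less_power)

lemma indep_model_cond_nonempty:
  "set_pmf (map_pmf Collect (Pi_pmf {1..K} False (\<lambda>_. bernoulli_pmf (real r / real K))))
     \<inter> {\<gamma>. card \<gamma> \<le> rbar} \<noteq> {}"
proof -
  have "{} \<in> set_pmf (map_pmf Collect (Pi_pmf {1..K} False (\<lambda>_. bernoulli_pmf (real r / real K))))"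
    unfolding set_pmf_iff using indep_model_pos[of "{}"] by simp
  moreover have "{} \<in> {\<gamma> :: nat set. card \<gamma> \<le> rbar}" by simp
  ultimately show ?thesis by blast
qed

lemma set_model_prior: "set_pmf (model_prior K r rbar) \<subseteq> {\<gamma>. \<gamma> \<subseteq> {1..K} \<and> card \<gamma> \<le> rbar}"
proof -
  have "\<gamma> \<subseteq> {1..K}" if "\<gamma> \<in> set_pmf (map_pmf Collect (Pi_pmf {1..K} False (\<lambda>_. bernoulli_pmf (real r / real K))))" for \<gamma>
    using that set_Pi_pmf_subset[of "{1..K}" False "\<lambda>_. bernoulli_pmf (real r / real K)"]
    by fastforce
  then show ?thesis
    unfolding model_prior_def set_cond_pmf[OF indep_model_cond_nonempty] by blast
qed

text \<open>Conditioning divides by a probability, hence can only increase the mass of a model that satisfies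
  the condition.\<close>

lemma model_prior_ge:
  assumes "\<gamma> \<subseteq> {1..K}" "card \<gamma> \<le> rbar"
  shows "(real r / real K) ^ card \<gamma> * (1 - real r / real K) ^ (K - card \<gamma>) \<le> pmf (model_prior K r rbar) \<gamma>"
proof -
  let ?M = "map_pmf Collect (Pi_pmf {1..K} False (\<lambda>_. bernoulli_pmf (real r / real K)))"
  have "0 < measure ?M {\<gamma>. card \<gamma> \<le> rbar}"
    using indep_model_cond_nonempty by (auto intro: measure_pmf_posI)
  moreover have "measure ?M {\<gamma>. card \<gamma> \<le> rbar} \<le> 1" by simp
  ultimately have "pmf ?M \<gamma> \<le> pmf ?M \<gamma> / measure ?M {\<gamma>. card \<gamma> \<le> rbar}"
    by (simp add: pos_le_divide_eq mult_left_le)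
  then show ?thesis
    unfolding model_prior_def pmf_cond[OF indep_model_cond_nonempty]
    using assms r by (subst (asm) (1) pmf_indep_model) auto
qed

definition coef_kernel :: "nat set \<Rightarrow> param measure" where
  "coef_kernel \<gamma> = distr (coef_prior \<gamma> (V \<gamma>)) (param_space K) (\<lambda>\<beta>. (\<gamma>, zero_extend K \<gamma> \<beta>))"

definition model_space :: "nat set measure" where
  "model_space = restrict_space (measure_pmf (model_prior K r rbar)) (Pow {1..K})"

lemma prior_eq: "prior K r rbar V = model_space \<bind> coef_kernel"
  unfolding prior_def model_space_def coef_kernel_def ..

lemma space_model_space: "space model_space = Pow {1..K}"
  unfolding model_space_def by (simp add: space_restrict_space)

lemma prob_space_coef_kernel: "\<gamma> \<subseteq> {1..K} \<Longrightarrow> prob_space (coef_kernel \<gamma>)"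
  unfolding coef_kernel_def
  by (intro prob_space.prob_space_distr prob_space_coef_prior V zero_extend_measurable)
    (auto intro: finite_subset)

lemma coef_kernel_measurable: "coef_kernel \<in> measurable model_space (subprob_algebra (param_space K))"
proof (rule measurableI)
  fix \<gamma> assume "\<gamma> \<in> space model_space"
  then show "coef_kernel \<gamma> \<in> space (subprob_algebra (param_space K))"
    unfolding space_model_space space_subprob_algebra
    using prob_space_coef_kernel prob_space_imp_subprob_space by (auto simp: coef_kernel_def)
next
  fix A :: "param measure set"
  show "coef_kernel -` A \<inter> space model_space \<in> sets model_space"
    unfolding space_model_space by (auto simp: model_space_def sets_restrict_space)
qed

lemma nn_integral_model_space:
  "(\<integral>\<^sup>+\<gamma>. g \<gamma> \<partial>model_space) = (\<integral>\<^sup>+\<gamma>. g \<gamma> \<partial>measure_pmf (model_prior K r rbar))"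
proof -
  have "(\<integral>\<^sup>+\<gamma>. g \<gamma> \<partial>model_space) = (\<integral>\<^sup>+\<gamma>. g \<gamma> * indicator (Pow {1..K}) \<gamma> \<partial>measure_pmf (model_prior K r rbar))"
    unfolding model_space_def by (subst nn_integral_restrict_space) auto
  also have "\<dots> = (\<integral>\<^sup>+\<gamma>. g \<gamma> \<partial>measure_pmf (model_prior K r rbar))"
    by (intro nn_integral_cong_AE) (use set_model_prior in \<open>auto simp: AE_measure_pmf_iff indicator_def\<close>)
  finally show ?thesis .
qed

lemma sets_prior: "sets (prior K r rbar V) = sets (param_space K)"
  unfolding prior_eq by (rule sets_bind) (auto simp: coef_kernel_def space_model_space)

lemma emeasure_prior:
  "X \<in> sets (param_space K) \<Longrightarrow>
    emeasure (prior K r rbar V) X = (\<integral>\<^sup>+\<gamma>. emeasure (coef_kernel \<gamma>) X \<partial>measure_pmf (model_prior K r rbar))"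
  unfolding prior_eq nn_integral_model_space[symmetric]
  by (rule emeasure_bind[OF _ coef_kernel_measurable]) (auto simp: space_model_space)

lemma emeasure_prior_le:
  assumes X: "X \<in> sets (param_space K)"
    and le: "\<And>\<gamma>. \<gamma> \<subseteq> {1..K} \<Longrightarrow> card \<gamma> \<le> rbar \<Longrightarrow> emeasure (coef_kernel \<gamma>) X \<le> u"
  shows "emeasure (prior K r rbar V) X \<le> u"
proof -
  have "emeasure (prior K r rbar V) X \<le> (\<integral>\<^sup>+\<gamma>. u \<partial>measure_pmf (model_prior K r rbar))"
    unfolding emeasure_prior[OF X]
    by (intro nn_integral_mono_AE) (use set_model_prior le in \<open>auto simp: AE_measure_pmf_iff\<close>)
  then show ?thesis by simp
qed

lemma prob_space_prior: "prob_space (prior K r rbar V)"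
proof
  have "emeasure (prior K r rbar V) (space (prior K r rbar V))
      = (\<integral>\<^sup>+\<gamma>. emeasure (coef_kernel \<gamma>) (space (param_space K)) \<partial>measure_pmf (model_prior K r rbar))"
    unfolding sets_eq_imp_space_eq[OF sets_prior] by (rule emeasure_prior) simp
  also have "\<dots> = (\<integral>\<^sup>+\<gamma>. 1 \<partial>measure_pmf (model_prior K r rbar))"
  proof (intro nn_integral_cong_AE, unfold AE_measure_pmf_iff, safe)
    fix \<gamma> assume "\<gamma> \<in> set_pmf (model_prior K r rbar)"
    then have "prob_space (coef_kernel \<gamma>)" using set_model_prior prob_space_coef_kernel by blast
    from prob_space.emeasure_space_1[OF this]
    show "emeasure (coef_kernel \<gamma>) (space (param_space K)) = 1" by (simp add: coef_kernel_def)
  qed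
  finally show "emeasure (prior K r rbar V) (space (prior K r rbar V)) = 1" by simp
qed

lemma emeasure_coef_kernel:
  "\<gamma> \<subseteq> {1..K} \<Longrightarrow> X \<in> sets (param_space K) \<Longrightarrow> emeasure (coef_kernel \<gamma>) X
    = emeasure (coef_prior \<gamma> (V \<gamma>)) {\<beta> \<in> space (Pi\<^sub>M \<gamma> (\<lambda>_. lborel)). (\<gamma>, zero_extend K \<gamma> \<beta>) \<in> X}"
  unfolding coef_kernel_def using zero_extend_measurable[of \<gamma> K "V \<gamma>"]
  by (subst emeasure_distr) (auto intro!: arg_cong[where f = "emeasure _"] simp: coef_prior_def)

lemma prior_model_size: "AE \<theta> in prior K r rbar V. card (fst \<theta>) \<le> rbar"
proof (rule AE_I')
  let ?X = "{\<theta> \<in> space (param_space K). \<not> card (fst \<theta>) \<le> rbar}"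
  have X: "?X \<in> sets (param_space K)" by measurable
  have "emeasure (prior K r rbar V) ?X \<le> 0"
  proof (rule emeasure_prior_le[OF X])
    fix \<gamma> assume g: "\<gamma> \<subseteq> {1..K}" "card \<gamma> \<le> rbar"
    have "{\<beta> \<in> space (Pi\<^sub>M \<gamma> (\<lambda>_. lborel)). (\<gamma>, zero_extend K \<gamma> \<beta>) \<in> ?X} = {}" using g by auto
    then show "emeasure (coef_kernel \<gamma>) ?X \<le> 0"
      unfolding emeasure_coef_kernel[OF g(1) X] by (simp only: emeasure_empty order_refl)
  qed
  then show "?X \<in> null_sets (prior K r rbar V)" using X by (auto simp: sets_prior)
  show "{\<theta> \<in> space (prior K r rbar V). \<not> card (fst \<theta>) \<le> rbar} \<subseteq> ?X"
    unfolding sets_eq_imp_space_eq[OF sets_prior] ..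
qed

lemma prior_tail:
  assumes B: "\<And>\<gamma>. \<gamma> \<subseteq> {1..K} \<Longrightarrow> \<gamma> \<noteq> {} \<Longrightarrow> card \<gamma> \<le> rbar \<Longrightarrow> ch1 (V \<gamma>) \<le> B" and C: "0 \<le> C"
  shows "emeasure (prior K r rbar V) {\<theta> \<in> space (param_space K). \<exists>j\<in>fst \<theta>. C < \<bar>snd \<theta> j\<bar>}
    \<le> ennreal (sqrt (2 ^ rbar) * exp (- C\<^sup>2 / (4 * B)))"
proof (rule emeasure_prior_le)
  let ?X = "{\<theta> \<in> space (param_space K). \<exists>j\<in>fst \<theta>. C < \<bar>snd \<theta> j\<bar>}"
  show X: "?X \<in> sets (param_space K)" by (rule coef_event_measurable) measurable
  fix \<gamma> assume g: "\<gamma> \<subseteq> {1..K}" "card \<gamma> \<le> rbar"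
  let ?Y = "{\<beta> \<in> space (Pi\<^sub>M \<gamma> (\<lambda>_. lborel)). (\<gamma>, zero_extend K \<gamma> \<beta>) \<in> ?X}"
  have sub: "?Y \<subseteq> {\<beta> \<in> space (Pi\<^sub>M \<gamma> (\<lambda>_. lborel)). \<exists>j\<in>\<gamma>. C < \<bar>\<beta> j\<bar>}"
    using g by (auto simp: zero_extend_def split: if_splits)
  have fin: "finite \<gamma>" using g(1) by (rule finite_subset) simp
  show "emeasure (coef_kernel \<gamma>) ?X \<le> ennreal (sqrt (2 ^ rbar) * exp (- C\<^sup>2 / (4 * B)))"
  proof (cases "\<gamma> = {}")
    case True
    then have "?Y = {}" by auto
    then show ?thesis unfolding emeasure_coef_kernel[OF g(1) X] by (simp only: emeasure_empty zero_le)
  next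
    case False
    have m: "{\<beta> \<in> space (Pi\<^sub>M \<gamma> (\<lambda>_. lborel)). \<exists>j\<in>\<gamma>. C < \<bar>\<beta> j\<bar>} \<in> sets (Pi\<^sub>M \<gamma> (\<lambda>_. lborel :: real measure))"
      using fin by measurable
    have "emeasure (coef_kernel \<gamma>) ?X \<le>
        emeasure (coef_prior \<gamma> (V \<gamma>)) {\<beta> \<in> space (Pi\<^sub>M \<gamma> (\<lambda>_. lborel)). \<exists>j\<in>\<gamma>. C < \<bar>\<beta> j\<bar>}"
      unfolding emeasure_coef_kernel[OF g(1) X] by (rule emeasure_mono[OF sub]) (use m in \<open>simp add: coef_prior_def\<close>)
    also have "\<dots> \<le> ennreal (sqrt (2 ^ card \<gamma>) * exp (- C\<^sup>2 / (4 * B)))"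
      by (rule coef_prior_tail[OF fin False V[OF g(1)] B[OF g(1) False g(2)] C])
    also have "\<dots> \<le> ennreal (sqrt (2 ^ rbar) * exp (- C\<^sup>2 / (4 * B)))"
      using g(2) by (intro ennreal_leI mult_right_mono real_sqrt_le_mono power_increasing) auto
    finally show ?thesis .
  qed
qed

lemma prior_box:
  assumes g: "\<gamma> \<subseteq> {1..K}" "card \<gamma> = r"
    and B: "ch1 (V \<gamma>) \<le> B" and B1: "ch1 (mat_inv (V \<gamma>)) \<le> B1" and w: "0 \<le> w"
    and Q: "(\<Sum>j\<in>\<gamma>. (\<bar>b j\<bar> + w)\<^sup>2) \<le> Q"
  shows "ennreal ((real r / real K) ^ r * (1 - real r / real K) ^ (K - r)
      * ((2 * w) ^ r * (exp (- B1 * Q / 2) / sqrt ((2 * pi * B) ^ r))))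
    \<le> emeasure (prior K r rbar V)
        {\<theta> \<in> space (param_space K). fst \<theta> = \<gamma> \<and> (\<forall>j\<in>fst \<theta>. \<bar>snd \<theta> j - b j\<bar> \<le> w)}"
proof -
  let ?X = "{\<theta> \<in> space (param_space K). fst \<theta> = \<gamma> \<and> (\<forall>j\<in>fst \<theta>. \<bar>snd \<theta> j - b j\<bar> \<le> w)}"
  have fin: "finite \<gamma>" using g(1) by (rule finite_subset) simp
  have ne: "\<gamma> \<noteq> {}" using g r by auto
  have k: "0 < card \<gamma>" using fin ne by auto
  have "{\<theta> \<in> space (param_space K). \<forall>j\<in>fst \<theta>. \<bar>snd \<theta> j - b j\<bar> \<le> w} \<in> sets (param_space K)"
    by (rule coef_event_measurable) measurable
  then have X: "?X \<in> sets (param_space K)"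
    by (simp only: conj_commute[of "fst _ = \<gamma>"]) (intro sets.sets_Collect_conj, simp_all)
  let ?Y = "{\<beta> \<in> space (Pi\<^sub>M \<gamma> (\<lambda>_. lborel)). (\<gamma>, zero_extend K \<gamma> \<beta>) \<in> ?X}"
  have "?Y = {\<beta> \<in> space (Pi\<^sub>M \<gamma> (\<lambda>_. lborel)). \<forall>j\<in>\<gamma>. \<bar>\<beta> j - b j\<bar> \<le> w}"
    using g by (auto simp: zero_extend_def space_param_space space_PiM subset_iff)
  then have Y: "emeasure (coef_kernel \<gamma>) ?X
      = emeasure (coef_prior \<gamma> (V \<gamma>)) {\<beta> \<in> space (Pi\<^sub>M \<gamma> (\<lambda>_. lborel)). \<forall>j\<in>\<gamma>. \<bar>\<beta> j - b j\<bar> \<le> w}"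
    unfolding emeasure_coef_kernel[OF g(1) X] by simp
  have B0: "0 < B" using ch1_pos[OF V[OF g(1)] k] B by simp
  have "ennreal ((real r / real K) ^ r * (1 - real r / real K) ^ (K - r)
      * ((2 * w) ^ r * (exp (- B1 * Q / 2) / sqrt ((2 * pi * B) ^ r))))
      = ennreal ((real r / real K) ^ r * (1 - real r / real K) ^ (K - r))
      * ennreal ((2 * w) ^ r * (exp (- B1 * Q / 2) / sqrt ((2 * pi * B) ^ r)))"
    using w B0 r by (intro ennreal_mult) (auto intro!: mult_nonneg_nonneg)
  also have "\<dots> \<le> ennreal (pmf (model_prior K r rbar) \<gamma>) * emeasure (coef_kernel \<gamma>) ?X"
    unfolding Y using model_prior_ge[OF g(1)] g r coef_prior_box[OF fin ne V[OF g(1)] B B1 w Q]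
    by (intro mult_mono ennreal_leI) auto
  also have "\<dots> = (\<integral>\<^sup>+\<gamma>'. emeasure (coef_kernel \<gamma>) ?X * indicator {\<gamma>} \<gamma>' \<partial>measure_pmf (model_prior K r rbar))"
    by (subst nn_integral_cmult_indicator) (auto simp: emeasure_pmf_single mult.commute)
  also have "\<dots> \<le> (\<integral>\<^sup>+\<gamma>'. emeasure (coef_kernel \<gamma>') ?X \<partial>measure_pmf (model_prior K r rbar))"
    by (intro nn_integral_mono) (auto simp: indicator_def)
  also have "\<dots> = emeasure (prior K r rbar V) ?X" by (rule emeasure_prior[OF X, symmetric])
  finally show ?thesis .
qed

end

section \<open>Posterior probabilities under the true law\<close>

lemma linear_predictor_measurable:
  assumes nu_sets: "sets \<nu> = sets (cov_space K)"
  shows "(\<lambda>z. \<Sum>j\<in>fst (snd z). fst z j * snd (snd z) j) \<in> borel_measurable (\<nu> \<Otimes>\<^sub>M param_space K)"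
proof -
  let ?g = "\<lambda>z :: cov \<times> param. \<Sum>j\<in>{1..K}. if j \<in> fst (snd z) then fst z j * snd (snd z) j else 0"
  have x: "(\<lambda>x. x j) \<in> borel_measurable \<nu>" if "j \<in> {1..K}" for j
  proof -
    have "(\<lambda>x. x j) \<in> borel_measurable (cov_space K)"
      unfolding cov_space_def using that by (rule measurable_component_singleton)
    then show ?thesis using nu_sets measurable_cong_sets by blast
  qed
  have [measurable]: "(\<lambda>z. fst z j) \<in> borel_measurable (\<nu> \<Otimes>\<^sub>M param_space K)" if "j \<in> {1..K}" for j
    by (rule measurable_compose[OF measurable_fst x[OF that]])
  have [measurable]: "(\<lambda>z. snd (snd z) j) \<in> borel_measurable (\<nu> \<Otimes>\<^sub>M param_space K)" if "j \<in> {1..K}" for j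
    by (rule measurable_compose[OF measurable_snd param_snd_measurable[OF that]])
  have [measurable]: "Measurable.pred (\<nu> \<Otimes>\<^sub>M param_space K) (\<lambda>z. j \<in> fst (snd z))" for j
    by (rule measurable_compose[OF measurable_snd pred_fst_param])
  have "?g \<in> borel_measurable (\<nu> \<Otimes>\<^sub>M param_space K)" by measurable
  also have "?this \<longleftrightarrow> ?thesis"
  proof (rule measurable_cong)
    fix z :: "cov \<times> param" assume "z \<in> space (\<nu> \<Otimes>\<^sub>M param_space K)"
    then have "snd z \<in> space (param_space K)" by (auto simp: space_pair_measure)
    then have "fst (snd z) \<subseteq> {1..K}" by (rule fst_param_subset)
    then show "?g z = (\<Sum>j\<in>fst (snd z). fst z j * snd (snd z) j)"
      by (intro sum.mono_neutral_cong_right) auto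
  qed
  finally show ?thesis .
qed

lemma sqrt_prod: "sqrt (\<Prod>i\<in>I. g i) = (\<Prod>i\<in>I. sqrt (g i))"
  by (induction I rule: infinite_finite_induct) (auto simp: real_sqrt_mult)

context
  fixes a b :: "real \<Rightarrow> real" and c :: "bool \<Rightarrow> real" and f :: "bool \<Rightarrow> real \<Rightarrow> real"
    and n :: nat
  assumes glm: "is_glm a b c" and f_eq: "f = glm_pdf a b c"
begin

lemma f_measurable: "f y \<in> borel_measurable borel"
  unfolding f_eq by (intro borel_measurable_continuous_onI continuous_glm_pdf[OF glm])

lemma f_pos: "0 < f y h" and f_le_1: "f y h \<le> 1" and f_sum: "f True h + f False h = 1"
  unfolding f_eq using glm_pdf_pos[OF glm] glm_pdf_le_1[OF glm] glm_pdf_sum[OF glm] by auto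

lemma likelihood_pos: "0 < likelihood f n D \<theta>"
  unfolding likelihood_def model_density_def by (intro prod_pos) (simp add: f_pos)

lemma likelihood_le_1: "likelihood f n D \<theta> \<le> 1"
  unfolding likelihood_def model_density_def by (intro prod_le_1) (simp add: f_pos f_le_1 less_imp_le)

context
  fixes K :: nat and \<nu> :: "cov measure"
  assumes nu_sets: "sets \<nu> = sets (cov_space K)"
begin

lemma model_density_measurable:
  "(\<lambda>z. model_density f (snd z) y (fst z)) \<in> borel_measurable (\<nu> \<Otimes>\<^sub>M param_space K)"
  unfolding model_density_def
  by (rule measurable_compose[OF linear_predictor_measurable[OF nu_sets] f_measurable])

lemma cond_density_model:
  assumes "fst \<theta> \<subseteq> {1..K}"
  shows "cond_density \<nu> (model_density f \<theta>)"
proof -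
  have x: "(\<lambda>x. x j) \<in> borel_measurable \<nu>" if "j \<in> fst \<theta>" for j
  proof -
    have "(\<lambda>x. x j) \<in> borel_measurable (cov_space K)"
      unfolding cov_space_def using that assms by (intro measurable_component_singleton) auto
    then show ?thesis using nu_sets measurable_cong_sets by blast
  qed
  have "(\<lambda>x. \<Sum>j\<in>fst \<theta>. x j * snd \<theta> j) \<in> borel_measurable \<nu>"
    by (intro borel_measurable_sum borel_measurable_times x) auto
  from measurable_compose[OF this f_measurable]
  show ?thesis
    unfolding cond_density_def model_density_def using f_pos f_sum by auto
qed

lemma likelihood_measurable:
  "(\<lambda>z. likelihood f n (fst z) (snd z))
    \<in> borel_measurable (Pi\<^sub>M {1..n} (\<lambda>_. \<nu> \<Otimes>\<^sub>M nu_y) \<Otimes>\<^sub>M param_space K)"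
proof -
  let ?N = "Pi\<^sub>M {1..n} (\<lambda>_. \<nu> \<Otimes>\<^sub>M nu_y) \<Otimes>\<^sub>M param_space K"
  have [measurable]: "(\<lambda>z. model_density f (snd z) (snd (fst z i)) (fst (fst z i))) \<in> borel_measurable ?N"
    if i: "i \<in> {1..n}" for i
  proof -
    have Di: "(\<lambda>z. fst z i) \<in> measurable ?N (\<nu> \<Otimes>\<^sub>M nu_y)"
      by (rule measurable_compose[OF measurable_fst measurable_component_singleton[OF i]])
    have pr: "(\<lambda>z. (fst (fst z i), snd z)) \<in> measurable ?N (\<nu> \<Otimes>\<^sub>M param_space K)"
      using Di by (intro measurable_Pair measurable_snd measurable_compose[OF Di measurable_fst])
    have [measurable]: "(\<lambda>z. model_density f (snd z) y (fst (fst z i))) \<in> borel_measurable ?N" for y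
      using measurable_compose[OF pr model_density_measurable[of y]] by simp
    have [measurable]: "Measurable.pred ?N (\<lambda>z. snd (fst z i))"
      by (rule measurable_compose[OF Di measurable_snd])
    have "(\<lambda>z. model_density f (snd z) (snd (fst z i)) (fst (fst z i)))
        = (\<lambda>z. if snd (fst z i) then model_density f (snd z) True (fst (fst z i))
               else model_density f (snd z) False (fst (fst z i)))"
      by (auto simp: fun_eq_iff)
    also have "\<dots> \<in> borel_measurable ?N" by measurable
    finally show ?thesis .
  qed
  show ?thesis unfolding likelihood_def by measurable
qed

context
  fixes \<theta>s :: param and \<pi> :: "param measure"
  assumes nu: "prob_space \<nu>" and \<theta>s: "fst \<theta>s \<subseteq> {1..K}" and prior: "prob_space \<pi>" and prior_sets: "sets \<pi> = sets (param_space K)"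
begin

abbreviation "P_D \<equiv> data_law n \<nu> (model_density f \<theta>s)"
abbreviation "post \<equiv> posterior f \<pi> n"
abbreviation "evidence D \<equiv> \<integral>\<^sup>+\<theta>. ennreal (likelihood f n D \<theta>) \<partial>\<pi>"
abbreviation "evidence_on T D \<equiv> \<integral>\<^sup>+\<theta>. ennreal (likelihood f n D \<theta>) * indicator T \<theta> \<partial>\<pi>"

lemma sets_data_law: "sets P_D = sets (Pi\<^sub>M {1..n} (\<lambda>_. \<nu> \<Otimes>\<^sub>M nu_y))"
  unfolding data_law_def by (intro sets_PiM_cong) (auto simp: sets_obs_law)

lemma product_prob_data: "product_prob_space (\<lambda>_::nat. obs_law \<nu> (model_density f \<theta>s))"
  using prob_space_obs_law[OF nu cond_density_model[OF \<theta>s]]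
  by (intro product_prob_space.intro product_sigma_finite.intro product_prob_space_axioms.intro prob_space_imp_sigma_finite)

lemma prob_space_data_law: "prob_space P_D"
  unfolding data_law_def using product_prob_data
  by (rule prob_space_PiM[OF product_prob_space.prob_space])

lemma AE_data_law:
  assumes "AE x in \<nu>. Q x"
  shows "AE D in P_D. \<forall>i\<in>{1..n}. Q (fst (D i))"
proof (rule AE_finite_allI)
  fix i assume i: "i \<in> {1..n}"
  interpret product_prob_space "\<lambda>_::nat. obs_law \<nu> (model_density f \<theta>s)" "{1..n}" by (rule product_prob_data)
  interpret cnt: sigma_finite_measure "count_space (UNIV :: bool set)"
    by (rule sigma_finite_measure_count_space_finite) simp
  from assms obtain N where N: "N \<in> null_sets \<nu>" "{x \<in> space \<nu>. \<not> Q x} \<subseteq> N" by (auto simp: eventually_ae_filter)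
  have "N \<times> UNIV \<in> null_sets (\<nu> \<Otimes>\<^sub>M nu_y)"
    using N(1) by (auto simp: null_sets_def cnt.emeasure_pair_measure_Times)
  then have "AE z in \<nu> \<Otimes>\<^sub>M nu_y. Q (fst z)"
    by (rule AE_I') (use N(2) in \<open>auto simp: space_pair_measure\<close>)
  moreover have "(\<lambda>(x, y). ennreal (model_density f \<theta>s y x)) \<in> borel_measurable (\<nu> \<Otimes>\<^sub>M nu_y)"
    using cond_densityD(1)[OF cond_density_model[OF \<theta>s]]
    by (intro cond_density_measurable_pair) measurable
  ultimately have "AE z in obs_law \<nu> (model_density f \<theta>s). Q (fst z)"
    unfolding obs_law_def by (subst AE_density) auto
  then show "AE D in P_D. Q (fst (D i))"
    unfolding data_law_def using i by (intro AE_component)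
qed simp

lemma likelihood_measurable_prior [measurable]:
  "(\<lambda>z. likelihood f n (fst z) (snd z)) \<in> borel_measurable (P_D \<Otimes>\<^sub>M \<pi>)"
proof -
  have "sets (P_D \<Otimes>\<^sub>M \<pi>) = sets (Pi\<^sub>M {1..n} (\<lambda>_. \<nu> \<Otimes>\<^sub>M nu_y) \<Otimes>\<^sub>M param_space K)"
    by (rule sets_pair_measure_cong[OF sets_data_law prior_sets])
  then show ?thesis using likelihood_measurable measurable_cong_sets by blast
qed

lemma likelihood_measurable_param:
  "D \<in> space P_D \<Longrightarrow> (\<lambda>\<theta>. likelihood f n D \<theta>) \<in> borel_measurable \<pi>"
  using measurable_compose[OF measurable_Pair1' likelihood_measurable_prior] by simp

lemma likelihood_measurable_data:
  assumes "fst \<theta> \<subseteq> {1..K}"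
  shows "(\<lambda>D. likelihood f n D \<theta>) \<in> borel_measurable P_D"
proof -
  have [measurable]: "(\<lambda>D. model_density f \<theta> (snd (D i)) (fst (D i))) \<in> borel_measurable P_D"
    if "i \<in> {1..n}" for i
  proof -
    have "(\<lambda>D. D i) \<in> measurable P_D (obs_law \<nu> (model_density f \<theta>s))"
      unfolding data_law_def using that by (rule measurable_component_singleton)
    then have Di: "(\<lambda>D. D i) \<in> measurable P_D (\<nu> \<Otimes>\<^sub>M nu_y)"
      using measurable_cong_sets[OF refl sets_obs_law] by blast
    have "(\<lambda>(x, y). model_density f \<theta> y x) \<in> borel_measurable (\<nu> \<Otimes>\<^sub>M nu_y)"
      by (rule cond_density_measurable_pair[OF cond_densityD(1)[OF cond_density_model[OF assms]]])
    from measurable_compose[OF Di this] show ?thesis by (simp add: case_prod_beta)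
  qed
  show ?thesis unfolding likelihood_def by measurable
qed

lemma evidence_pos:
  assumes "D \<in> space P_D"
  shows "0 < evidence D"
proof -
  interpret prob_space \<pi> by (rule prior)
  have "\<not> (AE \<theta> in \<pi>. ennreal (likelihood f n D \<theta>) = 0)"
  proof
    assume "AE \<theta> in \<pi>. ennreal (likelihood f n D \<theta>) = 0"
    then have "AE \<theta> in \<pi>. False"
    proof eventually_elim
      case (elim \<theta>)
      then show False using likelihood_pos[of D \<theta>] by (simp add: ennreal_eq_0_iff)
    qed
    then show False by simp
  qed
  then have "evidence D \<noteq> 0"
    using likelihood_measurable_param[OF assms] by (subst nn_integral_0_iff_AE) auto
  then show ?thesis by (simp add: zero_less_iff_neq_zero)
qed

lemma evidence_le_1: "evidence D \<le> 1"
proof -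
  interpret prob_space \<pi> by (rule prior)
  have "evidence D \<le> (\<integral>\<^sup>+\<theta>. 1 \<partial>\<pi>)"
    using likelihood_le_1 by (intro nn_integral_mono) (simp add: ennreal_le_1)
  then show ?thesis by (simp add: emeasure_space_1)
qed

lemma sets_posterior: "sets (post D) = sets (param_space K)"
  unfolding posterior_def by (simp add: prior_sets)

lemma emeasure_posterior:
  assumes D: "D \<in> space P_D" and T: "T \<in> sets (param_space K)"
  shows "emeasure (post D) T
    = evidence_on T D / evidence D"
proof -
  note [measurable] = likelihood_measurable_param[OF D]
  have T' [measurable]: "T \<in> sets \<pi>" using T prior_sets by simp
  have "emeasure (post D) T
      = (\<integral>\<^sup>+\<theta>. ennreal (likelihood f n D \<theta>) / evidence D * indicator T \<theta> \<partial>\<pi>)"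
    unfolding posterior_def by (rule emeasure_density[OF _ T']) measurable
  also have "\<dots> = (\<integral>\<^sup>+\<theta>. (ennreal (likelihood f n D \<theta>) * indicator T \<theta>) / evidence D \<partial>\<pi>)"
    by (intro nn_integral_cong) (simp add: ennreal_times_divide ennreal_divide_times mult.commute)
  also have "\<dots> = evidence_on T D / evidence D"
    using T' by (intro nn_integral_divide) measurable
  finally show ?thesis .
qed

lemma posterior_measurable:
  assumes X: "X \<in> sets (param_space K)"
  shows "(\<lambda>D. emeasure (post D) X) \<in> borel_measurable P_D"
proof -
  interpret pi: prob_space \<pi> by (rule prior)
  have [measurable]: "X \<in> sets \<pi>" using X prior_sets by simp
  have "(\<lambda>D. evidence_on X D / evidence D) \<in> borel_measurable P_D"
    by (intro borel_measurable_divide_ennreal pi.borel_measurable_nn_integral) (unfold case_prod_beta, measurable)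
  also have "?this \<longleftrightarrow> ?thesis"
    by (rule measurable_cong) (simp add: emeasure_posterior[OF _ X])
  finally show ?thesis .
qed

lemma prob_space_posterior:
  assumes D: "D \<in> space P_D"
  shows "prob_space (post D)"
proof
  have "emeasure (post D) (space (post D))
      = emeasure (post D) (space (param_space K))"
    by (simp add: sets_eq_imp_space_eq[OF sets_posterior])
  also have "\<dots> = evidence_on (space (param_space K)) D / evidence D"
    by (rule emeasure_posterior[OF D]) simp
  also have "evidence_on (space (param_space K)) D = evidence D"
    by (intro nn_integral_cong) (simp add: sets_eq_imp_space_eq[OF prior_sets])
  also have "evidence D / evidence D = 1"
    using evidence_pos[OF D] evidence_le_1[of D]
    by (intro ennreal_divide_self) (auto simp: le_less_trans[OF _ ennreal_one_less_top])
  finally show "emeasure (post D) (space (post D)) = 1" .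
qed

lemma posterior_le:
  assumes D: "D \<in> space P_D" and T: "T \<in> sets (param_space K)" and l: "l \<le> evidence D"
    and le: "evidence_on T D \<le> z * l"
  shows "emeasure (post D) T \<le> z"
  unfolding emeasure_posterior[OF D T]
proof (rule divide_le_posI_ennreal[OF evidence_pos[OF D]])
  have "z * l \<le> z * evidence D" using l by (intro mult_left_mono) auto
  with le show "evidence_on T D \<le> evidence D * z"
    by (simp add: mult.commute)
qed

lemma likelihood_ratio_prod:
  "likelihood f n D \<theta> / likelihood f n D \<theta>s
    = (\<Prod>i\<in>{1..n}. model_density f \<theta> (snd (D i)) (fst (D i)) / model_density f \<theta>s (snd (D i)) (fst (D i)))"
  unfolding likelihood_def by (simp add: prod_dividef)

lemma expectation_prod:
  assumes g: "\<And>y. g y \<in> borel_measurable \<nu>"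
  shows "(\<integral>\<^sup>+D. (\<Prod>i\<in>{1..n}. ennreal (g (snd (D i)) (fst (D i)))) \<partial>P_D)
    = (\<integral>\<^sup>+z. ennreal (g (snd z) (fst z)) \<partial>obs_law \<nu> (model_density f \<theta>s)) ^ n"
proof -
  interpret product_prob_space "\<lambda>_::nat. obs_law \<nu> (model_density f \<theta>s)" "{1..n}" by (rule product_prob_data)
  have "(\<lambda>z. ennreal (g (snd z) (fst z))) \<in> borel_measurable (\<nu> \<Otimes>\<^sub>M nu_y)"
    using cond_density_measurable_pair[of g \<nu>, OF g] by (simp add: case_prod_beta)
  then have "(\<lambda>z. ennreal (g (snd z) (fst z))) \<in> borel_measurable (obs_law \<nu> (model_density f \<theta>s))"
    using measurable_cong_sets[OF sets_obs_law refl] by blast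
  then show ?thesis
    unfolding data_law_def by (subst product_nn_integral_prod) auto
qed

lemma model_ratio_measurable:
  "fst \<theta> \<subseteq> {1..K} \<Longrightarrow> (\<lambda>x. model_density f \<theta> y x / model_density f \<theta>s y x) \<in> borel_measurable \<nu>"
  using cond_densityD(1)[OF cond_density_model] \<theta>s by (intro borel_measurable_divide) auto

lemma expectation_likelihood_ratio:
  assumes \<theta>: "fst \<theta> \<subseteq> {1..K}"
  shows "(\<integral>\<^sup>+D. ennreal (likelihood f n D \<theta> / likelihood f n D \<theta>s) \<partial>P_D) = 1"
proof -
  have "0 \<le> model_density f \<theta> y x / model_density f \<theta>s y x" for y x
    unfolding model_density_def by (intro divide_nonneg_nonneg) (simp_all add: f_pos less_imp_le)
  then have "(\<integral>\<^sup>+D. ennreal (likelihood f n D \<theta> / likelihood f n D \<theta>s) \<partial>P_D)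
      = (\<integral>\<^sup>+D. (\<Prod>i\<in>{1..n}. ennreal (model_density f \<theta> (snd (D i)) (fst (D i)) / model_density f \<theta>s (snd (D i)) (fst (D i)))) \<partial>P_D)"
    unfolding likelihood_ratio_prod by (simp add: prod_ennreal)
  also have "\<dots> = 1"
    unfolding expectation_prod[of "\<lambda>y x. model_density f \<theta> y x / model_density f \<theta>s y x", OF model_ratio_measurable[OF \<theta>]]
      nn_integral_likelihood_ratio[OF nu cond_density_model[OF \<theta>s] cond_density_model[OF \<theta>]]
    by simp
  finally show ?thesis .
qed

lemma expectation_sqrt_likelihood_ratio:
  assumes \<theta>: "fst \<theta> \<subseteq> {1..K}" and t: "0 \<le> t" "t \<le> tv_dist \<nu> (model_density f \<theta>) (model_density f \<theta>s)"
  shows "(\<integral>\<^sup>+D. ennreal (sqrt (likelihood f n D \<theta> / likelihood f n D \<theta>s)) \<partial>P_D) \<le> ennreal (exp (- (real n * t\<^sup>2 / 2)))"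
proof -
  let ?q = "model_density f \<theta>" and ?p = "model_density f \<theta>s"
  have nn: "0 \<le> sqrt (?q y x / ?p y x)" for y x
    unfolding model_density_def by (intro real_sqrt_ge_zero divide_nonneg_nonneg) (simp_all add: f_pos less_imp_le)
  have sq: "sqrt (likelihood f n D \<theta> / likelihood f n D \<theta>s)
      = (\<Prod>i\<in>{1..n}. sqrt (?q (snd (D i)) (fst (D i)) / ?p (snd (D i)) (fst (D i))))" for D
    unfolding likelihood_ratio_prod by (rule sqrt_prod)
  have "t\<^sup>2 \<le> (tv_dist \<nu> ?q ?p)\<^sup>2" using t by (intro power_mono) auto
  then have le: "1 - (tv_dist \<nu> ?q ?p)\<^sup>2 / 2 \<le> exp (- (t\<^sup>2 / 2))"
    using exp_ge_add_one_self[of "- (t\<^sup>2 / 2)"] by simp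
  have "(\<integral>\<^sup>+D. ennreal (sqrt (likelihood f n D \<theta> / likelihood f n D \<theta>s)) \<partial>P_D)
      = (\<integral>\<^sup>+D. (\<Prod>i\<in>{1..n}. ennreal (sqrt (?q (snd (D i)) (fst (D i)) / ?p (snd (D i)) (fst (D i))))) \<partial>P_D)"
    unfolding sq using nn by (simp add: prod_ennreal)
  also have "\<dots> = (\<integral>\<^sup>+z. ennreal (sqrt (?q (snd z) (fst z) / ?p (snd z) (fst z))) \<partial>obs_law \<nu> ?p) ^ n"
  proof (rule expectation_prod[of "\<lambda>y x. sqrt (?q y x / ?p y x)"])
    fix y
    have "?q y \<in> borel_measurable \<nu>" "?p y \<in> borel_measurable \<nu>"
      using cond_densityD(1)[OF cond_density_model] \<theta> \<theta>s by auto
    then show "(\<lambda>x. sqrt (?q y x / ?p y x)) \<in> borel_measurable \<nu>" by measurable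
  qed
  also have "\<dots> \<le> ennreal (exp (- (t\<^sup>2 / 2))) ^ n"
    by (intro power_mono_ennreal order_trans[OF nn_integral_sqrt_likelihood_ratio[OF nu cond_density_model[OF \<theta>s] cond_density_model[OF \<theta>]]] ennreal_leI le)
  also have "\<dots> = ennreal (exp (- (real n * t\<^sup>2 / 2)))"
    by (simp add: ennreal_power exp_of_nat_mult[symmetric])
  finally show ?thesis .
qed

text \<open>Under the true law the likelihood ratio of a fixed parameter has expectation one, so that the
  expected posterior mass of a set exceeds its prior mass at most by the loss \<open>1 / E\<^sub>0\<close> in the
  evidence.\<close>

lemma expected_posterior_le_prior:
  assumes T: "T \<in> sets (param_space K)" and E0: "0 < E0"
    and ev: "AE D in P_D. ennreal (E0 * likelihood f n D \<theta>s) \<le> evidence D"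
  shows "(\<integral>\<^sup>+D. emeasure (post D) T \<partial>P_D) \<le> ennreal (1 / E0) * emeasure \<pi> T"
proof -
  interpret D: prob_space P_D by (rule prob_space_data_law)
  interpret pi: prob_space \<pi> by (rule prior)
  interpret pair_sigma_finite P_D \<pi> ..
  have T' [measurable]: "T \<in> sets \<pi>" using T prior_sets by simp
  have [measurable]: "(\<lambda>D. likelihood f n D \<theta>s) \<in> borel_measurable P_D"
    by (rule likelihood_measurable_data[OF \<theta>s])
  let ?g = "\<lambda>D \<theta>. ennreal (likelihood f n D \<theta> / likelihood f n D \<theta>s) * indicator T \<theta>"
  have m: "case_prod ?g \<in> borel_measurable (P_D \<Otimes>\<^sub>M \<pi>)"
    unfolding case_prod_beta using T' by measurable
  have "(\<integral>\<^sup>+D. emeasure (post D) T \<partial>P_D) \<le> (\<integral>\<^sup>+D. ennreal (1 / E0) * (\<integral>\<^sup>+\<theta>. ?g D \<theta> \<partial>\<pi>) \<partial>P_D)"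
  proof (rule nn_integral_mono_AE)
    show "AE D in P_D. emeasure (post D) T \<le> ennreal (1 / E0) * (\<integral>\<^sup>+\<theta>. ?g D \<theta> \<partial>\<pi>)"
      using ev
    proof (rule AE_mp, intro AE_I2 impI)
      fix D assume D: "D \<in> space P_D" and e: "ennreal (E0 * likelihood f n D \<theta>s) \<le> evidence D"
      note [measurable] = likelihood_measurable_param[OF D]
      let ?l = "likelihood f n D \<theta>s"
      have lp: "0 < ?l" by (rule likelihood_pos)
      show "emeasure (post D) T \<le> ennreal (1 / E0) * (\<integral>\<^sup>+\<theta>. ?g D \<theta> \<partial>\<pi>)"
      proof (rule posterior_le[OF D T e])
        have "evidence_on T D = (\<integral>\<^sup>+\<theta>. ennreal ?l * ?g D \<theta> \<partial>\<pi>)"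
        proof (intro nn_integral_cong)
          fix \<theta>
          have "ennreal (likelihood f n D \<theta>) = ennreal ?l * ennreal (likelihood f n D \<theta> / ?l)"
            using lp likelihood_pos[of D \<theta>] by (subst ennreal_mult[symmetric]) auto
          then show "ennreal (likelihood f n D \<theta>) * indicator T \<theta> = ennreal ?l * ?g D \<theta>" by (simp add: mult.assoc)
        qed
        also have "\<dots> = ennreal ?l * (\<integral>\<^sup>+\<theta>. ?g D \<theta> \<partial>\<pi>)"
          using T' by (intro nn_integral_cmult) measurable
        also have "ennreal ?l = ennreal (1 / E0) * ennreal (E0 * ?l)"
          using E0 lp by (subst ennreal_mult[symmetric]) auto
        finally show "evidence_on T D
            \<le> ennreal (1 / E0) * (\<integral>\<^sup>+\<theta>. ?g D \<theta> \<partial>\<pi>) * ennreal (E0 * ?l)"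
          by (simp add: mult_ac)
      qed
    qed
  qed
  also have "\<dots> = ennreal (1 / E0) * (\<integral>\<^sup>+D. \<integral>\<^sup>+\<theta>. ?g D \<theta> \<partial>\<pi> \<partial>P_D)"
    by (rule nn_integral_cmult[OF pi.borel_measurable_nn_integral[OF m]])
  also have "(\<integral>\<^sup>+D. \<integral>\<^sup>+\<theta>. ?g D \<theta> \<partial>\<pi> \<partial>P_D) = (\<integral>\<^sup>+\<theta>. \<integral>\<^sup>+D. ?g D \<theta> \<partial>P_D \<partial>\<pi>)"
    by (rule Fubini'[OF m, symmetric])
  also have "\<dots> = (\<integral>\<^sup>+\<theta>. indicator T \<theta> \<partial>\<pi>)"
  proof (intro nn_integral_cong)
    fix \<theta> assume "\<theta> \<in> space \<pi>"
    then have \<theta>: "fst \<theta> \<subseteq> {1..K}" using fst_param_subset sets_eq_imp_space_eq[OF prior_sets] by auto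
    have [measurable]: "(\<lambda>D. likelihood f n D \<theta>) \<in> borel_measurable P_D" by (rule likelihood_measurable_data[OF \<theta>])
    have "(\<integral>\<^sup>+D. ?g D \<theta> \<partial>P_D) = (\<integral>\<^sup>+D. ennreal (likelihood f n D \<theta> / likelihood f n D \<theta>s) \<partial>P_D) * indicator T \<theta>"
      by (rule nn_integral_multc) measurable
    then show "(\<integral>\<^sup>+D. ?g D \<theta> \<partial>P_D) = indicator T \<theta>" unfolding expectation_likelihood_ratio[OF \<theta>] by simp
  qed
  also have "\<dots> = emeasure \<pi> T" using T' by simp
  finally show ?thesis .
qed

text \<open>A posterior probability \<open>X\<close> is at most \<open>min 1 X \<le> \<surd>X\<close>, and the square root of a likelihood ratio
  has an expectation that is exponentially small in \<open>n\<close> for parameters far from the truth.  The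
  maximum over a finite net is bounded by the sum only after the square root has been taken; this
  does the work of a test.\<close>

lemma expected_posterior_le_net:
  assumes S: "S \<in> sets (param_space K)" and E0: "0 < E0" and G: "0 < G" and t: "0 \<le> t"
    and ev: "AE D in P_D. ennreal (E0 * likelihood f n D \<theta>s) \<le> evidence D"
    and fin: "finite \<Theta>" and \<Theta>: "\<And>\<theta>. \<theta> \<in> \<Theta> \<Longrightarrow> fst \<theta> \<subseteq> {1..K}"
    and far: "\<And>\<theta>. \<theta> \<in> \<Theta> \<Longrightarrow> t \<le> tv_dist \<nu> (model_density f \<theta>) (model_density f \<theta>s)"
    and net: "AE D in P_D. \<forall>\<theta>\<in>S. \<exists>\<theta>'\<in>\<Theta>. likelihood f n D \<theta> \<le> G * likelihood f n D \<theta>'"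
  shows "(\<integral>\<^sup>+D. emeasure (post D) S \<partial>P_D)
    \<le> ennreal (real (card \<Theta>) * (sqrt (G / E0) * exp (- (real n * t\<^sup>2 / 2))))"
proof -
  interpret prob_space \<pi> by (rule prior)
  let ?g = "\<lambda>\<theta> D. sqrt (G / E0) * sqrt (likelihood f n D \<theta> / likelihood f n D \<theta>s)"
  have g0: "0 \<le> ?g \<theta> D" for \<theta> D
    using G E0 likelihood_pos[of D \<theta>] likelihood_pos[of D \<theta>s] by simp
  have "AE D in P_D. emeasure (post D) S \<le> (\<Sum>\<theta>\<in>\<Theta>. ennreal (?g \<theta> D))"
    using ev net AE_space
  proof eventually_elim
    case (elim D)
    then have D: "D \<in> space P_D" and e: "ennreal (E0 * likelihood f n D \<theta>s) \<le> evidence D"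
      and nt: "\<forall>\<theta>\<in>S. \<exists>\<theta>'\<in>\<Theta>. likelihood f n D \<theta> \<le> G * likelihood f n D \<theta>'" by auto
    show "emeasure (post D) S \<le> (\<Sum>\<theta>\<in>\<Theta>. ennreal (?g \<theta> D))"
    proof (cases "\<Theta> = {}")
      case True
      then have "S = {}" using nt by auto
      then show ?thesis by simp
    next
      case False
      have "Max (likelihood f n D ` \<Theta>) \<in> likelihood f n D ` \<Theta>" using fin False by (intro Max_in) auto
      then obtain m where m: "m \<in> \<Theta>" "Max (likelihood f n D ` \<Theta>) = likelihood f n D m" by auto
      have le: "likelihood f n D \<theta> \<le> G * likelihood f n D m" if "\<theta> \<in> S" for \<theta>
      proof -
        from nt that obtain \<theta>' where \<theta>': "\<theta>' \<in> \<Theta>" "likelihood f n D \<theta> \<le> G * likelihood f n D \<theta>'" by blast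
        have "likelihood f n D \<theta>' \<le> likelihood f n D m" unfolding m(2)[symmetric] using fin \<theta>'(1) by simp
        then have "G * likelihood f n D \<theta>' \<le> G * likelihood f n D m" using G by simp
        with \<theta>'(2) show ?thesis by simp
      qed
      define X where "X = G / E0 * (likelihood f n D m / likelihood f n D \<theta>s)"
      have lp: "0 < likelihood f n D \<theta>" for \<theta> by (rule likelihood_pos)
      have X0: "0 < X" unfolding X_def using G E0 lp by simp
      have "evidence_on S D \<le> (\<integral>\<^sup>+\<theta>. ennreal (G * likelihood f n D m) \<partial>\<pi>)"
        using le by (intro nn_integral_mono) (auto simp: indicator_def intro!: ennreal_leI)
      also have "\<dots> = ennreal (G * likelihood f n D m)" by (simp add: emeasure_space_1)
      also have "\<dots> = ennreal X * ennreal (E0 * likelihood f n D \<theta>s)"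
        using X0 E0 lp[of \<theta>s] by (subst ennreal_mult[symmetric]) (auto simp: X_def)
      finally have 1: "emeasure (post D) S \<le> ennreal X" by (intro posterior_le[OF D S e])
      have 2: "emeasure (post D) S \<le> ennreal 1"
        using prob_space.emeasure_le_1[OF prob_space_posterior[OF D]] by simp
      have "min 1 X \<le> sqrt X"
      proof (cases "1 \<le> X")
        case True
        then show ?thesis by simp
      next
        case False
        then have "X * X \<le> X * 1" using X0 by (intro mult_left_mono) auto
        then have "X \<le> sqrt X" using X0 by (intro real_le_rsqrt) (simp add: power2_eq_square)
        then show ?thesis by simp
      qed
      moreover have "emeasure (post D) S \<le> ennreal (min 1 X)"
        using 1 2 by (simp add: min_def)
      ultimately have "emeasure (post D) S \<le> ennreal (sqrt X)"
        using ennreal_leI order_trans by blast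
      also have "sqrt X = ?g m D" unfolding X_def real_sqrt_mult[symmetric] ..
      also have "ennreal (?g m D) \<le> (\<Sum>\<theta>\<in>\<Theta>. ennreal (?g \<theta> D))"
        by (rule member_le_sum[OF m(1) _ fin]) simp
      finally show ?thesis .
    qed
  qed
  then have "(\<integral>\<^sup>+D. emeasure (post D) S \<partial>P_D) \<le> (\<integral>\<^sup>+D. (\<Sum>\<theta>\<in>\<Theta>. ennreal (?g \<theta> D)) \<partial>P_D)"
    by (rule nn_integral_mono_AE)
  also have "\<dots> = (\<Sum>\<theta>\<in>\<Theta>. \<integral>\<^sup>+D. ennreal (?g \<theta> D) \<partial>P_D)"
  proof (rule nn_integral_sum)
    fix \<theta> assume "\<theta> \<in> \<Theta>"
    from likelihood_measurable_data[OF \<Theta>[OF this]] likelihood_measurable_data[OF \<theta>s]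
    show "(\<lambda>D. ennreal (?g \<theta> D)) \<in> borel_measurable P_D" by measurable
  qed
  also have "\<dots> \<le> (\<Sum>\<theta>\<in>\<Theta>. ennreal (sqrt (G / E0) * exp (- (real n * t\<^sup>2 / 2))))"
  proof (rule sum_mono)
    fix \<theta> assume \<theta>: "\<theta> \<in> \<Theta>"
    have [measurable]: "(\<lambda>D. likelihood f n D \<theta>) \<in> borel_measurable P_D" "(\<lambda>D. likelihood f n D \<theta>s) \<in> borel_measurable P_D"
      using likelihood_measurable_data[OF \<Theta>[OF \<theta>]] likelihood_measurable_data[OF \<theta>s] by auto
    have "(\<integral>\<^sup>+D. ennreal (?g \<theta> D) \<partial>P_D)
        = (\<integral>\<^sup>+D. ennreal (sqrt (G / E0)) * ennreal (sqrt (likelihood f n D \<theta> / likelihood f n D \<theta>s)) \<partial>P_D)"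
      using G E0 likelihood_pos by (intro nn_integral_cong ennreal_mult real_sqrt_ge_zero divide_nonneg_nonneg) (auto intro: less_imp_le[OF likelihood_pos])
    also have "\<dots> = ennreal (sqrt (G / E0)) * (\<integral>\<^sup>+D. ennreal (sqrt (likelihood f n D \<theta> / likelihood f n D \<theta>s)) \<partial>P_D)"
      by (rule nn_integral_cmult) measurable
    also have "\<dots> \<le> ennreal (sqrt (G / E0)) * ennreal (exp (- (real n * t\<^sup>2 / 2)))"
      by (intro mult_left_mono expectation_sqrt_likelihood_ratio \<Theta> \<theta> t far) auto
    also have "\<dots> = ennreal (sqrt (G / E0) * exp (- (real n * t\<^sup>2 / 2)))"
      using G E0 by (subst ennreal_mult) auto
    finally show "(\<integral>\<^sup>+D. ennreal (?g \<theta> D) \<partial>P_D) \<le> ennreal (sqrt (G / E0) * exp (- (real n * t\<^sup>2 / 2)))" .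
  qed
  also have "\<dots> = ennreal (real (card \<Theta>) * (sqrt (G / E0) * exp (- (real n * t\<^sup>2 / 2))))"
    using G E0 by (subst sum_ennreal) auto
  finally show ?thesis .
qed

end

end

end

section \<open>Nets of parameters and stability of the likelihood\<close>

lemma card_small_subsets:
  fixes K m :: nat
  shows "card {\<gamma>. \<gamma> \<subseteq> {1..K} \<and> card \<gamma> \<le> m} \<le> (K + 1) ^ m"
proof -
  let ?G = "{\<gamma>. \<gamma> \<subseteq> {1..K} \<and> card \<gamma> \<le> m}"
  let ?F = "{..<m} \<rightarrow>\<^sub>E {0..K}"
  have "?G \<subseteq> (\<lambda>g. g ` {..<m} \<inter> {1..K}) ` ?F"
  proof
    fix \<gamma> assume \<gamma>: "\<gamma> \<in> ?G"
    then have "finite \<gamma>" by (auto intro: finite_subset)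
    then obtain h where h: "bij_betw h {0..<card \<gamma>} \<gamma>" using ex_bij_betw_nat_finite by blast
    define g where "g = (\<lambda>i\<in>{..<m}. if i < card \<gamma> then h i else 0)"
    have hi: "h i \<in> \<gamma>" if "i < card \<gamma>" for i using bij_betwE[OF h] that by auto
    have "g \<in> ?F"
    proof (rule PiE_I)
      fix i assume i: "i \<in> {..<m}"
      have "h i \<in> {0..K}" if "i < card \<gamma>" using hi[OF that] \<gamma> by auto
      then show "g i \<in> {0..K}" unfolding g_def using i by simp
    qed (simp add: g_def)
    moreover have "g ` {..<m} \<inter> {1..K} = \<gamma>"
    proof
      show "g ` {..<m} \<inter> {1..K} \<subseteq> \<gamma>" unfolding g_def using hi by (auto split: if_splits)
      show "\<gamma> \<subseteq> g ` {..<m} \<inter> {1..K}"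
      proof
        fix j assume j: "j \<in> \<gamma>"
        then have "j \<in> h ` {0..<card \<gamma>}" using h unfolding bij_betw_def by blast
        then obtain i where i: "i < card \<gamma>" "h i = j" by auto
        then have "g i = j" "i < m" unfolding g_def using \<gamma> by auto
        then show "j \<in> g ` {..<m} \<inter> {1..K}" using j \<gamma> by blast
      qed
    qed
    ultimately show "\<gamma> \<in> (\<lambda>g. g ` {..<m} \<inter> {1..K}) ` ?F" by blast
  qed
  moreover have finF: "finite ?F" by (intro finite_PiE) auto
  ultimately have "card ?G \<le> card ?F" by (intro surj_card_le[OF finF])
  also have "card ?F = (K + 1) ^ m" by (simp add: card_PiE)
  finally show ?thesis .
qed

text \<open>One point of \<open>S\<close> is chosen from each cell of a cubic grid that \<open>S\<close> meets.  The net must consist of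
  points of \<open>S\<close> itself, so that they inherit the distance from the true density.\<close>

lemma param_net:
  assumes S: "\<And>\<theta>. \<theta> \<in> S \<Longrightarrow> fst \<theta> \<subseteq> {1..K} \<and> card (fst \<theta>) \<le> m \<and> (\<forall>j\<in>fst \<theta>. \<bar>snd \<theta> j\<bar> \<le> C)"
    and w: "0 < w" and C: "0 \<le> C"
  shows "\<exists>\<Theta> \<subseteq> S. finite \<Theta> \<and> real (card \<Theta>) \<le> (real (K + 1) * (2 * C / w + 2)) ^ m \<and>
    (\<forall>\<theta>\<in>S. \<exists>\<theta>'\<in>\<Theta>. fst \<theta>' = fst \<theta> \<and> (\<forall>j\<in>fst \<theta>. \<bar>snd \<theta> j - snd \<theta>' j\<bar> \<le> w))"
proof -
  let ?G = "{\<gamma>. \<gamma> \<subseteq> {1..K} \<and> card \<gamma> \<le> m}"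
  let ?Z = "{\<lfloor>- C / w\<rfloor>..\<lfloor>C / w\<rfloor>}"
  define cell where "cell \<theta> = (fst \<theta>, \<lambda>j\<in>fst \<theta>. \<lfloor>snd \<theta> j / w\<rfloor>)" for \<theta> :: param
  let ?F = "SIGMA \<gamma>:?G. \<gamma> \<rightarrow>\<^sub>E ?Z"
  have finG: "finite ?G" by (rule finite_subset[of _ "Pow {1..K}"]) auto
  have fin\<gamma>: "finite \<gamma>" if "\<gamma> \<in> ?G" for \<gamma> using that by (auto intro: finite_subset)
  have finF: "finite ?F" by (intro finite_SigmaI finG finite_PiE fin\<gamma>) auto
  have "cell ` S \<subseteq> ?F"
  proof
    fix z assume "z \<in> cell ` S"
    then obtain \<theta> where \<theta>: "\<theta> \<in> S" "z = cell \<theta>" by auto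
    have "\<lfloor>snd \<theta> j / w\<rfloor> \<in> ?Z" if "j \<in> fst \<theta>" for j
    proof -
      have "\<bar>snd \<theta> j\<bar> \<le> C" using S[OF \<theta>(1)] that by blast
      then have "- C / w \<le> snd \<theta> j / w" "snd \<theta> j / w \<le> C / w"
        using w by (auto intro!: divide_right_mono simp: abs_le_iff minus_divide_left simp del: divide_minus_left)
      then show ?thesis by (auto intro: floor_mono)
    qed
    then show "z \<in> ?F" unfolding \<theta>(2) cell_def using S[OF \<theta>(1)] by auto
  qed
  then have card_cells: "card (cell ` S) \<le> card ?F" and fin_cells: "finite (cell ` S)"
    using finF by (auto intro: card_mono finite_subset)
  have z1: "1 \<le> card ?Z"
  proof -
    have "- C / w \<le> C / w" using C w by (simp add: divide_right_mono)
    then have "\<lfloor>- C / w\<rfloor> \<le> \<lfloor>C / w\<rfloor>" by (rule floor_mono)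
    then show ?thesis by simp
  qed
  have z2: "real (card ?Z) \<le> 2 * C / w + 2"
  proof -
    have "0 \<le> C / w" using C w by simp
    moreover have "real_of_int \<lfloor>C / w\<rfloor> \<le> C / w" "- C / w - 1 \<le> real_of_int \<lfloor>- C / w\<rfloor>"
      by linarith+
    ultimately show ?thesis by simp linarith
  qed
  have "card ?F = (\<Sum>\<gamma>\<in>?G. card (\<gamma> \<rightarrow>\<^sub>E ?Z))"
    by (rule card_SigmaI[OF finG]) (use fin\<gamma> in \<open>auto intro!: finite_PiE\<close>)
  also have "\<dots> = (\<Sum>\<gamma>\<in>?G. card ?Z ^ card \<gamma>)"
    using fin\<gamma> by (intro sum.cong refl) (simp add: card_PiE)
  also have "\<dots> \<le> (\<Sum>\<gamma>\<in>?G. card ?Z ^ m)"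
    using z1 by (intro sum_mono power_increasing) auto
  also have "\<dots> \<le> (K + 1) ^ m * card ?Z ^ m"
    using card_small_subsets[of K m] by simp
  finally have "real (card ?F) \<le> real (K + 1) ^ m * real (card ?Z) ^ m"
    unfolding of_nat_power[symmetric] of_nat_mult[symmetric] of_nat_le_iff .
  also have "\<dots> \<le> (real (K + 1) * (2 * C / w + 2)) ^ m"
    unfolding power_mult_distrib by (intro mult_left_mono power_mono z2) auto
  finally have cF: "real (card ?F) \<le> (real (K + 1) * (2 * C / w + 2)) ^ m" .
  obtain \<Theta> where \<Theta>: "\<Theta> \<subseteq> S" "inj_on cell \<Theta>" "cell ` S = cell ` \<Theta>"
    using subset_image_inj[of "cell ` S" cell S] by auto
  show ?thesis
  proof (intro exI[of _ \<Theta>] conjI ballI \<Theta>(1))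
    show "finite \<Theta>" by (rule finite_imageD[OF _ \<Theta>(2)]) (use fin_cells \<Theta>(3) in simp)
    have "card \<Theta> = card (cell ` S)" using \<Theta>(2,3) by (simp add: card_image)
    then show "real (card \<Theta>) \<le> (real (K + 1) * (2 * C / w + 2)) ^ m" using card_cells cF by linarith
    fix \<theta> assume "\<theta> \<in> S"
    then obtain \<theta>' where \<theta>': "\<theta>' \<in> \<Theta>" "cell \<theta> = cell \<theta>'" using \<Theta>(3) by blast
    have f: "fst \<theta>' = fst \<theta>" using \<theta>'(2) unfolding cell_def by simp
    have "\<bar>snd \<theta> j - snd \<theta>' j\<bar> \<le> w" if j: "j \<in> fst \<theta>" for j
    proof -
      have "\<lfloor>snd \<theta> j / w\<rfloor> = \<lfloor>snd \<theta>' j / w\<rfloor>"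
      proof -
        have "snd (cell \<theta>) j = snd (cell \<theta>') j" using \<theta>'(2) by simp
        then show ?thesis using f j unfolding cell_def by simp
      qed
      then have "\<bar>snd \<theta> j / w - snd \<theta>' j / w\<bar> \<le> 1" by linarith
      then have "\<bar>snd \<theta> j - snd \<theta>' j\<bar> / w \<le> 1"
        using w by (simp add: diff_divide_distrib[symmetric] abs_divide)
      then show ?thesis using w by (simp add: divide_le_eq_1)
    qed
    with \<theta>'(1) f show "\<exists>\<theta>'\<in>\<Theta>. fst \<theta>' = fst \<theta> \<and> (\<forall>j\<in>fst \<theta>. \<bar>snd \<theta> j - snd \<theta>' j\<bar> \<le> w)" by blast
  qed
qed

lemma abs_sum_bounded:
  fixes x b :: "nat \<Rightarrow> real"
  assumes "\<And>j. j \<in> \<gamma> \<Longrightarrow> \<bar>x j\<bar> \<le> 1"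
  shows "\<bar>\<Sum>j\<in>\<gamma>. x j * b j\<bar> \<le> (\<Sum>j\<in>\<gamma>. \<bar>b j\<bar>)"
proof -
  have "\<bar>\<Sum>j\<in>\<gamma>. x j * b j\<bar> \<le> (\<Sum>j\<in>\<gamma>. \<bar>x j * b j\<bar>)" by (rule sum_abs)
  also have "\<dots> \<le> (\<Sum>j\<in>\<gamma>. \<bar>b j\<bar>)"
    using assms by (intro sum_mono) (simp add: abs_mult mult_left_le_one_le)
  finally show ?thesis .
qed

lemma sum_le_card:
  assumes "\<And>j. j \<in> \<gamma> \<Longrightarrow> g j \<le> (w::real)" "card \<gamma> \<le> m" "0 \<le> w"
  shows "(\<Sum>j\<in>\<gamma>. g j) \<le> real m * w"
proof -
  have "(\<Sum>j\<in>\<gamma>. g j) \<le> of_nat (card \<gamma>) * w" by (rule sum_bounded_above[OF assms(1)])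
  also have "\<dots> \<le> real m * w" using assms by (intro mult_right_mono) auto
  finally show ?thesis .
qed

definition bounded_data :: "nat \<Rightarrow> nat \<Rightarrow> dataset \<Rightarrow> bool" where
  "bounded_data K n D \<longleftrightarrow> (\<forall>i\<in>{1..n}. \<forall>j\<in>{1..K}. \<bar>fst (D i) j\<bar> \<le> 1)"

context
  fixes a b :: "real \<Rightarrow> real" and c :: "bool \<Rightarrow> real" and f :: "bool \<Rightarrow> real \<Rightarrow> real"
    and K n :: nat
  assumes glm: "is_glm a b c" and f_eq: "f = glm_pdf a b c"
begin

lemma likelihood_lipschitz:
  assumes "\<And>i. i \<in> {1..n} \<Longrightarrow> \<bar>\<Sum>j\<in>fst \<theta>. fst (D i) j * snd \<theta> j\<bar> \<le> R"
    and "\<And>i. i \<in> {1..n} \<Longrightarrow> \<bar>\<Sum>j\<in>fst \<theta>'. fst (D i) j * snd \<theta>' j\<bar> \<le> R"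
    and "\<And>i. i \<in> {1..n} \<Longrightarrow> \<bar>(\<Sum>j\<in>fst \<theta>. fst (D i) j * snd \<theta> j) - (\<Sum>j\<in>fst \<theta>'. fst (D i) j * snd \<theta>' j)\<bar> \<le> \<tau>"
    and R: "0 \<le> R"
  shows "likelihood f n D \<theta> \<le> exp (real n * (glm_lip a R * \<tau>)) * likelihood f n D \<theta>'"
proof -
  have "likelihood f n D \<theta> \<le> (\<Prod>i\<in>{1..n}. exp (glm_lip a R * \<tau>) * model_density f \<theta>' (snd (D i)) (fst (D i)))"
    unfolding likelihood_def
  proof (rule prod_mono, safe)
    fix i assume i: "i \<in> {1..n}"
    let ?h = "\<Sum>j\<in>fst \<theta>. fst (D i) j * snd \<theta> j" and ?h' = "\<Sum>j\<in>fst \<theta>'. fst (D i) j * snd \<theta>' j"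
    show "0 \<le> model_density f \<theta> (snd (D i)) (fst (D i))"
      unfolding model_density_def f_eq by (simp add: glm_pdf_pos[OF glm] less_imp_le)
    have "f (snd (D i)) ?h \<le> exp (glm_lip a R * \<bar>?h - ?h'\<bar>) * f (snd (D i)) ?h'"
      unfolding f_eq by (rule glm_pdf_lipschitz[OF glm assms(1,2)[OF i]])
    also have "\<dots> \<le> exp (glm_lip a R * \<tau>) * f (snd (D i)) ?h'"
      using assms(3)[OF i] glm_lip_pos[OF glm R] glm_pdf_pos[OF glm]
      by (intro mult_right_mono) (auto simp: f_eq less_imp_le)
    finally show "model_density f \<theta> (snd (D i)) (fst (D i))
        \<le> exp (glm_lip a R * \<tau>) * model_density f \<theta>' (snd (D i)) (fst (D i))"
      unfolding model_density_def .
  qed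
  also have "\<dots> = exp (real n * (glm_lip a R * \<tau>)) * likelihood f n D \<theta>'"
    unfolding likelihood_def by (simp add: prod.distrib exp_of_nat_mult)
  finally show ?thesis .
qed

lemma likelihood_close:
  assumes D: "bounded_data K n D" and \<gamma>: "fst \<theta> \<subseteq> {1..K}" "card (fst \<theta>) \<le> m" "fst \<theta>' = fst \<theta>"
    and C: "\<And>j. j \<in> fst \<theta> \<Longrightarrow> \<bar>snd \<theta> j\<bar> \<le> C" "\<And>j. j \<in> fst \<theta> \<Longrightarrow> \<bar>snd \<theta>' j\<bar> \<le> C"
    and w: "\<And>j. j \<in> fst \<theta> \<Longrightarrow> \<bar>snd \<theta> j - snd \<theta>' j\<bar> \<le> w" and nn: "0 \<le> w" "0 \<le> C"
  shows "likelihood f n D \<theta> \<le> exp (real n * (glm_lip a (real m * C) * (real m * w))) * likelihood f n D \<theta>'"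
proof (rule likelihood_lipschitz)
  fix i assume i: "i \<in> {1..n}"
  have x: "\<bar>fst (D i) j\<bar> \<le> 1" if "j \<in> fst \<theta>" for j using D i \<gamma> that unfolding bounded_data_def by auto
  show "\<bar>\<Sum>j\<in>fst \<theta>. fst (D i) j * snd \<theta> j\<bar> \<le> real m * C"
    using abs_sum_bounded[of "fst \<theta>" "fst (D i)" "snd \<theta>", OF x]
      sum_le_card[of "fst \<theta>" "\<lambda>j. \<bar>snd \<theta> j\<bar>" C m, OF C(1) \<gamma>(2) nn(2)] by simp
  show "\<bar>\<Sum>j\<in>fst \<theta>'. fst (D i) j * snd \<theta>' j\<bar> \<le> real m * C"
    unfolding \<gamma>(3) using abs_sum_bounded[of "fst \<theta>" "fst (D i)" "snd \<theta>'", OF x]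
      sum_le_card[of "fst \<theta>" "\<lambda>j. \<bar>snd \<theta>' j\<bar>" C m, OF C(2) \<gamma>(2) nn(2)] by simp
  have "(\<Sum>j\<in>fst \<theta>. fst (D i) j * snd \<theta> j) - (\<Sum>j\<in>fst \<theta>'. fst (D i) j * snd \<theta>' j)
      = (\<Sum>j\<in>fst \<theta>. fst (D i) j * (snd \<theta> j - snd \<theta>' j))"
    unfolding \<gamma>(3) by (simp add: sum_subtractf right_diff_distrib)
  then show "\<bar>(\<Sum>j\<in>fst \<theta>. fst (D i) j * snd \<theta> j) - (\<Sum>j\<in>fst \<theta>'. fst (D i) j * snd \<theta>' j)\<bar> \<le> real m * w"
    using abs_sum_bounded[of "fst \<theta>" "fst (D i)" "\<lambda>j. snd \<theta> j - snd \<theta>' j", OF x]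
      sum_le_card[of "fst \<theta>" "\<lambda>j. \<bar>snd \<theta> j - snd \<theta>' j\<bar>" w m, OF w \<gamma>(2) nn(1)] by simp
qed (use nn in simp)

text \<open>The coefficients omitted from the model contribute at most their absolute sum to the linear
  predictor because the covariates are bounded; the comparison of likelihoods therefore holds for each
  data set.  The radius \<open>M + 1\<close> leaves room for \<open>\<tau> \<le> 1\<close>.\<close>

lemma likelihood_near_truth:
  assumes D: "bounded_data K n D" and \<gamma>: "fst \<theta> \<subseteq> {1..K}" "card (fst \<theta>) \<le> m"
    and w: "\<And>j. j \<in> fst \<theta> \<Longrightarrow> \<bar>snd \<theta> j - \<beta> j\<bar> \<le> w" and w0: "0 \<le> w"
    and \<tau>: "real m * w + (\<Sum>j\<in>{1..K} - fst \<theta>. \<bar>\<beta> j\<bar>) \<le> \<tau>" "\<tau> \<le> 1"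
    and M: "(\<Sum>j\<in>{1..K}. \<bar>\<beta> j\<bar>) \<le> M"
  shows "likelihood f n D ({1..K}, \<beta>) \<le> exp (real n * (glm_lip a (M + 1) * \<tau>)) * likelihood f n D \<theta>"
proof -
  let ?h = "\<lambda>i. \<Sum>j\<in>fst \<theta>. fst (D i) j * snd \<theta> j" and ?hs = "\<lambda>i. \<Sum>j\<in>{1..K}. fst (D i) j * \<beta> j"
  have x: "\<bar>fst (D i) j\<bar> \<le> 1" if "i \<in> {1..n}" "j \<in> {1..K}" for i j using D that unfolding bounded_data_def by auto
  have hs: "\<bar>?hs i\<bar> \<le> M" if i: "i \<in> {1..n}" for i
    using abs_sum_bounded[of "{1..K}" "fst (D i)" \<beta>, OF x[OF i]] M by linarith
  have d: "\<bar>?hs i - ?h i\<bar> \<le> \<tau>" if i: "i \<in> {1..n}" for i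
  proof -
    have "?hs i = (\<Sum>j\<in>{1..K} - fst \<theta>. fst (D i) j * \<beta> j) + (\<Sum>j\<in>fst \<theta>. fst (D i) j * \<beta> j)"
      by (rule sum.subset_diff[OF \<gamma>(1)]) simp
    moreover have "(\<Sum>j\<in>fst \<theta>. fst (D i) j * (snd \<theta> j - \<beta> j)) = ?h i - (\<Sum>j\<in>fst \<theta>. fst (D i) j * \<beta> j)"
      by (simp add: sum_subtractf right_diff_distrib)
    ultimately have e: "?hs i - ?h i = (\<Sum>j\<in>{1..K} - fst \<theta>. fst (D i) j * \<beta> j) - (\<Sum>j\<in>fst \<theta>. fst (D i) j * (snd \<theta> j - \<beta> j))"
      by simp
    have "\<bar>\<Sum>j\<in>{1..K} - fst \<theta>. fst (D i) j * \<beta> j\<bar> \<le> (\<Sum>j\<in>{1..K} - fst \<theta>. \<bar>\<beta> j\<bar>)"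
      by (rule abs_sum_bounded) (use x i in auto)
    moreover have "\<bar>\<Sum>j\<in>fst \<theta>. fst (D i) j * (snd \<theta> j - \<beta> j)\<bar> \<le> (\<Sum>j\<in>fst \<theta>. \<bar>snd \<theta> j - \<beta> j\<bar>)"
      by (rule abs_sum_bounded) (use x i \<gamma> in auto)
    moreover have "(\<Sum>j\<in>fst \<theta>. \<bar>snd \<theta> j - \<beta> j\<bar>) \<le> real m * w"
      by (rule sum_le_card[OF w \<gamma>(2) w0])
    ultimately show ?thesis unfolding e using \<tau>(1) by linarith
  qed
  have "0 \<le> (\<Sum>j\<in>{1..K}. \<bar>\<beta> j\<bar>)" by (rule sum_nonneg) simp
  then have M0: "0 \<le> M" using M by linarith
  show ?thesis
  proof (rule likelihood_lipschitz)
    fix i assume i: "i \<in> {1..n}"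
    show "\<bar>\<Sum>j\<in>fst ({1..K}, \<beta>). fst (D i) j * snd ({1..K}, \<beta>) j\<bar> \<le> M + 1" using hs[OF i] by simp
    show "\<bar>?h i\<bar> \<le> M + 1" using hs[OF i] d[OF i] \<tau>(2) by linarith
    show "\<bar>(\<Sum>j\<in>fst ({1..K}, \<beta>). fst (D i) j * snd ({1..K}, \<beta>) j) - ?h i\<bar> \<le> \<tau>" using d[OF i] by simp
  qed (use M0 in simp)
qed

end

section \<open>Bounds for a fixed sample size\<close>

abbreviation far_params :: "(bool \<Rightarrow> real \<Rightarrow> real) \<Rightarrow> nat \<Rightarrow> cov measure \<Rightarrow> param \<Rightarrow> real \<Rightarrow> param set" where
  "far_params f K \<nu> \<theta>s t \<equiv>
     {\<theta> \<in> space (param_space K). t < tv_dist \<nu> (model_density f \<theta>) (model_density f \<theta>s)}"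

context
  fixes a b :: "real \<Rightarrow> real" and c :: "bool \<Rightarrow> real" and f :: "bool \<Rightarrow> real \<Rightarrow> real"
    and K n :: nat and \<nu> :: "cov measure"
  assumes glm: "is_glm a b c" and f_eq: "f = glm_pdf a b c"
    and nu: "prob_space \<nu>" and nu_sets: "sets \<nu> = sets (cov_space K)"
begin

lemma tv_dist_measurable:
  assumes "fst \<theta>s \<subseteq> {1..K}"
  shows "(\<lambda>\<theta>. tv_dist \<nu> (model_density f \<theta>) (model_density f \<theta>s)) \<in> borel_measurable (param_space K)"
proof -
  interpret prob_space \<nu> by (rule nu)
  have [measurable]: "model_density f \<theta>s True \<in> borel_measurable \<nu>"
    by (rule cond_densityD(1)[OF cond_density_model[OF glm f_eq nu_sets assms]])
  have sw: "(\<lambda>z. (snd z, fst z)) \<in> measurable (param_space K \<Otimes>\<^sub>M \<nu>) (\<nu> \<Otimes>\<^sub>M param_space K)"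
    by measurable
  have [measurable]: "(\<lambda>z. model_density f (fst z) True (snd z)) \<in> borel_measurable (param_space K \<Otimes>\<^sub>M \<nu>)"
    using measurable_compose[OF sw model_density_measurable[OF glm f_eq nu_sets, of True]] by simp
  show ?thesis
    unfolding tv_dist_def
    by (rule borel_measurable_lebesgue_integral) (unfold case_prod_beta, measurable)
qed

text \<open>A mixture is at most as far from the truth as its components are on average, and the distance of
  the far components is at most \<open>1\<close>.\<close>

lemma selected_tv_le:
  assumes \<theta>s: "fst \<theta>s \<subseteq> {1..K}" and Q: "prob_space Q" "sets Q = sets (param_space K)"
    and \<rho>: "0 < \<rho>" "\<rho> < measure Q E" and t: "0 \<le> t"
    and p_hat: "\<And>y x. p_hat y x = (\<integral>\<theta>. model_density f \<theta> y x \<partial>uniform_measure Q E)"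
  shows "p_hat True \<in> borel_measurable \<nu>" "0 \<le> p_hat True x" "p_hat True x \<le> 1"
    "tv_dist \<nu> p_hat (model_density f \<theta>s)
      \<le> t + measure Q (far_params f K \<nu> \<theta>s t) / \<rho>"
proof -
  interpret nu: prob_space \<nu> by (rule nu)
  interpret Q: prob_space Q by (rule Q(1))
  have E: "E \<in> sets Q" using \<rho> measure_notin_sets by fastforce
  have E0: "emeasure Q E \<noteq> 0" "emeasure Q E \<noteq> \<infinity>" using \<rho> by (auto simp: Q.emeasure_eq_measure)
  let ?U = "uniform_measure Q E"
  interpret U: prob_space ?U by (rule prob_space_uniform_measure[OF E0])
  interpret pair_prob_space \<nu> ?U ..
  have Up: "measure ?U (space Q) = 1" using U.prob_space by simp
  have Us: "sets ?U = sets (param_space K)" using Q(2) by simp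
  have Usp: "space ?U = space (param_space K)" by (rule sets_eq_imp_space_eq[OF Us])
  let ?p = "model_density f \<theta>s"
  have md01: "0 \<le> model_density f \<theta> y x" "model_density f \<theta> y x \<le> 1" for \<theta> y x
    unfolding model_density_def using f_pos[OF glm f_eq] f_le_1[OF glm f_eq] by (auto intro: less_imp_le)
  have [measurable]: "?p True \<in> borel_measurable \<nu>"
    by (rule cond_densityD(1)[OF cond_density_model[OF glm f_eq nu_sets \<theta>s]])
  have pairs: "sets (\<nu> \<Otimes>\<^sub>M ?U) = sets (\<nu> \<Otimes>\<^sub>M param_space K)"
    by (rule sets_pair_measure_cong[OF refl Us])
  have md [measurable]: "(\<lambda>z. model_density f (snd z) y (fst z)) \<in> borel_measurable (\<nu> \<Otimes>\<^sub>M ?U)" for y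
    using model_density_measurable[OF glm f_eq nu_sets, of y] measurable_cong_sets[OF pairs refl] by blast
  have mdx: "integrable ?U (\<lambda>\<theta>. model_density f \<theta> True x)" if "x \<in> space \<nu>" for x
  proof (rule U.integrable_const_bound[where B = 1])
    show "AE \<theta> in ?U. norm (model_density f \<theta> True x) \<le> 1" using md01 by (intro AE_I2) simp
    show "(\<lambda>\<theta>. model_density f \<theta> True x) \<in> borel_measurable ?U"
      using measurable_compose[OF measurable_Pair1'[OF that] md] by simp
  qed
  show phm: "p_hat True \<in> borel_measurable \<nu>"
    unfolding p_hat by (rule U.borel_measurable_lebesgue_integral) (unfold case_prod_beta, measurable)
  show "0 \<le> p_hat True x" for x unfolding p_hat using md01 by (intro integral_nonneg_AE) simp
  show "p_hat True x \<le> 1" for x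
  proof (cases "integrable ?U (\<lambda>\<theta>. model_density f \<theta> True x)")
    case True
    then have "p_hat True x \<le> (\<integral>\<theta>. 1 \<partial>?U)" unfolding p_hat using md01 by (intro integral_mono) auto
    then show ?thesis using U.prob_space by simp
  next
    case False
    then show ?thesis unfolding p_hat by (simp add: not_integrable_integral_eq)
  qed
  let ?d = "\<lambda>x \<theta>. \<bar>model_density f \<theta> True x - ?p True x\<bar>"
  let ?tv = "\<lambda>\<theta>. tv_dist \<nu> (model_density f \<theta>) ?p"
  have d1: "?d x \<theta> \<le> 1" for x \<theta>
    using md01[of \<theta> True x] md01[of \<theta>s True x] by linarith
  have intd: "integrable (\<nu> \<Otimes>\<^sub>M ?U) (case_prod ?d)"
  proof (rule P.integrable_const_bound[where B = 1])
    show "AE z in \<nu> \<Otimes>\<^sub>M ?U. norm (case_prod ?d z) \<le> 1" using d1 by (intro AE_I2) (simp add: case_prod_beta)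
    show "case_prod ?d \<in> borel_measurable (\<nu> \<Otimes>\<^sub>M ?U)" unfolding case_prod_beta by measurable
  qed
  have intx: "integrable \<nu> (\<lambda>x. \<integral>\<theta>. ?d x \<theta> \<partial>?U)"
    using integrable_fst'[OF intd] by (simp add: case_prod_beta)
  have tvm: "?tv \<in> borel_measurable ?U"
    using tv_dist_measurable[OF \<theta>s] measurable_cong_sets[OF Us refl] by blast
  let ?bad = "(far_params f K \<nu> \<theta>s t)"
  have bad: "?bad \<in> sets (param_space K)" using tv_dist_measurable[OF \<theta>s] by measurable
  have badU: "?bad \<in> sets ?U" using bad Us by simp
  have "tv_dist \<nu> p_hat ?p \<le> (\<integral>x. \<integral>\<theta>. ?d x \<theta> \<partial>?U \<partial>\<nu>)"
    unfolding tv_dist_def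
  proof (rule integral_mono)
    show "integrable \<nu> (\<lambda>x. \<bar>p_hat True x - ?p True x\<bar>)"
      by (rule integrable_abs_diff[OF nu cond_density_model[OF glm f_eq nu_sets \<theta>s], of p_hat]) fact+
    show "integrable \<nu> (\<lambda>x. \<integral>\<theta>. ?d x \<theta> \<partial>?U)" by (rule intx)
    fix x assume x: "x \<in> space \<nu>"
    have "p_hat True x - ?p True x = (\<integral>\<theta>. model_density f \<theta> True x - ?p True x \<partial>?U)"
      unfolding p_hat using mdx[OF x] by (simp add: Up)
    then show "\<bar>p_hat True x - ?p True x\<bar> \<le> (\<integral>\<theta>. ?d x \<theta> \<partial>?U)"
      by (simp add: integral_abs_bound)
  qed
  also have "\<dots> = (\<integral>\<theta>. ?tv \<theta> \<partial>?U)"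
    unfolding tv_dist_def using Fubini_integral[OF intd] by simp
  also have "\<dots> \<le> (\<integral>\<theta>. t + indicator ?bad \<theta> \<partial>?U)"
  proof (rule integral_mono)
    have tv1: "0 \<le> ?tv \<theta>" "?tv \<theta> \<le> 1" if "\<theta> \<in> space ?U" for \<theta>
    proof -
      have \<theta>: "fst \<theta> \<subseteq> {1..K}" using that Usp fst_param_subset by auto
      show "0 \<le> ?tv \<theta>" unfolding tv_dist_def by (rule integral_nonneg_AE) simp
      have "?tv \<theta> \<le> (\<integral>x. 1 \<partial>\<nu>)" unfolding tv_dist_def
        using integrable_abs_diff[OF nu cond_density_model[OF glm f_eq nu_sets \<theta>s],
            OF cond_densityD(1)[OF cond_density_model[OF glm f_eq nu_sets \<theta>]]] md01 d1
        by (intro integral_mono) auto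
      then show "?tv \<theta> \<le> 1" by (simp add: nu.prob_space)
    qed
    show "integrable ?U ?tv"
      by (rule U.integrable_const_bound[where B = 1]) (use tv1 tvm in \<open>auto intro!: AE_I2\<close>)
    show "integrable ?U (\<lambda>\<theta>. t + indicator ?bad \<theta>)"
    proof (rule U.integrable_const_bound[where B = "t + 1"])
      show "(\<lambda>\<theta>. t + indicator ?bad \<theta>) \<in> borel_measurable ?U"
        using badU by (intro borel_measurable_add borel_measurable_indicator) auto
    qed (use t in \<open>auto intro!: AE_I2 simp: indicator_def\<close>)
    show "?tv \<theta> \<le> t + indicator ?bad \<theta>" if "\<theta> \<in> space ?U" for \<theta>
      using tv1[OF that] t that unfolding Usp by (auto simp: indicator_def)
  qed
  also have "\<dots> = t + measure ?U ?bad"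
    using badU by (simp add: Up U.emeasure_eq_measure)
  also have "measure ?U ?bad = measure Q (E \<inter> ?bad) / measure Q E"
    using bad Q(2) E by (intro measure_uniform_measure E0) auto
  also have "\<dots> \<le> measure Q ?bad / \<rho>"
    using \<rho> bad Q(2) by (intro frac_le Q.finite_measure_mono) auto
  finally show "tv_dist \<nu> p_hat ?p \<le> t + measure Q ?bad / \<rho>" by simp
qed

end

text \<open>All constants are explicit here; the asymptotic conditions enter only when the two summands of
  the bound are compared with \<open>\<epsilon>\<^sub>n\<close>.\<close>

lemma expected_posterior_far_le:
  fixes a b :: "real \<Rightarrow> real" and c :: "bool \<Rightarrow> real" and f :: "bool \<Rightarrow> real \<Rightarrow> real"
    and K n r rbar :: nat and \<nu> :: "cov measure" and V :: "nat set \<Rightarrow> real Matrix.mat"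
    and \<beta> :: "nat \<Rightarrow> real"
  defines "\<pi> \<equiv> prior K r rbar V" and "\<theta>s \<equiv> ({1..K}, \<beta>)"
  assumes glm: "is_glm a b c" and f_eq: "f = glm_pdf a b c"
    and nu: "prob_space \<nu>" and nu_sets: "sets \<nu> = sets (cov_space K)"
    and x_bounded: "AE x in \<nu>. \<forall>j\<in>{1..K}. \<bar>x j\<bar> \<le> 1"
    and r: "1 \<le> r" "r \<le> rbar" "rbar < K"
    and V: "\<And>\<gamma>. \<gamma> \<subseteq> {1..K} \<Longrightarrow> pos_def_mat (card \<gamma>) (V \<gamma>)"
    and \<gamma>: "\<gamma> \<subseteq> {1..K}" "card \<gamma> = r" and w0: "0 \<le> w\<^sub>0"
    and \<tau>: "real r * w\<^sub>0 + (\<Sum>j\<in>{1..K} - \<gamma>. \<bar>\<beta> j\<bar>) \<le> \<tau>" "\<tau> \<le> 1"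
    and M: "(\<Sum>j\<in>{1..K}. \<bar>\<beta> j\<bar>) \<le> M"
    and E0: "0 < E0"
    and mass: "ennreal (E0 * exp (real n * (glm_lip a (M + 1) * \<tau>))) \<le> emeasure \<pi>
        {\<theta> \<in> space (param_space K). fst \<theta> = \<gamma> \<and> (\<forall>j\<in>fst \<theta>. \<bar>snd \<theta> j - \<beta> j\<bar> \<le> w\<^sub>0)}"
    and B: "\<And>\<gamma>. \<gamma> \<subseteq> {1..K} \<Longrightarrow> \<gamma> \<noteq> {} \<Longrightarrow> card \<gamma> \<le> rbar \<Longrightarrow> ch1 (V \<gamma>) \<le> B"
    and C: "0 \<le> C" and w: "0 < w" and t: "0 \<le> t"
  shows "(\<integral>\<^sup>+D. emeasure (posterior f \<pi> n D)
        (far_params f K \<nu> \<theta>s t)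
        \<partial>data_law n \<nu> (model_density f \<theta>s))
    \<le> ennreal (1 / E0 * (sqrt (2 ^ rbar) * exp (- C\<^sup>2 / (4 * B)))
       + (real (K + 1) * (2 * C / w + 2)) ^ rbar
         * (sqrt (exp (real n * (glm_lip a (real rbar * C) * (real rbar * w))) / E0) * exp (- (real n * t\<^sup>2 / 2))))"
proof -
  let ?P = "data_law n \<nu> (model_density f \<theta>s)"
  let ?tv = "\<lambda>\<theta>. tv_dist \<nu> (model_density f \<theta>) (model_density f \<theta>s)"
  have \<theta>s: "fst \<theta>s \<subseteq> {1..K}" unfolding \<theta>s_def by simp
  have prior: "prob_space \<pi>" "sets \<pi> = sets (param_space K)"
    unfolding \<pi>_def using prob_space_prior[OF r V] sets_prior[OF r V] by auto
  note ctx = glm f_eq nu_sets nu \<theta>s prior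
  interpret pi: prob_space \<pi> by (rule prior)
  define N where "N = {\<theta> \<in> space (param_space K). \<not> card (fst \<theta>) \<le> rbar}"
  define T where "T = {\<theta> \<in> space (param_space K). \<exists>j\<in>fst \<theta>. C < \<bar>snd \<theta> j\<bar>}"
  define S where "S = {\<theta> \<in> space (param_space K). (card (fst \<theta>) \<le> rbar \<and> t < ?tv \<theta>) \<and> (\<forall>j\<in>fst \<theta>. \<bar>snd \<theta> j\<bar> \<le> C)}"
  define G where "G = {\<theta> \<in> space (param_space K). fst \<theta> = \<gamma> \<and> (\<forall>j\<in>fst \<theta>. \<bar>snd \<theta> j - \<beta> j\<bar> \<le> w\<^sub>0)}"
  have [measurable]: "?tv \<in> borel_measurable (param_space K)"
    by (rule tv_dist_measurable[OF glm f_eq nu nu_sets \<theta>s])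
  have Nm: "N \<in> sets (param_space K)" unfolding N_def by measurable
  have Tm: "T \<in> sets (param_space K)" unfolding T_def by (rule coef_event_measurable) measurable
  have "{\<theta> \<in> space (param_space K). \<forall>j\<in>fst \<theta>. \<bar>snd \<theta> j\<bar> \<le> C} \<in> sets (param_space K)"
    by (rule coef_event_measurable) measurable
  moreover have "{\<theta> \<in> space (param_space K). card (fst \<theta>) \<le> rbar \<and> t < ?tv \<theta>} \<in> sets (param_space K)"
    by measurable
  ultimately have "{\<theta> \<in> space (param_space K). \<forall>j\<in>fst \<theta>. \<bar>snd \<theta> j\<bar> \<le> C}
      \<inter> {\<theta> \<in> space (param_space K). card (fst \<theta>) \<le> rbar \<and> t < ?tv \<theta>} \<in> sets (param_space K)"
    by (rule sets.Int)
  also have "{\<theta> \<in> space (param_space K). \<forall>j\<in>fst \<theta>. \<bar>snd \<theta> j\<bar> \<le> C}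
      \<inter> {\<theta> \<in> space (param_space K). card (fst \<theta>) \<le> rbar \<and> t < ?tv \<theta>} = S"
    unfolding S_def by blast
  finally have Sm: "S \<in> sets (param_space K)" .
  have "{\<theta> \<in> space (param_space K). \<forall>j\<in>fst \<theta>. \<bar>snd \<theta> j - \<beta> j\<bar> \<le> w\<^sub>0} \<in> sets (param_space K)"
    by (rule coef_event_measurable) measurable
  then have Gm: "G \<in> sets (param_space K)"
    unfolding G_def by (intro sets.sets_Collect_conj) simp_all
  have good: "AE D in ?P. bounded_data K n D"
    by (rule eventually_mono[OF AE_data_law[OF ctx x_bounded]]) (simp add: bounded_data_def)
  let ?e = "exp (real n * (glm_lip a (M + 1) * \<tau>))"
  have ev: "AE D in ?P. ennreal (E0 * likelihood f n D \<theta>s) \<le> (\<integral>\<^sup>+\<theta>. ennreal (likelihood f n D \<theta>) \<partial>\<pi>)"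
    using good AE_space
  proof eventually_elim
    case (elim D)
    let ?l = "likelihood f n D \<theta>s"
    have l0: "0 < ?l" by (rule likelihood_pos[OF glm f_eq])
    have near: "?l / ?e \<le> likelihood f n D \<theta>" if "\<theta> \<in> G" for \<theta>
    proof -
      have "?l \<le> ?e * likelihood f n D \<theta>"
        unfolding \<theta>s_def
      proof (rule likelihood_near_truth[OF glm f_eq elim(1)])
        show "fst \<theta> \<subseteq> {1..K}" "card (fst \<theta>) \<le> r" using that \<gamma> unfolding G_def by auto
        show "\<And>j. j \<in> fst \<theta> \<Longrightarrow> \<bar>snd \<theta> j - \<beta> j\<bar> \<le> w\<^sub>0" using that unfolding G_def by auto
        show "real r * w\<^sub>0 + (\<Sum>j\<in>{1..K} - fst \<theta>. \<bar>\<beta> j\<bar>) \<le> \<tau>" using that \<tau>(1) unfolding G_def by auto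
      qed (use w0 \<tau> M in auto)
      then show ?thesis by (simp add: pos_divide_le_eq mult.commute)
    qed
    have "ennreal (E0 * ?l) = ennreal (?l / ?e) * ennreal (E0 * ?e)"
      using E0 l0 by (subst ennreal_mult[symmetric]) auto
    also have "\<dots> \<le> ennreal (?l / ?e) * emeasure \<pi> G"
      using mass unfolding G_def by (intro mult_left_mono) auto
    also have "\<dots> = (\<integral>\<^sup>+\<theta>. ennreal (?l / ?e) * indicator G \<theta> \<partial>\<pi>)"
      using Gm prior by (simp add: nn_integral_cmult_indicator)
    also have "\<dots> \<le> (\<integral>\<^sup>+\<theta>. ennreal (likelihood f n D \<theta>) \<partial>\<pi>)"
      using near by (intro nn_integral_mono) (auto simp: indicator_def intro!: ennreal_leI)
    finally show ?case .
  qed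
  have boundT: "(\<integral>\<^sup>+D. emeasure (posterior f \<pi> n D) T \<partial>?P)
      \<le> ennreal (1 / E0 * (sqrt (2 ^ rbar) * exp (- C\<^sup>2 / (4 * B))))"
  proof -
    have "(\<integral>\<^sup>+D. emeasure (posterior f \<pi> n D) T \<partial>?P) \<le> ennreal (1 / E0) * emeasure \<pi> T"
      by (rule expected_posterior_le_prior[OF ctx Tm E0 ev])
    also have "\<dots> \<le> ennreal (1 / E0) * ennreal (sqrt (2 ^ rbar) * exp (- C\<^sup>2 / (4 * B)))"
      unfolding T_def \<pi>_def by (intro mult_left_mono prior_tail[OF r V B C]) auto
    finally show ?thesis using E0 by (simp add: ennreal_mult[symmetric])
  qed
  have boundS: "(\<integral>\<^sup>+D. emeasure (posterior f \<pi> n D) S \<partial>?P)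
      \<le> ennreal ((real (K + 1) * (2 * C / w + 2)) ^ rbar
         * (sqrt (exp (real n * (glm_lip a (real rbar * C) * (real rbar * w))) / E0) * exp (- (real n * t\<^sup>2 / 2))))"
  proof -
    have S: "fst \<theta> \<subseteq> {1..K} \<and> card (fst \<theta>) \<le> rbar \<and> (\<forall>j\<in>fst \<theta>. \<bar>snd \<theta> j\<bar> \<le> C)" if "\<theta> \<in> S" for \<theta>
      using that fst_param_subset unfolding S_def by auto
    have "\<exists>\<Theta>\<subseteq>S. finite \<Theta> \<and> real (card \<Theta>) \<le> (real (K + 1) * (2 * C / w + 2)) ^ rbar \<and>
        (\<forall>\<theta>\<in>S. \<exists>\<theta>'\<in>\<Theta>. fst \<theta>' = fst \<theta> \<and> (\<forall>j\<in>fst \<theta>. \<bar>snd \<theta> j - snd \<theta>' j\<bar> \<le> w))"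
      by (rule param_net[OF _ w C]) (rule S)
    then obtain \<Theta> where \<Theta>: "\<Theta> \<subseteq> S" "finite \<Theta>" "real (card \<Theta>) \<le> (real (K + 1) * (2 * C / w + 2)) ^ rbar"
      "\<forall>\<theta>\<in>S. \<exists>\<theta>'\<in>\<Theta>. fst \<theta>' = fst \<theta> \<and> (\<forall>j\<in>fst \<theta>. \<bar>snd \<theta> j - snd \<theta>' j\<bar> \<le> w)"
      by (elim exE conjE)
    let ?G = "exp (real n * (glm_lip a (real rbar * C) * (real rbar * w)))"
    have "(\<integral>\<^sup>+D. emeasure (posterior f \<pi> n D) S \<partial>?P)
        \<le> ennreal (real (card \<Theta>) * (sqrt (?G / E0) * exp (- (real n * t\<^sup>2 / 2))))"
    proof (rule expected_posterior_le_net[OF ctx Sm E0 _ t ev \<Theta>(2)])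
      show "fst \<theta> \<subseteq> {1..K}" "t \<le> ?tv \<theta>" if "\<theta> \<in> \<Theta>" for \<theta>
      proof -
        have \<theta>: "\<theta> \<in> S" using that \<Theta>(1) by blast
        show "fst \<theta> \<subseteq> {1..K}" using S[OF \<theta>] by blast
        show "t \<le> ?tv \<theta>" using \<theta> unfolding S_def mem_Collect_eq by linarith
      qed
      show "AE D in ?P. \<forall>\<theta>\<in>S. \<exists>\<theta>'\<in>\<Theta>. likelihood f n D \<theta> \<le> ?G * likelihood f n D \<theta>'"
        using good
      proof eventually_elim
        case (elim D)
        show ?case
        proof
          fix \<theta> assume \<theta>: "\<theta> \<in> S"
          from bspec[OF \<Theta>(4) \<theta>] obtain \<theta>' where \<theta>': "\<theta>' \<in> \<Theta>" "fst \<theta>' = fst \<theta>"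
            "\<forall>j\<in>fst \<theta>. \<bar>snd \<theta> j - snd \<theta>' j\<bar> \<le> w" by blast
          have "\<theta>' \<in> S" using \<theta>'(1) \<Theta>(1) by blast
          have "likelihood f n D \<theta> \<le> ?G * likelihood f n D \<theta>'"
          proof (rule likelihood_close[OF glm f_eq elim])
            show "fst \<theta> \<subseteq> {1..K}" "card (fst \<theta>) \<le> rbar" using S[OF \<theta>] by blast+
            show "fst \<theta>' = fst \<theta>" by (rule \<theta>'(2))
            show "\<And>j. j \<in> fst \<theta> \<Longrightarrow> \<bar>snd \<theta> j\<bar> \<le> C" using S[OF \<theta>] by blast
            show "\<And>j. j \<in> fst \<theta> \<Longrightarrow> \<bar>snd \<theta>' j\<bar> \<le> C" using S[OF \<open>\<theta>' \<in> S\<close>] \<theta>'(2) by simp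
            show "\<And>j. j \<in> fst \<theta> \<Longrightarrow> \<bar>snd \<theta> j - snd \<theta>' j\<bar> \<le> w" using \<theta>'(3) by blast
          qed (use w C in simp_all)
          with \<theta>'(1) show "\<exists>\<theta>'\<in>\<Theta>. likelihood f n D \<theta> \<le> ?G * likelihood f n D \<theta>'" by blast
        qed
      qed
    qed simp
    also have "\<dots> \<le> ennreal ((real (K + 1) * (2 * C / w + 2)) ^ rbar * (sqrt (?G / E0) * exp (- (real n * t\<^sup>2 / 2))))"
      using E0 by (intro ennreal_leI mult_right_mono \<Theta>(3)) auto
    finally show ?thesis .
  qed
  have split: "AE D in ?P. emeasure (posterior f \<pi> n D) (far_params f K \<nu> \<theta>s t)
      \<le> emeasure (posterior f \<pi> n D) T + emeasure (posterior f \<pi> n D) S"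
    using ev AE_space
  proof eventually_elim
    case (elim D)
    have ps: "sets (posterior f \<pi> n D) = sets (param_space K)"
      by (rule sets_posterior[OF ctx])
    have "emeasure (posterior f \<pi> n D) N \<le> 0"
    proof (rule posterior_le[OF ctx elim(2) Nm elim(1)])
      have "(\<integral>\<^sup>+\<theta>. ennreal (likelihood f n D \<theta>) * indicator N \<theta> \<partial>\<pi>) = (\<integral>\<^sup>+\<theta>. 0 \<partial>\<pi>)"
      proof (rule nn_integral_cong_AE)
        show "AE \<theta> in \<pi>. ennreal (likelihood f n D \<theta>) * indicator N \<theta> = 0"
        proof -
          have "AE \<theta> in \<pi>. card (fst \<theta>) \<le> rbar"
            unfolding \<pi>_def by (rule prior_model_size[OF r]) (rule V)
          then show ?thesis by eventually_elim (simp add: N_def)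
        qed
      qed
      then show "(\<integral>\<^sup>+\<theta>. ennreal (likelihood f n D \<theta>) * indicator N \<theta> \<partial>\<pi>) \<le> 0 * ennreal (E0 * likelihood f n D \<theta>s)"
        by simp
    qed
    then have N0: "emeasure (posterior f \<pi> n D) N = 0" by simp
    have "(far_params f K \<nu> \<theta>s t) \<subseteq> (T \<union> S) \<union> N"
    proof
      fix \<theta> assume "\<theta> \<in> (far_params f K \<nu> \<theta>s t)"
      then have \<theta>: "\<theta> \<in> space (param_space K)" "t < ?tv \<theta>" by auto
      show "\<theta> \<in> (T \<union> S) \<union> N"
      proof (cases "card (fst \<theta>) \<le> rbar \<and> (\<forall>j\<in>fst \<theta>. \<bar>snd \<theta> j\<bar> \<le> C)")
        case True
        then have "\<theta> \<in> S" unfolding S_def using \<theta> by blast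
        then show ?thesis by blast
      next
        case False
        then have "\<theta> \<in> T \<or> \<theta> \<in> N" unfolding T_def N_def using \<theta>(1) by (auto simp: not_le)
        then show ?thesis by blast
      qed
    qed
    then have "emeasure (posterior f \<pi> n D) (far_params f K \<nu> \<theta>s t)
        \<le> emeasure (posterior f \<pi> n D) ((T \<union> S) \<union> N)"
      using Tm Sm Nm ps by (intro emeasure_mono) auto
    also have "\<dots> \<le> emeasure (posterior f \<pi> n D) (T \<union> S) + emeasure (posterior f \<pi> n D) N"
      using Tm Sm Nm ps by (intro emeasure_subadditive) auto
    also have "emeasure (posterior f \<pi> n D) (T \<union> S) \<le> emeasure (posterior f \<pi> n D) T + emeasure (posterior f \<pi> n D) S"
      using Tm Sm Nm ps by (intro emeasure_subadditive) auto
    finally show ?case using N0 by simp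
  qed
  note meas = posterior_measurable[OF ctx]
  have "(\<integral>\<^sup>+D. emeasure (posterior f \<pi> n D) (far_params f K \<nu> \<theta>s t) \<partial>?P)
      \<le> (\<integral>\<^sup>+D. emeasure (posterior f \<pi> n D) T + emeasure (posterior f \<pi> n D) S \<partial>?P)"
    by (rule nn_integral_mono_AE[OF split])
  also have "\<dots> = (\<integral>\<^sup>+D. emeasure (posterior f \<pi> n D) T \<partial>?P) + (\<integral>\<^sup>+D. emeasure (posterior f \<pi> n D) S \<partial>?P)"
    by (rule nn_integral_add[OF meas[OF Tm] meas[OF Sm]])
  also have "\<dots> \<le> ennreal (1 / E0 * (sqrt (2 ^ rbar) * exp (- C\<^sup>2 / (4 * B))))
      + ennreal ((real (K + 1) * (2 * C / w + 2)) ^ rbar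
         * (sqrt (exp (real n * (glm_lip a (real rbar * C) * (real rbar * w))) / E0) * exp (- (real n * t\<^sup>2 / 2))))"
    by (rule add_mono[OF boundT boundS])
  also have "\<dots> = ennreal (1 / E0 * (sqrt (2 ^ rbar) * exp (- C\<^sup>2 / (4 * B)))
       + (real (K + 1) * (2 * C / w + 2)) ^ rbar
         * (sqrt (exp (real n * (glm_lip a (real rbar * C) * (real rbar * w))) / E0) * exp (- (real n * t\<^sup>2 / 2))))"
    using E0 C w by (intro ennreal_plus[symmetric] mult_nonneg_nonneg) auto
  finally show ?thesis .
qed

text \<open>A risk that is not integrable as a function of the data has integral \<open>0\<close> by convention, which makes
  the bound trivial.  Otherwise the bound for almost every data set is integrated.\<close>

lemma expected_excess_risk_le:
  fixes a b :: "real \<Rightarrow> real" and c :: "bool \<Rightarrow> real" and f :: "bool \<Rightarrow> real \<Rightarrow> real"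
    and K n :: nat and \<nu> :: "cov measure" and \<pi> :: "param measure" and A :: "dataset \<Rightarrow> cdens set"
  assumes glm: "is_glm a b c" and f_eq: "f = glm_pdf a b c"
    and nu: "prob_space \<nu>" and nu_sets: "sets \<nu> = sets (cov_space K)"
    and \<theta>s: "fst \<theta>s \<subseteq> {1..K}" and prior: "prob_space \<pi>" "sets \<pi> = sets (param_space K)"
    and \<rho>: "0 < \<rho>" and t: "0 \<le> t" and u: "0 \<le> u"
    and mass: "AE D in data_law n \<nu> (model_density f \<theta>s). \<rho> < measure (posterior f \<pi> n D) (sel_event f K (A D))"
    and far: "(\<integral>\<^sup>+D. emeasure (posterior f \<pi> n D)
        (far_params f K \<nu> \<theta>s t)
        \<partial>data_law n \<nu> (model_density f \<theta>s)) \<le> ennreal u"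
  shows "(\<integral>D. misclass_prob (obs_law \<nu> (model_density f \<theta>s)) (classifier (selected_estimate f K \<pi> n D (A D)))
            \<partial>data_law n \<nu> (model_density f \<theta>s))
       - misclass_prob (obs_law \<nu> (model_density f \<theta>s)) (classifier (model_density f \<theta>s))
    \<le> 2 * t + 2 * u / \<rho>"
proof -
  let ?P = "data_law n \<nu> (model_density f \<theta>s)"
  note ctx = glm f_eq nu_sets nu \<theta>s prior
  interpret P: prob_space ?P by (rule prob_space_data_law[OF ctx])
  let ?R = "\<lambda>D. misclass_prob (obs_law \<nu> (model_density f \<theta>s)) (classifier (selected_estimate f K \<pi> n D (A D)))"
  let ?L = "misclass_prob (obs_law \<nu> (model_density f \<theta>s)) (classifier (model_density f \<theta>s))"
  let ?bad = "(far_params f K \<nu> \<theta>s t)"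
  have rhs: "0 \<le> 2 * t + 2 * u / \<rho>" using \<rho> t u by simp
  have L0: "0 \<le> ?L" unfolding misclass_prob_def by simp
  show ?thesis
  proof (cases "integrable ?P ?R")
    case False
    then show ?thesis using L0 rhs by (simp add: not_integrable_integral_eq)
  next
    case True
    have pt: "AE D in ?P. ennreal (?R D - ?L) \<le> ennreal (2 * t) + ennreal (2 / \<rho>) * emeasure (posterior f \<pi> n D) ?bad"
      using mass AE_space
    proof eventually_elim
      case (elim D)
      let ?Q = "posterior f \<pi> n D"
      interpret Q: prob_space ?Q by (rule prob_space_posterior[OF ctx elim(2)])
      note sel = selected_tv_le[OF glm f_eq nu nu_sets \<theta>s Q.prob_space_axioms sets_posterior[OF ctx] \<rho> elim(1) t,
          of "selected_estimate f K \<pi> n D (A D)", unfolded selected_estimate_def, OF refl, folded selected_estimate_def]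
      have "?R D - ?L \<le> 2 * tv_dist \<nu> (selected_estimate f K \<pi> n D (A D)) (model_density f \<theta>s)"
        by (rule excess_risk_le[OF nu cond_density_model[OF glm f_eq nu_sets \<theta>s]]) (rule sel)+
      also have "\<dots> \<le> 2 * (t + measure ?Q ?bad / \<rho>)" using sel(4) by simp
      also have "\<dots> = 2 * t + 2 / \<rho> * measure ?Q ?bad" by (simp add: field_simps)
      finally have "ennreal (?R D - ?L) \<le> ennreal (2 * t + 2 / \<rho> * measure ?Q ?bad)" by (rule ennreal_leI)
      also have "\<dots> = ennreal (2 * t) + ennreal (2 / \<rho>) * emeasure ?Q ?bad"
        unfolding Q.emeasure_eq_measure using t \<rho>
        by (simp only: ennreal_mult[symmetric] ennreal_plus[symmetric] measure_nonneg divide_nonneg_pos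
            mult_nonneg_nonneg zero_le_numeral)
      finally show ?case .
    qed
    have "(\<integral>\<^sup>+D. ennreal (?R D - ?L) \<partial>?P) \<le> ennreal (2 * t + 2 * u / \<rho>)"
    proof -
      have bad: "?bad \<in> sets (param_space K)"
        using tv_dist_measurable[OF glm f_eq nu nu_sets \<theta>s] by measurable
      have m: "(\<lambda>D. emeasure (posterior f \<pi> n D) ?bad) \<in> borel_measurable ?P"
        by (rule posterior_measurable[OF ctx bad])
      have "(\<integral>\<^sup>+D. ennreal (?R D - ?L) \<partial>?P)
          \<le> (\<integral>\<^sup>+D. ennreal (2 * t) + ennreal (2 / \<rho>) * emeasure (posterior f \<pi> n D) ?bad \<partial>?P)"
        by (rule nn_integral_mono_AE[OF pt])
      also have "\<dots> = ennreal (2 * t) + ennreal (2 / \<rho>) * (\<integral>\<^sup>+D. emeasure (posterior f \<pi> n D) ?bad \<partial>?P)"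
        using m by (simp add: nn_integral_add nn_integral_cmult P.emeasure_space_1)
      also have "\<dots> \<le> ennreal (2 * t) + ennreal (2 / \<rho>) * ennreal u"
        by (intro add_left_mono mult_left_mono far) simp
      also have "\<dots> = ennreal (2 * t + 2 * u / \<rho>)" using t u \<rho> by (simp add: ennreal_mult[symmetric])
      finally show ?thesis .
    qed
    from integral_real_bounded[OF rhs this]
    have "(\<integral>D. ?R D - ?L \<partial>?P) \<le> 2 * t + 2 * u / \<rho>" .
    then show ?thesis using True by (simp add: P.prob_space)
  qed
qed

section \<open>Asymptotics\<close>

lemma power_eq_exp: "0 < x \<Longrightarrow> x ^ m = exp (real m * ln (x::real))"
  by (simp add: exp_of_nat_mult)

lemma one_minus_ratio_power_ge:
  assumes "r < K"
  shows "exp (- real r) \<le> (1 - real r / real K) ^ (K - r)"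
proof -
  define d where "d = real (K - r)"
  have d: "0 < d" "real K = d + real r" using assms unfolding d_def by auto
  have "1 + real r / d \<le> exp (real r / d)" by (rule exp_ge_add_one_self)
  then have "exp (- (real r / d)) \<le> 1 / (1 + real r / d)"
    using d by (simp add: exp_minus inverse_eq_divide frac_le add_pos_nonneg)
  also have "\<dots> = 1 - real r / real K" unfolding d(2) using d(1) by (simp add: field_simps)
  finally have "exp (- (real r / d)) ^ (K - r) \<le> (1 - real r / real K) ^ (K - r)"
    by (intro power_mono) auto
  moreover have "exp (- (real r / d)) ^ (K - r) = exp (real (K - r) * (- (real r / d)))"
    by (simp only: exp_of_nat_mult)
  moreover have "real (K - r) * (- (real r / d)) = - real r" unfolding d_def[symmetric] using d(1) by simp
  ultimately show ?thesis by (simp only:)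
qed

text \<open>The side length of the box has \<open>r\<close> in its denominator, which cancels the \<open>r\<close> in the inclusion
  probability \<open>r / K\<close>: no term \<open>r ln r\<close> is left.\<close>

lemma box_mass_ge:
  fixes e :: real
  assumes r: "1 \<le> r" "r < K" and \<delta>: "0 < \<delta>" and e: "0 < e" and B: "0 < B"
    and Y: "real r * ln (real K) + real r * ln (1 / e) + real r * (1 + ln (1 / \<delta>) + ln (2 * pi) / 2)
      + B1 * Q / 2 + real r * ln B / 2 \<le> Y"
  shows "exp (- Y) \<le> (real r / real K) ^ r * (1 - real r / real K) ^ (K - r)
      * ((2 * (\<delta> * e / (2 * real r))) ^ r * (exp (- B1 * Q / 2) / sqrt ((2 * pi * B) ^ r)))"
proof -
  have K: "0 < real K" and r0: "0 < real r" using r by auto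
  let ?X = "real r * (- ln (real K) - ln (1 / e) - ln (1 / \<delta>))"
  have 1: "(real r / real K) ^ r * (2 * (\<delta> * e / (2 * real r))) ^ r = exp ?X"
  proof -
    have "(real r / real K) ^ r * (2 * (\<delta> * e / (2 * real r))) ^ r = (\<delta> * e / real K) ^ r"
      unfolding power_mult_distrib[symmetric] using r0 by simp
    also have "\<dots> = exp (real r * ln (\<delta> * e / real K))" using K \<delta> e by (intro power_eq_exp) simp
    also have "ln (\<delta> * e / real K) = - ln (real K) - ln (1 / e) - ln (1 / \<delta>)"
      using K \<delta> e by (simp add: ln_div ln_mult)
    finally show ?thesis .
  qed
  have 2: "sqrt ((2 * pi * B) ^ r) = exp (real r * (ln (2 * pi) / 2 + ln B / 2))"
  proof -
    have "(2 * pi * B) ^ r = exp (real r * ln (2 * pi * B))" using B by (intro power_eq_exp) simp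
    also have "ln (2 * pi * B) = ln (2 * pi) + ln B" using B by (subst ln_mult) auto
    also have "exp (real r * (ln (2 * pi) + ln B)) = (exp (real r * (ln (2 * pi) / 2 + ln B / 2)))\<^sup>2"
      unfolding exp_double[symmetric] by (simp add: algebra_simps)
    finally show ?thesis by simp
  qed
  have "exp (- Y) \<le> exp (?X + - real r + (- B1 * Q / 2 - real r * (ln (2 * pi) / 2 + ln B / 2)))"
    using Y by (simp add: algebra_simps)
  also have "\<dots> = exp ?X * exp (- real r) * (exp (- B1 * Q / 2) / sqrt ((2 * pi * B) ^ r))"
    unfolding 2 by (simp only: exp_add exp_diff times_divide_eq_right)
  also have "\<dots> \<le> exp ?X * (1 - real r / real K) ^ (K - r) * (exp (- B1 * Q / 2) / sqrt ((2 * pi * B) ^ r))"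
    using B by (intro mult_right_mono mult_left_mono one_minus_ratio_power_ge[OF r(2)]) auto
  finally show ?thesis unfolding 1[symmetric] by (simp only: mult_ac)
qed

lemma asymp_less_eventually_le:
  fixes u v :: "nat \<Rightarrow> real"
  assumes "u \<prec> v" and "\<And>n. n \<ge> 1 \<Longrightarrow> 0 < v n" and "0 < \<kappa>"
  shows "\<forall>\<^sub>F n in sequentially. u n \<le> \<kappa> * v n"
proof -
  have "\<forall>\<^sub>F n in sequentially. dist (u n / v n) 0 < \<kappa>"
    using assms(1,3) unfolding asymp_less_def by (rule tendstoD)
  then show ?thesis using eventually_ge_at_top[of 1]
  proof eventually_elim
    case (elim n)
    then have "u n / v n < \<kappa>" unfolding dist_real_def by linarith
    then show ?case using assms(2)[of n] elim by (simp add: pos_divide_less_eq)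
  qed
qed

lemma asymp_less_eventually_ge:
  fixes v :: "nat \<Rightarrow> real"
  assumes "(\<lambda>n. 1) \<prec> v" and "\<And>n. n \<ge> 1 \<Longrightarrow> 0 < v n"
  shows "\<forall>\<^sub>F n in sequentially. k \<le> v n"
proof -
  have "\<forall>\<^sub>F n in sequentially. 1 \<le> (1 / (\<bar>k\<bar> + 1)) * v n"
    by (rule asymp_less_eventually_le[OF assms]) auto
  then show ?thesis
  proof eventually_elim
    case (elim n)
    then have "\<bar>k\<bar> + 1 \<le> v n" by (simp add: pos_le_divide_eq)
    then show ?case by linarith
  qed
qed

lemma sum_squares_le_square_sum:
  fixes g :: "'i \<Rightarrow> real"
  assumes "\<And>j. j \<in> I \<Longrightarrow> 0 \<le> g j"
  shows "(\<Sum>j\<in>I. (g j)\<^sup>2) \<le> (\<Sum>j\<in>I. g j)\<^sup>2"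
  using assms
proof (induction I rule: infinite_finite_induct)
  case (insert i I)
  have "0 \<le> g i" "0 \<le> (\<Sum>j\<in>I. g j)" using insert.prems by (auto intro: sum_nonneg)
  then have "0 \<le> g i * (\<Sum>j\<in>I. g j)" by simp
  then show ?case using insert by (simp add: power2_sum)
qed auto

lemma finite_models_of_size: "finite (models_of_size K r)"
  unfolding models_of_size_def by (rule finite_subset[of _ "Pow {1..K}"]) auto

lemma ch1_le_B_bar: "\<gamma> \<in> models_of_size K r \<Longrightarrow> ch1 (V \<gamma>) \<le> B_bar K V r"
  unfolding B_bar_def by (intro cSUP_upper bdd_above_finite finite_imageI finite_models_of_size)

lemma ch1_inv_le_B_inv: "\<gamma> \<in> models_of_size K r \<Longrightarrow> ch1 (mat_inv (V \<gamma>)) \<le> B_inv K V r"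
  unfolding B_inv_def by (intro cSUP_upper bdd_above_finite finite_imageI finite_models_of_size)

lemma ch1_le_B_tilde:
  assumes "\<gamma> \<subseteq> {1..K}" "\<gamma> \<noteq> {}" "card \<gamma> \<le> m"
  shows "ch1 (V \<gamma>) \<le> B_tilde K V m"
proof -
  have "finite {\<gamma>. \<gamma> \<subseteq> {1..K} \<and> \<gamma> \<noteq> {} \<and> card \<gamma> \<le> m}"
    by (rule finite_subset[of _ "Pow {1..K}"]) auto
  then show ?thesis
    unfolding B_tilde_def using assms by (intro cSUP_upper bdd_above_finite finite_imageI) auto
qed

lemma net_size_le:
  fixes e :: real
  assumes e: "0 < e" "e \<le> 1" and D: "1 \<le> D" and p: "0 < p" and K: "1 \<le> K" and x: "x \<le> D / p / e"
    and x0: "0 \<le> x"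
  shows "(real (K + 1) * (2 * x + 2)) ^ m
    \<le> exp (real m * ln (real K) + real m * ln D + real m * ln (1 / e) + real m * ln (2 * (2 / p + 2)))"
proof -
  have De: "1 \<le> D / e" using e D by (simp add: pos_le_divide_eq)
  have K0: "0 < real K" using K by simp
  have "2 * x + 2 \<le> 2 * (D / p / e) + 2 * (D / e)" using x De by linarith
  also have "\<dots> = (2 / p + 2) * (D / e)" using p e by (simp add: field_simps)
  finally have a: "2 * x + 2 \<le> (2 / p + 2) * (D / e)" .
  have "real (K + 1) * (2 * x + 2) \<le> (2 * real K) * ((2 / p + 2) * (D / e))"
    using K x0 by (intro mult_mono a) auto
  also have "\<dots> = real K * D * (1 / e) * (2 * (2 / p + 2))" by (simp add: mult_ac)
  finally have "(real (K + 1) * (2 * x + 2)) ^ m \<le> (real K * D * (1 / e) * (2 * (2 / p + 2))) ^ m"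
    using x0 by (intro power_mono) auto
  also have "\<dots> = exp (real m * ln (real K * D * (1 / e) * (2 * (2 / p + 2))))"
    using K0 D e p by (intro power_eq_exp mult_pos_pos add_pos_pos divide_pos_pos) auto
  also have "ln (real K * D * (1 / e) * (2 * (2 / p + 2))) = ln (real K) + ln D + ln (1 / e) + ln (2 * (2 / p + 2))"
  proof -
    have pos: "0 < D" "0 < 1 / e" "0 < 2 * (2 / p + 2)" using D e p by (auto intro!: add_pos_pos)
    have "ln (real K * D * (1 / e) * (2 * (2 / p + 2))) = ln (real K * D * (1 / e)) + ln (2 * (2 / p + 2))"
      by (rule ln_mult_pos) (intro mult_pos_pos K0 pos, rule pos)
    also have "ln (real K * D * (1 / e)) = ln (real K * D) + ln (1 / e)"
      by (rule ln_mult_pos) (intro mult_pos_pos K0 pos, rule pos)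
    also have "ln (real K * D) = ln (real K) + ln D" by (rule ln_mult_pos[OF K0 pos(1)])
    finally show ?thesis .
  qed
  finally show ?thesis by (simp add: algebra_simps)
qed

theorem mainTheorem5:
  fixes a b :: "real \<Rightarrow> real" and c :: "bool \<Rightarrow> real"
    and f :: "bool \<Rightarrow> real \<Rightarrow> real"
    and K r rbar :: "nat \<Rightarrow> nat"
    and \<nu>\<^sub>x :: "nat \<Rightarrow> cov measure"
    and \<beta>_true :: "nat \<Rightarrow> nat \<Rightarrow> real"
    and V :: "nat \<Rightarrow> nat set \<Rightarrow> real Matrix.mat"
    and \<epsilon> :: "nat \<Rightarrow> real"
    and p_true :: "nat \<Rightarrow> cdens"
    and P :: "nat \<Rightarrow> (cov \<times> bool) measure"
    and PD :: "nat \<Rightarrow> dataset measure"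
    and \<pi> :: "nat \<Rightarrow> param measure"
    and A :: "nat \<Rightarrow> dataset \<Rightarrow> cdens set"
    and p_hat :: "nat \<Rightarrow> dataset \<Rightarrow> cdens"
    and \<rho> :: real
  assumes glm: "is_glm a b c"
    and f_eq: "f = glm_pdf a b c"
    and K_mono: "mono_on {1..} K"
    and nu_prob: "\<And>n. n \<ge> 1 \<Longrightarrow> prob_space (\<nu>\<^sub>x n)"
    and nu_sets: "\<And>n. n \<ge> 1 \<Longrightarrow> sets (\<nu>\<^sub>x n) = sets (cov_space (K n))"
    and x_bounded: "\<And>n. n \<ge> 1 \<Longrightarrow> AE x in \<nu>\<^sub>x n. \<forall>j\<in>{1..K n}. \<bar>x j\<bar> \<le> 1"
    and beta_summable: "convergent (\<lambda>n. \<Sum>j\<in>{1..K n}. \<bar>\<beta>_true n j\<bar>)"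
    and p_true_eq: "\<And>n. p_true n = model_density f ({1..K n}, \<beta>_true n)"
    and P_eq: "\<And>n. P n = obs_law (\<nu>\<^sub>x n) (p_true n)"
    and PD_eq: "\<And>n. PD n = data_law n (\<nu>\<^sub>x n) (p_true n)"
    and V_pos_def: "\<And>n \<gamma>. n \<ge> 1 \<Longrightarrow> \<gamma> \<subseteq> {1..K n} \<Longrightarrow> pos_def_mat (card \<gamma>) (V n \<gamma>)"
    and Pi_eq: "\<And>n. \<pi> n = prior (K n) (r n) (rbar n) (V n)"
    and eps_range: "\<And>n. n \<ge> 1 \<Longrightarrow> 0 < \<epsilon> n \<and> \<epsilon> n \<le> 1"
    and eps_rate: "(\<lambda>n. 1) \<prec> (\<lambda>n. real n * (\<epsilon> n)\<^sup>2)"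
    and rbar_eps: "(\<lambda>n. real (rbar n) * ln (1 / (\<epsilon> n)\<^sup>2)) \<prec> (\<lambda>n. real n * (\<epsilon> n)\<^sup>2)"
    and rbar_K: "(\<lambda>n. real (rbar n) * ln (real (K n))) \<prec> (\<lambda>n. real n * (\<epsilon> n)\<^sup>2)"
    and rbar_D: "(\<lambda>n. real (rbar n) *
          ln (glm_D a b (real (rbar n) * sqrt (real n * (\<epsilon> n)\<^sup>2 * B_tilde (K n) (V n) (rbar n)))))
        \<prec> (\<lambda>n. real n * (\<epsilon> n)\<^sup>2)"
    and r_range: "\<And>n. n \<ge> 1 \<Longrightarrow> 1 \<le> r n \<and> r n \<le> rbar n \<and> rbar n < K n"
    and r_large: "(\<lambda>n. 1) \<prec> (\<lambda>n. real (r n))"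
    and r_small: "(\<lambda>n. real (r n)) \<prec> (\<lambda>n. real (K n))"
    and Delta_small: "(\<lambda>n. Delta (K n) (\<beta>_true n) (r n)) \<prec> (\<lambda>n. (\<epsilon> n)\<^sup>2)"
    and B_small: "(\<lambda>n. B_inv (K n) (V n) (r n)) \<prec> (\<lambda>n. real n * (\<epsilon> n)\<^sup>2)"
    and Bbar_small: "(\<lambda>n. real (r n) * ln (B_bar (K n) (V n) (r n))) \<prec> (\<lambda>n. real n * (\<epsilon> n)\<^sup>2)"
    and A_rule: "\<And>n. n \<ge> 1 \<Longrightarrow> selection_rule f (K n) (PD n) (A n)"
    and rho_pos: "\<rho> > 0"
    and A_mass: "\<And>n. n \<ge> 1 \<Longrightarrow>
          AE D in PD n. measure (posterior f (\<pi> n) n D) (sel_event f (K n) (A n D)) > \<rho>"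
    and p_hat_eq: "\<And>n D. p_hat n D = selected_estimate f (K n) (\<pi> n) n D (A n D)"
  shows "\<forall>\<^sub>F n in sequentially.
           (\<integral>D. misclass_prob (P n) (classifier (p_hat n D)) \<partial>PD n)
             - misclass_prob (P n) (classifier (p_true n))
           \<le> 5 * \<epsilon> n"
proof -
  let ?s = "\<lambda>n. real n * (\<epsilon> n)\<^sup>2"
  have s_pos: "0 < ?s n" and e2_pos: "0 < (\<epsilon> n)\<^sup>2" if "n \<ge> 1" for n
    using eps_range[OF that] that by auto
  from convergent_imp_Bseq[OF beta_summable] obtain M where M: "0 < M"
    "\<And>n. norm (\<Sum>j\<in>{1..K n}. \<bar>\<beta>_true n j\<bar>) \<le> M" unfolding Bseq_def by blast
  define \<Lambda> where "\<Lambda> = glm_lip a (M + 1)"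
  have \<Lambda>: "0 < \<Lambda>" unfolding \<Lambda>_def using M(1) by (intro glm_lip_pos[OF glm]) simp
  \<comment> \<open>The radius \<open>\<delta> \<epsilon>\<^sub>n\<^sup>2\<close> in the linear predictor costs a factor of at most \<open>exp (s / 32)\<close> in the
    likelihood.\<close>
  define \<delta> where "\<delta> = min 1 (1 / (32 * \<Lambda>))"
  have \<delta>: "0 < \<delta>" "\<delta> \<le> 1" "\<Lambda> * \<delta> \<le> 1 / 32"
    using \<Lambda> unfolding \<delta>_def by (auto simp: min_def field_simps)
  define p where "p = glm_pdf a b c True 0"
  have p: "0 < p" unfolding p_def by (rule glm_pdf_pos[OF glm])
  define Q where "Q = (M + 1)\<^sup>2"
  define c0 where "c0 = 1 + ln (1 / \<delta>) + ln (2 * pi) / 2"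
  define c1 where "c1 = ln (2 * (2 / p + 2))"
  have "0 \<le> ln (1 / \<delta>)" using \<delta> by simp
  moreover have "0 \<le> ln (2 * pi)" using pi_gt3 by (intro ln_ge_zero) linarith
  ultimately have c0: "0 \<le> c0" unfolding c0_def by linarith
  have c1: "0 \<le> c1" unfolding c1_def using p by (intro ln_ge_zero) (simp add: add_nonneg_pos)
  have Q: "0 \<le> Q" unfolding Q_def by simp
  \<comment> \<open>Every quantity assumed to be of smaller order than \<open>s = n \<epsilon>\<^sub>n\<^sup>2\<close> will be at most \<open>\<kappa> s\<close>, and all of
    them together, with their constants, at most \<open>s / 32\<close>.\<close>
  define \<kappa> where "\<kappa> = 1 / (32 * (4 + c0 + c1 + Q))"
  have \<kappa>: "0 < \<kappa>" unfolding \<kappa>_def using c0 c1 Q by simp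
  have \<kappa>_sum: "\<kappa> * (4 + c0 + c1 + Q) = 1 / 32" unfolding \<kappa>_def using c0 c1 Q by simp
  have \<kappa>_le: "\<kappa> \<le> 1 / 32"
    using \<kappa>_sum \<kappa> c0 c1 Q mult_left_mono[of 1 "4 + c0 + c1 + Q" \<kappa>] by linarith
  \<comment> \<open>The factor \<open>ln 2 \<le> ln K\<^sub>n\<close> makes this a bound for \<open>rbar n\<close> itself, too.\<close>
  have "\<forall>\<^sub>F n in sequentially. real (rbar n) * ln (real (K n)) \<le> (\<kappa> * ln 2) * ?s n"
    using \<kappa> by (intro asymp_less_eventually_le[OF rbar_K s_pos]) auto
  moreover have "\<forall>\<^sub>F n in sequentially. real (rbar n) * ln (1 / (\<epsilon> n)\<^sup>2) \<le> \<kappa> * ?s n"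
    by (rule asymp_less_eventually_le[OF rbar_eps s_pos \<kappa>])
  moreover have "\<forall>\<^sub>F n in sequentially. real (rbar n) *
        ln (glm_D a b (real (rbar n) * sqrt (?s n * B_tilde (K n) (V n) (rbar n)))) \<le> \<kappa> * ?s n"
    by (rule asymp_less_eventually_le[OF rbar_D s_pos \<kappa>])
  moreover have "\<forall>\<^sub>F n in sequentially. B_inv (K n) (V n) (r n) \<le> \<kappa> * ?s n"
    by (rule asymp_less_eventually_le[OF B_small s_pos \<kappa>])
  moreover have "\<forall>\<^sub>F n in sequentially. real (r n) * ln (B_bar (K n) (V n) (r n)) \<le> \<kappa> * ?s n"
    by (rule asymp_less_eventually_le[OF Bbar_small s_pos \<kappa>])
  moreover have "\<forall>\<^sub>F n in sequentially. Delta (K n) (\<beta>_true n) (r n) \<le> (\<delta> / 4) * (\<epsilon> n)\<^sup>2"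
    using \<delta>(1) by (intro asymp_less_eventually_le[OF Delta_small e2_pos]) auto
  moreover have "\<forall>\<^sub>F n in sequentially. 32 * ln (4 / \<rho>) \<le> ?s n"
    by (rule asymp_less_eventually_ge[OF eps_rate s_pos])
  ultimately show ?thesis
    using eventually_ge_at_top[of 1]
  proof eventually_elim
    case (elim n)
    note ev = elim(1-7) and n = elim(8)
    let ?K = "K n" and ?r = "r n" and ?m = "rbar n" and ?e = "(\<epsilon> n)\<^sup>2" and ?V = "V n" and ?\<beta> = "\<beta>_true n"
    define s where "s = ?s n"
    have s: "0 < s" unfolding s_def by (rule s_pos[OF n])
    have eps: "0 < \<epsilon> n" "\<epsilon> n \<le> 1" using eps_range[OF n] by auto
    have e: "0 < ?e" "?e \<le> 1" using eps by (auto simp: power_le_one)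
    have r: "1 \<le> ?r" "?r \<le> ?m" "?m < ?K" using r_range[OF n] by auto
    have K: "2 \<le> ?K" using r by linarith
    have lnK: "ln 2 \<le> ln (real ?K)" using K by simp
    have Le: "0 \<le> ln (1 / ?e)" using e by simp
    have m_s: "real ?m \<le> \<kappa> * s"
    proof -
      have "real ?m * ln 2 \<le> real ?m * ln (real ?K)" using lnK by (intro mult_left_mono) auto
      also have "\<dots> \<le> \<kappa> * s * ln 2" using ev(1) by (simp add: s_def mult_ac)
      finally show ?thesis by simp
    qed
    have K_s: "real ?m * ln (real ?K) \<le> \<kappa> * s"
    proof -
      have "\<kappa> * s * ln 2 \<le> \<kappa> * s * 1"
        using \<kappa> s ln_2_less_1 by (intro mult_left_mono) auto
      then show ?thesis using ev(1) by (simp add: s_def mult_ac)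
    qed
    have r_m: "real ?r \<le> real ?m" using r by simp
    have models_ne: "models_of_size ?K ?r \<noteq> {}"
    proof -
      have "{1..?r} \<in> models_of_size ?K ?r" unfolding models_of_size_def using r by auto
      then show ?thesis by blast
    qed
    have "Delta ?K ?\<beta> ?r < \<delta> / 2 * ?e"
    proof -
      have "\<delta> / 4 * ?e < \<delta> / 2 * ?e" using \<delta>(1) e(1) by (intro mult_strict_right_mono) auto
      then show ?thesis using ev(6) by linarith
    qed
    then have "\<exists>x\<in>(\<lambda>\<gamma>. \<Sum>j\<in>{1..?K} - \<gamma>. \<bar>?\<beta> j\<bar>) ` models_of_size ?K ?r. x < \<delta> / 2 * ?e"
      unfolding Delta_def using models_ne by (intro cInf_lessD) simp_all
    then obtain \<gamma> where \<gamma>m: "\<gamma> \<in> models_of_size ?K ?r" and \<gamma>D: "(\<Sum>j\<in>{1..?K} - \<gamma>. \<bar>?\<beta> j\<bar>) < \<delta> / 2 * ?e"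
      by blast
    have \<gamma>: "\<gamma> \<subseteq> {1..?K}" "card \<gamma> = ?r" using \<gamma>m unfolding models_of_size_def by auto
    define w0 where "w0 = \<delta> * ?e / (2 * real ?r)"
    have w0: "0 \<le> w0" "real ?r * w0 = \<delta> / 2 * ?e" unfolding w0_def using \<delta> e r by simp_all
    define \<tau> where "\<tau> = \<delta> * ?e"
    have \<tau>: "real ?r * w0 + (\<Sum>j\<in>{1..?K} - \<gamma>. \<bar>?\<beta> j\<bar>) \<le> \<tau>" "\<tau> \<le> 1"
    proof -
      show "real ?r * w0 + (\<Sum>j\<in>{1..?K} - \<gamma>. \<bar>?\<beta> j\<bar>) \<le> \<tau>"
        using w0(2) \<gamma>D unfolding \<tau>_def by linarith
      show "\<tau> \<le> 1" unfolding \<tau>_def using \<delta> e by (intro mult_le_one) auto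
    qed
    have Mn: "(\<Sum>j\<in>{1..?K}. \<bar>?\<beta> j\<bar>) \<le> M" using M(2)[of n] by simp
    have n\<tau>: "real n * (\<Lambda> * \<tau>) \<le> s / 32"
    proof -
      have "real n * (\<Lambda> * \<tau>) = (\<Lambda> * \<delta>) * s" unfolding \<tau>_def s_def by simp
      also have "\<dots> \<le> 1 / 32 * s" using s by (intro mult_right_mono \<delta>(3)) simp
      finally show ?thesis by simp
    qed
    have "0 < ch1 (?V \<gamma>)" using ch1_pos[OF V_pos_def[OF n \<gamma>(1)]] \<gamma>(2) r by simp
    then have Bbar: "0 < B_bar ?K ?V ?r" using ch1_le_B_bar[OF \<gamma>m, of ?V] by linarith
    have Qs: "(\<Sum>j\<in>\<gamma>. (\<bar>?\<beta> j\<bar> + w0)\<^sup>2) \<le> Q"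
    proof -
      have fin: "finite \<gamma>" using \<gamma>(1) by (rule finite_subset) simp
      have "(\<Sum>j\<in>\<gamma>. (\<bar>?\<beta> j\<bar> + w0)\<^sup>2) \<le> (\<Sum>j\<in>\<gamma>. \<bar>?\<beta> j\<bar> + w0)\<^sup>2"
        using w0 by (intro sum_squares_le_square_sum) auto
      also have "(\<Sum>j\<in>\<gamma>. \<bar>?\<beta> j\<bar> + w0) = (\<Sum>j\<in>\<gamma>. \<bar>?\<beta> j\<bar>) + real ?r * w0"
        using \<gamma>(2) by (simp add: sum.distrib)
      also have "((\<Sum>j\<in>\<gamma>. \<bar>?\<beta> j\<bar>) + real ?r * w0)\<^sup>2 \<le> (M + 1)\<^sup>2"
      proof (rule power_mono)
        have "(\<Sum>j\<in>\<gamma>. \<bar>?\<beta> j\<bar>) \<le> (\<Sum>j\<in>{1..?K}. \<bar>?\<beta> j\<bar>)" by (rule sum_mono2) (use \<gamma> in auto)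
        moreover have "real ?r * w0 \<le> 1"
        proof -
          have "0 \<le> (\<Sum>j\<in>{1..?K} - \<gamma>. \<bar>?\<beta> j\<bar>)" by (rule sum_nonneg) simp
          then show ?thesis using \<tau> by linarith
        qed
        ultimately show "(\<Sum>j\<in>\<gamma>. \<bar>?\<beta> j\<bar>) + real ?r * w0 \<le> M + 1" using Mn by linarith
        show "0 \<le> (\<Sum>j\<in>\<gamma>. \<bar>?\<beta> j\<bar>) + real ?r * w0"
          using w0(1) by (intro add_nonneg_nonneg sum_nonneg mult_nonneg_nonneg) auto
      qed
      finally show ?thesis unfolding Q_def .
    qed
    define E0 where "E0 = exp (- s / 8)"
    let ?mass = "(real ?r / real ?K) ^ ?r * (1 - real ?r / real ?K) ^ (?K - ?r)
      * ((2 * w0) ^ ?r * (exp (- B_inv ?K ?V ?r * Q / 2) / sqrt ((2 * pi * B_bar ?K ?V ?r) ^ ?r)))"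
    have "exp (- (s / 32)) \<le> ?mass"
      unfolding w0_def
    proof (rule box_mass_ge)
      have "real ?r * ln (real ?K) \<le> \<kappa> * s"
      proof -
        have "0 \<le> ln (real ?K)" using K by simp
        then show ?thesis using K_s mult_right_mono[OF r_m, of "ln (real ?K)"] by linarith
      qed
      moreover have "real ?r * ln (1 / ?e) \<le> \<kappa> * s"
        using ev(2)[folded s_def] mult_right_mono[OF r_m Le] by linarith
      moreover have "real ?r * c0 \<le> \<kappa> * s * c0"
        using m_s r_m c0 by (intro mult_right_mono) auto
      moreover have "B_inv ?K ?V ?r * Q / 2 \<le> \<kappa> * s * Q"
      proof -
        have "B_inv ?K ?V ?r * Q \<le> \<kappa> * s * Q" using ev(4)[folded s_def] Q by (intro mult_right_mono) auto
        moreover have "0 \<le> \<kappa> * s * Q" using \<kappa> s Q by simp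
        ultimately show ?thesis by linarith
      qed
      moreover have "real ?r * ln (B_bar ?K ?V ?r) / 2 \<le> \<kappa> * s"
        using ev(5)[folded s_def] mult_pos_pos[OF \<kappa> s] by linarith
      moreover have "\<kappa> * s + \<kappa> * s + \<kappa> * s * c0 + \<kappa> * s * Q + \<kappa> * s \<le> s / 32"
      proof -
        have "\<kappa> * s + \<kappa> * s + \<kappa> * s * c0 + \<kappa> * s * Q + \<kappa> * s \<le> (\<kappa> * s) * (4 + c0 + c1 + Q)"
          using mult_nonneg_nonneg[OF less_imp_le[OF mult_pos_pos[OF \<kappa> s]] c1] mult_pos_pos[OF \<kappa> s]
          by (simp add: distrib_left)
        also have "\<dots> = s * (\<kappa> * (4 + c0 + c1 + Q))" by (simp add: mult_ac)
        finally show ?thesis unfolding \<kappa>_sum by simp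
      qed
      ultimately show "real ?r * ln (real ?K) + real ?r * ln (1 / ?e)
          + real ?r * (1 + ln (1 / \<delta>) + ln (2 * pi) / 2)
          + B_inv ?K ?V ?r * Q / 2 + real ?r * ln (B_bar ?K ?V ?r) / 2 \<le> s / 32"
        unfolding c0_def[symmetric] by linarith
    qed (use r \<delta> e Bbar in auto)
    then have "E0 * exp (real n * (\<Lambda> * \<tau>)) \<le> ?mass"
    proof -
      assume mass: "exp (- (s / 32)) \<le> ?mass"
      have "E0 * exp (real n * (\<Lambda> * \<tau>)) = exp (- s / 8 + real n * (\<Lambda> * \<tau>))"
        unfolding E0_def by (simp only: exp_add)
      also have "\<dots> \<le> exp (- (s / 32))" using n\<tau> s by simp
      finally show ?thesis using mass by linarith
    qed
    then have "ennreal (E0 * exp (real n * (\<Lambda> * \<tau>))) \<le> ennreal ?mass" by (rule ennreal_leI)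
    also have "\<dots> \<le> emeasure (\<pi> n)
        {\<theta> \<in> space (param_space ?K). fst \<theta> = \<gamma> \<and> (\<forall>j\<in>fst \<theta>. \<bar>snd \<theta> j - ?\<beta> j\<bar> \<le> w0)}"
      unfolding Pi_eq
    proof (rule prior_box[OF r])
      show "ch1 (?V \<gamma>) \<le> B_bar ?K ?V ?r" by (rule ch1_le_B_bar[OF \<gamma>m])
      show "ch1 (mat_inv (?V \<gamma>)) \<le> B_inv ?K ?V ?r" by (rule ch1_inv_le_B_inv[OF \<gamma>m])
      show "pos_def_mat (card \<gamma>') (?V \<gamma>')" if "\<gamma>' \<subseteq> {1..?K}" for \<gamma>' by (rule V_pos_def[OF n that])
    qed (fact \<gamma> w0(1) Qs)+
    finally have mass: "ennreal (E0 * exp (real n * (glm_lip a (M + 1) * \<tau>))) \<le> emeasure (\<pi> n)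
        {\<theta> \<in> space (param_space ?K). fst \<theta> = \<gamma> \<and> (\<forall>j\<in>fst \<theta>. \<bar>snd \<theta> j - ?\<beta> j\<bar> \<le> w0)}"
      unfolding \<Lambda>_def .
    define Bt where "Bt = B_tilde ?K ?V ?m"
    have Bt: "0 < Bt"
    proof -
      have ne: "\<gamma> \<noteq> {}" using \<gamma>(2) r by auto
      have "0 < ch1 (?V \<gamma>)" using ch1_pos[OF V_pos_def[OF n \<gamma>(1)]] \<gamma>(2) r by simp
      also have "\<dots> \<le> Bt" unfolding Bt_def using \<gamma> r ne by (intro ch1_le_B_tilde) auto
      finally show ?thesis .
    qed
    \<comment> \<open>Coefficients are cut off where the Gaussian tail has dropped to \<open>exp (- s / 4)\<close>.\<close>
    define C where "C = sqrt (s * Bt)"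
    have C: "0 \<le> C" "C\<^sup>2 = s * Bt" unfolding C_def using s Bt by auto
    define R where "R = real ?m * C"
    have R: "0 \<le> R" unfolding R_def using C by simp
    define L where "L = glm_lip a R"
    have L: "0 < L" unfolding L_def by (rule glm_lip_pos[OF glm R])
    have m0: "0 < real ?m" using r by simp
    \<comment> \<open>At this mesh the likelihood varies within a cell by a factor of at most \<open>exp s\<close>.\<close>
    define w where "w = ?e / (L * real ?m)"
    have w: "0 < w" unfolding w_def using e L m0 by simp
    have nw: "real n * (L * (real ?m * w)) = s" unfolding w_def s_def using L m0 by simp
    have Cw: "2 * C / w = 2 * (R * L / ?e)" unfolding w_def R_def using L m0 e by (simp add: field_simps)
    note D = glm_D_ge[OF glm R, folded L_def p_def]
    have "(real (?K + 1) * (2 * C / w + 2)) ^ ?m \<le> exp (real ?m * ln (real ?K)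
        + real ?m * ln (glm_D a b R) + real ?m * ln (1 / ?e) + real ?m * ln (2 * (2 / p + 2)))"
      unfolding Cw
    proof (rule net_size_le[OF e D(1) p])
      show "R * L / ?e \<le> glm_D a b R / p / ?e" using D(2) e by (intro divide_right_mono) auto
    qed (use K R L e in auto)
    also have "\<dots> \<le> exp (s / 32)"
    proof -
      have "real ?m * ln (glm_D a b R) \<le> \<kappa> * s" using ev(3) unfolding R_def C_def Bt_def s_def .
      moreover have "real ?m * c1 \<le> \<kappa> * s * c1" using m_s c1 by (intro mult_right_mono)
      moreover have "\<kappa> * s + \<kappa> * s + \<kappa> * s + \<kappa> * s * c1 \<le> s / 32"
      proof -
        have ks: "0 \<le> \<kappa> * s" using \<kappa> s by simp
        have "\<kappa> * s + \<kappa> * s + \<kappa> * s + \<kappa> * s * c1 \<le> (\<kappa> * s) * (4 + c0 + c1 + Q)"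
          using mult_nonneg_nonneg[OF ks c0] mult_nonneg_nonneg[OF ks Q] ks by (simp add: distrib_left)
        also have "\<dots> = s * (\<kappa> * (4 + c0 + c1 + Q))" by (simp add: mult_ac)
        finally show ?thesis unfolding \<kappa>_sum by simp
      qed
      ultimately show ?thesis using K_s ev(2)[folded s_def] unfolding c1_def[symmetric] by simp
    qed
    finally have net: "(real (?K + 1) * (2 * C / w + 2)) ^ ?m \<le> exp (s / 32)" .
    have E0: "0 < E0" unfolding E0_def by simp
    let ?\<theta>s = "({1..?K}, ?\<beta>)"
    let ?u1 = "1 / E0 * (sqrt (2 ^ ?m) * exp (- C\<^sup>2 / (4 * Bt)))"
    let ?u2 = "(real (?K + 1) * (2 * C / w + 2)) ^ ?m
         * (sqrt (exp (real n * (glm_lip a (real ?m * C) * (real ?m * w))) / E0) * exp (- (real n * (2 * \<epsilon> n)\<^sup>2 / 2)))"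
    have far: "(\<integral>\<^sup>+D. emeasure (posterior f (\<pi> n) n D)
        (far_params f ?K (\<nu>\<^sub>x n) ?\<theta>s (2 * \<epsilon> n))
        \<partial>data_law n (\<nu>\<^sub>x n) (model_density f ?\<theta>s)) \<le> ennreal (?u1 + ?u2)"
      unfolding Pi_eq
    proof (rule expected_posterior_far_le[where \<gamma> = \<gamma> and w\<^sub>0 = w0 and \<tau> = \<tau> and M = M,
          OF glm f_eq nu_prob[OF n] nu_sets[OF n] x_bounded[OF n] r])
      show "pos_def_mat (card \<gamma>') (?V \<gamma>')" if "\<gamma>' \<subseteq> {1..?K}" for \<gamma>' by (rule V_pos_def[OF n that])
      show "ch1 (?V \<gamma>') \<le> Bt" if "\<gamma>' \<subseteq> {1..?K}" "\<gamma>' \<noteq> {}" "card \<gamma>' \<le> ?m" for \<gamma>'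
        unfolding Bt_def by (rule ch1_le_B_tilde[OF that])
      show "0 \<le> 2 * \<epsilon> n" using eps by simp
    qed (fact \<gamma> w0(1) \<tau> Mn E0 mass[unfolded Pi_eq] C(1) w)+
    have u1: "?u1 \<le> exp (- (s / 16))"
    proof -
      have "sqrt (2 ^ ?m) \<le> exp (s / 32)"
      proof -
        have "sqrt (2 ^ ?m) \<le> 2 ^ ?m" by (rule real_sqrt_le_iff[THEN iffD2, of _ "(2 ^ ?m)\<^sup>2", simplified]) (simp add: power2_eq_square)
        also have "(2::real) ^ ?m \<le> exp 1 ^ ?m" using exp_ge_add_one_self[of 1] by (intro power_mono) auto
        also have "\<dots> = exp (real ?m)" by (simp add: exp_of_nat_mult[symmetric])
        also have "\<dots> \<le> exp (s / 32)"
        proof -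
          have "\<kappa> * s \<le> 1 / 32 * s" using s \<kappa>_le by (intro mult_right_mono) auto
          then show ?thesis using m_s by simp
        qed
        finally show ?thesis .
      qed
      moreover have "- C\<^sup>2 / (4 * Bt) = - (s / 4)" unfolding C(2) using Bt by simp
      moreover have "1 / E0 = exp (s / 8)" unfolding E0_def by (simp add: exp_minus field_simps)
      ultimately have "?u1 \<le> exp (s / 8) * (exp (s / 32) * exp (- (s / 4)))"
        by (simp only:) (intro mult_left_mono mult_right_mono, auto)
      also have "\<dots> = exp (s / 8 + (s / 32 + - (s / 4)))" by (simp only: exp_add)
      also have "\<dots> \<le> exp (- (s / 16))" using s by simp
      finally show ?thesis .
    qed
    have u2: "?u2 \<le> exp (- (s / 16))"
    proof -
      have "exp (real n * (glm_lip a (real ?m * C) * (real ?m * w))) / E0 = exp (9 / 8 * s)"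
        unfolding R_def[symmetric] L_def[symmetric] nw E0_def exp_diff[symmetric] by simp
      also have "\<dots> = (exp (9 / 16 * s))\<^sup>2" unfolding exp_double[symmetric] by simp
      finally have "sqrt (exp (real n * (glm_lip a (real ?m * C) * (real ?m * w))) / E0) = exp (9 / 16 * s)" by simp
      moreover have "real n * (2 * \<epsilon> n)\<^sup>2 / 2 = 2 * s" unfolding s_def by (simp add: power_mult_distrib)
      ultimately have "?u2 \<le> exp (s / 32) * (exp (9 / 16 * s) * exp (- (2 * s)))"
        by (simp only:) (intro mult_right_mono net, simp)
      also have "\<dots> = exp (s / 32 + (9 / 16 * s + - (2 * s)))" by (simp only: exp_add)
      also have "\<dots> \<le> exp (- (s / 16))" using s by simp
      finally show ?thesis .
    qed
    have small: "exp (- (s / 16)) \<le> \<rho> * \<epsilon> n / 4"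
    proof -
      have "1 \<le> real ?m" using r by simp
      from mult_right_mono[OF this Le] have "ln (1 / ?e) \<le> real ?m * ln (1 / ?e)" by simp
      also have "\<dots> \<le> \<kappa> * s" using ev(2) unfolding s_def .
      also have "\<dots> \<le> 1 / 32 * s" using s \<kappa>_le by (intro mult_right_mono) auto
      finally have "- ln (\<epsilon> n) \<le> s / 32"
        using eps s by (simp add: ln_div ln_realpow)
      then have 1: "exp (- (s / 32)) \<le> \<epsilon> n"
        using eps by (subst ln_ge_iff[symmetric]) auto
      have "ln (4 / \<rho>) \<le> s / 32" using ev(7) unfolding s_def by simp
      then have "- (s / 32) \<le> ln (\<rho> / 4)" using rho_pos by (simp add: ln_div)
      then have 2: "exp (- (s / 32)) \<le> \<rho> / 4" using rho_pos by (subst ln_ge_iff[symmetric]) auto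
      have "exp (- (s / 16)) = exp (- (s / 32)) * exp (- (s / 32))" unfolding exp_add[symmetric] by simp
      also have "\<dots> \<le> \<rho> / 4 * \<epsilon> n" using rho_pos by (intro mult_mono 1 2) auto
      finally show ?thesis by simp
    qed
    have "ennreal (?u1 + ?u2) \<le> ennreal (\<rho> * \<epsilon> n / 2)"
      using u1 u2 small by (intro ennreal_leI) linarith
    with far have far': "(\<integral>\<^sup>+D. emeasure (posterior f (\<pi> n) n D)
        (far_params f ?K (\<nu>\<^sub>x n) ?\<theta>s (2 * \<epsilon> n))
        \<partial>data_law n (\<nu>\<^sub>x n) (model_density f ?\<theta>s)) \<le> ennreal (\<rho> * \<epsilon> n / 2)"
      by (rule order_trans)
    have prior: "prob_space (\<pi> n)" "sets (\<pi> n) = sets (param_space ?K)"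
      unfolding Pi_eq using V_pos_def[OF n] by (intro prob_space_prior[OF r] sets_prior[OF r]; blast)+
    have "(\<integral>D. misclass_prob (P n) (classifier (p_hat n D)) \<partial>PD n) - misclass_prob (P n) (classifier (p_true n))
        \<le> 2 * (2 * \<epsilon> n) + 2 * (\<rho> * \<epsilon> n / 2) / \<rho>"
      unfolding P_eq PD_eq p_true_eq p_hat_eq
    proof (rule expected_excess_risk_le[OF glm f_eq nu_prob[OF n] nu_sets[OF n] _ prior rho_pos _ _ _ far'])
      show "AE D in data_law n (\<nu>\<^sub>x n) (model_density f ?\<theta>s).
          \<rho> < measure (posterior f (\<pi> n) n D) (sel_event f ?K (A n D))"
        using A_mass[OF n] unfolding PD_eq p_true_eq .
    qed (use eps rho_pos in simp_all)
    also have "\<dots> = 5 * \<epsilon> n" using rho_pos by simp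
    finally show ?case .
  qed
qed

end
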